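(* Let the operators $A$, $\Sigma_0$, the truth $u^\dagger$ and the initial element $\zeta_0$ satisfy Assumption A (in the context), and let $\zeta_n$ be the 3DVAR iterates computed from Data Model 1 with parameter $\alpha$. Then there is a constant $C$, independent of $n$, $\gamma$ and $\alpha$, such that for all $n\ge 2$ $$\mathbb{E}\|\zeta_n-u^\dagger\|^2\le C\left(\frac{\alpha}{n}\right)^{\frac{s}{a+1}}+C\,\frac{\gamma^2\ln n}{\alpha}\,\mathrm{tr}(\Sigma_0).$$ Moreover, there is a constant $C'$, independent of $N$ and $\gamma$, such that for every integer $N\ge 2$, if one sets $\alpha=N^{\frac{s}{s+a+1}}$ and stops the iteration at $n=N$, then $$\mathbb{E}\|\zeta_N-u^\dagger\|^2\le C'\left(1+\gamma^2\,\mathrm{tr}(\Sigma_0)\right)N^{-\frac{s}{s+a+1}}\ln N.$$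
   Context: $X,Y$ are Hilbert spaces, $A$ is a compact linear operator from $X$ to $Y$, $u^\dagger\in X$ is a fixed (deterministic) element, $\gamma>0$, $\alpha>0$. $\|\cdot\|$ denotes the norm of $X$ (also of $Y$ and operator norms), $\mathcal{R}$ and $\mathcal{D}$ denote range and domain. $\mathcal{N}(0,\gamma^2 I)$ is the centred Gaussian on $Y$ with covariance $\gamma^2 I$ (Gaussian white noise if $Y$ is infinite dimensional, so that $\mathbb{E}\|F\eta\|^2=\gamma^2\,\mathrm{tr}(FF^* )$ for $\eta\sim\mathcal{N}(0,\gamma^2I)$ and a bounded linear $F:Y\to X$). Data Model 1: $y_n=Au^\dagger+\eta_n$, $n\ge1$, with $\eta_n$ i.i.d. $\mathcal{N}(0,\gamma^2I)$. 3DVAR: given $\zeta_0\in X$, for $n\ge1$ $$\zeta_n=\zeta_{n-1}+\mathcal{K}(y_n-A\zeta_{n-1}),\qquad \mathcal{K}=\Sigma_0A^*(A\Sigma_0A^*+\alpha I)^{-1}.$$ Assumption A: (i) the filter covariance is $C_0=\frac{\gamma^2}{\alpha}\Sigma_0$ and $\mathcal{R}(\Sigma_0^{1/2})\subset\mathcal{D}(A)$, where $\alpha>0$ is a constant, $\Sigma_0$ is positive self-adjoint on $X$, and $\Sigma_0^{-1}$ is a densely defined unbounded self-adjoint strictly positive operator; (ii) there are constants $a>0$ and $1\le c<\infty$ with $c^{-1}\|\Sigma_0^{a/2}x\|\le\|Ax\|\le c\|\Sigma_0^{a/2}x\|$ for all $x\in X$; (iii) $\zeta_0-u^\dagger\in\mathcal{D}(\Sigma_0^{-s/2})$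 with $0\le s\le a+2$; (iv) $\Sigma_0$ is trace class on $X$. *)

theory Defs
  imports "HOL-Probability.Probability"
begin

section \<open>Operators on real Hilbert spaces\<close>

text \<open>A real Hilbert space is a type of sort \<open>{real_inner, banach}\<close>. A densely defined
  operator is given by its domain and a function whose values off the domain are irrelevant.\<close>

definition compact_operator ::
  "('x::real_normed_vector \<Rightarrow> 'y::real_normed_vector) \<Rightarrow> bool" where
  "compact_operator T \<longleftrightarrow> bounded_linear T \<and> compact (closure (T ` cball 0 1))"

definition positive_selfadjoint :: "('x::real_inner \<Rightarrow> 'x) \<Rightarrow> bool" where
  "positive_selfadjoint T \<longleftrightarrow>
     bounded_linear T \<and> (\<forall>x y. T x \<bullet> y = x \<bullet> T y) \<and> (\<forall>x. 0 \<le> T x \<bullet> x)"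

text \<open>The equivalence says that the graph of the adjoint of \<open>T\<close> is the graph of \<open>T\<close>, so it
  contains the equality of the two domains.\<close>

definition selfadjoint_on :: "'x set \<Rightarrow> ('x::real_inner \<Rightarrow> 'x) \<Rightarrow> bool" where
  "selfadjoint_on D T \<longleftrightarrow>
     subspace D \<and> closure D = UNIV \<and>
     (\<forall>x\<in>D. \<forall>y\<in>D. \<forall>r t. T (r *\<^sub>R x + t *\<^sub>R y) = r *\<^sub>R T x + t *\<^sub>R T y) \<and>
     (\<forall>y z. (\<forall>x\<in>D. T x \<bullet> y = x \<bullet> z) \<longleftrightarrow> y \<in> D \<and> z = T y)"

definition unbounded_on ::
  "'x set \<Rightarrow> ('x::real_normed_vector \<Rightarrow> 'y::real_normed_vector) \<Rightarrow> bool" where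
  "unbounded_on D T \<longleftrightarrow> (\<nexists>B. \<forall>x\<in>D. norm (T x) \<le> B * norm x)"

definition strictly_positive_on :: "'x set \<Rightarrow> ('x::real_inner \<Rightarrow> 'x) \<Rightarrow> bool" where
  "strictly_positive_on D T \<longleftrightarrow> (\<forall>x\<in>D. x \<noteq> 0 \<longrightarrow> 0 < T x \<bullet> x)"

definition orthonormal_basis :: "'x::real_inner set \<Rightarrow> bool" where
  "orthonormal_basis E \<longleftrightarrow>
     pairwise orthogonal E \<and> (\<forall>e\<in>E. norm e = 1) \<and> closure (span E) = UNIV"

text \<open>The next two notions are meant for positive self-adjoint \<open>T\<close>: then \<open>|T| = T\<close>, and neither
  summability nor the sum depends on the orthonormal basis.\<close>

definition trace_class_pos :: "('x::real_inner \<Rightarrow> 'x) \<Rightarrow> bool" where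
  "trace_class_pos T \<longleftrightarrow> (\<exists>E. orthonormal_basis E \<and> (\<lambda>e. T e \<bullet> e) summable_on E)"

definition op_trace :: "('x::real_inner \<Rightarrow> 'x) \<Rightarrow> real" where
  "op_trace T = (\<Sum>\<^sub>\<infinity>e\<in>(SOME E. orthonormal_basis E). T e \<bullet> e)"


subsection \<open>Real powers\<close>

text \<open>For \<open>T\<close> compact, self-adjoint and positive with trivial kernel, the spectral theorem reads
  \<open>T x = (\<Sum>\<^sub>\<infinity>l. l *\<^sub>R P\<^sub>l x)\<close>, with \<open>P\<^sub>l\<close> the orthogonal projection onto the eigenspace of the
  eigenvalue \<open>l > 0\<close>. The functional calculus gives \<open>T\<close> to the power \<open>p\<close>, for every real \<open>p\<close>, as
  \<open>x \<mapsto> (\<Sum>\<^sub>\<infinity>l. l powr p *\<^sub>R P\<^sub>l x)\<close>. The terms are pairwise orthogonal, so its domain, the set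
  of all \<open>x\<close> with finite \<open>(\<Sum>\<^sub>\<infinity>l. l powr (2 * p) * (norm (P\<^sub>l x))\<^sup>2)\<close>, is the set of all \<open>x\<close> for
  which the vector-valued series is summable.\<close>

definition eigenspace :: "('x::real_vector \<Rightarrow> 'x) \<Rightarrow> real \<Rightarrow> 'x set" where
  "eigenspace T l = {x. T x = l *\<^sub>R x}"

definition pos_eigenvalues :: "('x::real_vector \<Rightarrow> 'x) \<Rightarrow> real set" where
  "pos_eigenvalues T = {l. 0 < l \<and> eigenspace T l \<noteq> {0}}"

definition orth_proj :: "'x::real_inner set \<Rightarrow> 'x \<Rightarrow> 'x" where
  "orth_proj V x = (THE v. v \<in> V \<and> (\<forall>w\<in>V. (x - v) \<bullet> w = 0))"

definition op_power :: "('x::real_inner \<Rightarrow> 'x) \<Rightarrow> real \<Rightarrow> 'x \<Rightarrow> 'x" where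
  "op_power T p x = (\<Sum>\<^sub>\<infinity>l\<in>pos_eigenvalues T. (l powr p) *\<^sub>R orth_proj (eigenspace T l) x)"

definition op_power_dom :: "('x::real_inner \<Rightarrow> 'x) \<Rightarrow> real \<Rightarrow> 'x set" where
  "op_power_dom T p =
     {x. (\<lambda>l. (l powr p) *\<^sub>R orth_proj (eigenspace T l) x) summable_on pos_eigenvalues T}"


section \<open>The smoothness assumption\<close>

text \<open>The operator \<open>A\<close> is defined on the whole space, so the inclusion of the range of the square
  root of \<open>S\<close> in the domain of \<open>A\<close> is automatic. The inverse of \<open>S\<close> is \<open>inv S\<close> with domain
  \<open>range S\<close>.\<close>

definition assumption_A ::
  "('x::{real_inner,banach} \<Rightarrow> 'y::{real_inner,banach}) \<Rightarrow> ('x \<Rightarrow> 'x) \<Rightarrow> 'x \<Rightarrow> 'x \<Rightarrow>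
   real \<Rightarrow> real \<Rightarrow> real \<Rightarrow> bool" where
  "assumption_A A S u z0 a c s \<longleftrightarrow>
     positive_selfadjoint S \<and> inj S \<and>
     selfadjoint_on (range S) (inv S) \<and> unbounded_on (range S) (inv S) \<and>
     strictly_positive_on (range S) (inv S) \<and>
     0 < a \<and> 1 \<le> c \<and>
     (\<forall>x. inverse c * norm (op_power S (a / 2) x) \<le> norm (A x) \<and>
          norm (A x) \<le> c * norm (op_power S (a / 2) x)) \<and>
     0 \<le> s \<and> s \<le> a + 2 \<and> z0 - u \<in> op_power_dom S (- s / 2) \<and>
     trace_class_pos S"


section \<open>Gaussian white noise\<close>

text \<open>A random element of \<open>'y\<close>, possibly generalized, is represented by the real random variables
  \<open>\<eta> v\<close> that stand for the inner products of \<open>\<eta>\<close> with \<open>v\<close>. If \<open>'y\<close> is infinite dimensional,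
  the Gaussian with covariance \<open>\<gamma>\<^sup>2 I\<close> exists only in this sense. Linearity up to null sets makes
  the finite-dimensional distributions jointly Gaussian, and polarization gives covariance
  \<open>\<gamma>\<^sup>2 * (v \<bullet> w)\<close> for \<open>\<eta> v\<close> and \<open>\<eta> w\<close>. The vector \<open>v = 0\<close> is excluded from the density
  condition because \<open>\<eta> 0\<close> vanishes almost surely. The parameter of \<open>normal_density\<close> is the
  standard deviation.\<close>

definition white_noise ::
  "'w measure \<Rightarrow> real \<Rightarrow> ('y::real_inner \<Rightarrow> 'w \<Rightarrow> real) \<Rightarrow> bool" where
  "white_noise M \<gamma> \<eta> \<longleftrightarrow>
     (\<forall>v. \<eta> v \<in> borel_measurable M) \<and>
     (\<forall>v w r t. AE \<omega> in M. \<eta> (r *\<^sub>R v + t *\<^sub>R w) \<omega> = r * \<eta> v \<omega> + t * \<eta> w \<omega>) \<and>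
     (\<forall>v. v \<noteq> 0 \<longrightarrow> distributed M lborel (\<eta> v) (normal_density 0 (\<gamma> * norm v)))"

definition iid_white_noise ::
  "'w measure \<Rightarrow> real \<Rightarrow> (nat \<Rightarrow> 'y::real_inner \<Rightarrow> 'w \<Rightarrow> real) \<Rightarrow> bool" where
  "iid_white_noise M \<gamma> \<eta> \<longleftrightarrow>
     (\<forall>n\<ge>1. white_noise M \<gamma> (\<eta> n)) \<and>
     prob_space.indep_vars M (\<lambda>_. \<Pi>\<^sub>M v\<in>UNIV. borel) (\<lambda>n \<omega> v. \<eta> n v \<omega>) {1..}"

definition data_model ::
  "'w measure \<Rightarrow> ('x \<Rightarrow> 'y::real_inner) \<Rightarrow> 'x \<Rightarrow> real \<Rightarrow> (nat \<Rightarrow> 'y \<Rightarrow> 'w \<Rightarrow> real) \<Rightarrow> bool" where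
  "data_model M A u \<gamma> y \<longleftrightarrow>
     (\<exists>\<eta>. iid_white_noise M \<gamma> \<eta> \<and> (\<forall>n\<ge>1. \<forall>v \<omega>. y n v \<omega> = A u \<bullet> v + \<eta> n v \<omega>))"

text \<open>\<open>op_image M F y Z\<close> says that the random element \<open>Z\<close> is (a version of) \<open>F y\<close> for a
  generalized random element \<open>y\<close>. If \<open>y v = (\<lambda>\<omega>. Y \<omega> \<bullet> v)\<close> for a genuine random element \<open>Y\<close>,
  the condition reads \<open>Z \<omega> \<bullet> x = F (Y \<omega>) \<bullet> x\<close>. For white noise and a Hilbert-Schmidt
  operator \<open>F\<close>, such a \<open>Z\<close> exists and is unique up to null sets.\<close>

definition op_image ::
  "'w measure \<Rightarrow> ('y::{real_inner,banach} \<Rightarrow> 'x::{real_inner,banach}) \<Rightarrow> ('y \<Rightarrow> 'w \<Rightarrow> real) \<Rightarrow>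
   ('w \<Rightarrow> 'x) \<Rightarrow> bool" where
  "op_image M F y Z \<longleftrightarrow>
     Z \<in> borel_measurable M \<and> (\<forall>x. AE \<omega> in M. Z \<omega> \<bullet> x = y (adjoint F x) \<omega>)"


section \<open>The 3DVAR iteration\<close>

definition gain ::
  "('x::{real_inner,banach} \<Rightarrow> 'y::{real_inner,banach}) \<Rightarrow> ('x \<Rightarrow> 'x) \<Rightarrow> real \<Rightarrow> 'y \<Rightarrow> 'x" where
  "gain A S \<alpha> v = S (adjoint A (inv (\<lambda>w. A (S (adjoint A w)) + \<alpha> *\<^sub>R w) v))"

definition threedvar ::
  "'w measure \<Rightarrow> ('x::{real_inner,banach} \<Rightarrow> 'y::{real_inner,banach}) \<Rightarrow> ('x \<Rightarrow> 'x) \<Rightarrow> real \<Rightarrow>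
   'x \<Rightarrow> (nat \<Rightarrow> 'y \<Rightarrow> 'w \<Rightarrow> real) \<Rightarrow> (nat \<Rightarrow> 'w \<Rightarrow> 'x) \<Rightarrow> bool" where
  "threedvar M A S \<alpha> z0 y \<zeta> \<longleftrightarrow>
     (\<forall>n. \<zeta> n \<in> borel_measurable M) \<and> (AE \<omega> in M. \<zeta> 0 \<omega> = z0) \<and>
     (\<forall>n\<ge>1. \<exists>Z. op_image M (gain A S \<alpha>) (\<lambda>v \<omega>. y n v \<omega> - A (\<zeta> (n - 1) \<omega>) \<bullet> v) Z \<and>
        (AE \<omega> in M. \<zeta> n \<omega> = \<zeta> (n - 1) \<omega> + Z \<omega>))"

end

theory Submission
  imports Defs
begin

text \<open>The error \<open>\<zeta>\<^sub>n - u\<close> is \<open>T\<^sup>n (z0 - u)\<close> plus the noise \<open>\<Sum>j<n. T\<^sup>j K \<eta>\<^sub>n\<^sub>-\<^sub>j\<close>, with \<open>K\<close>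
  the gain and \<open>T = I - K A\<close>. The adjoint \<open>R\<close> of \<open>T\<close> is symmetric for the form \<open>S x \<bullet> y\<close>, and
  \<open>0 \<le> R \<le> I\<close> there; so \<open>S (R\<^sup>k x) \<bullet> x\<close> is decreasing and convex in \<open>k\<close>. This gives
  \<open>\<parallel>K* R\<^sup>j x\<parallel>\<^sup>2 \<le> S x \<bullet> x / (2 \<alpha> (j + 1))\<close>, and summing over an orthonormal basis and over \<open>j < n\<close>
  yields the variance \<open>\<gamma>\<^sup>2 ln n tr S / \<alpha>\<close>. For the bias, work in the scale of norms
  \<open>\<Sum>l. l\<^sup>r \<parallel>P\<^sub>l x\<parallel>\<^sup>2\<close> of \<open>S\<close>. The powers of \<open>T\<close> are bounded for \<open>r = -1\<close> and, because
  \<open>\<parallel>A x\<parallel>\<close> is equivalent to the norm with \<open>r = a\<close>, for \<open>r = a\<close>; interpolation gives boundedness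
  for \<open>r = 0\<close>. The decrement bound gives the rate for \<open>s = a + 2\<close>, and splitting the spectrum
  of \<open>S\<close> at \<open>l = (\<alpha> / n) powr (1 / (a + 1))\<close> gives it for all smaller \<open>s\<close>.\<close>

section \<open>Projections, adjoints and coercive operators\<close>

text \<open>\<open>A\<close> and \<open>S\<close> need not commute, so \<open>T\<close> need not be
  self-adjoint and the functional calculus of \<open>S\<close> says nothing about its powers. The
  form natural for \<open>T\<close> is that of the unbounded inverse of \<open>S\<close>; passing to
  the adjoint \<open>R\<close> replaces it by the everywhere defined form of \<open>S\<close>, and
  \<open>T (S z) = S (R z)\<close> carries the estimates back. The data ask for \<open>R\<close> as
  well: white noise is known only through its pairings with vectors, so the error is tested against
  a vector and the powers of \<open>T\<close> move onto that vector. The factor 1 / (j + 1) makes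
  the variance a harmonic sum, hence the logarithm. For s = a + 2 the energy of order -1 gains one
  factor \<alpha> / n and that of order a gains two; order 0 lies at the fraction 1 / (a + 1) of the
  way from -1 to a, which gives the exponent (a + 2) / (a + 1). Each passage between
  \<open>A\<close> and the squared norm of order a costs a factor \<open>c\<^sup>2\<close>, whence
  the powers \<open>c ^ 4\<close>.\<close>

lemma bdd_below_dist_image: "bdd_below (dist x ` V)"
  by (rule bdd_belowI[of _ 0]) auto

text \<open>A minimizing sequence for the distance is Cauchy by the parallelogram law, and
  completeness supplies the nearest point.\<close>

lemma ex_orth_projection:
  fixes V :: "'a::{real_inner,banach} set"
  assumes "closed V" "subspace V"
  shows "\<exists>v\<in>V. \<forall>w\<in>V. (x - v) \<bullet> w = 0"
proof -
  define d where "d = infdist x V"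
  have V0: "0 \<in> V" using assms(2) by (simp add: subspace_0)
  have d0: "0 \<le> d" by (simp add: d_def infdist_nonneg)
  have dle: "d \<le> norm (x - w)" if "w \<in> V" for w
    using infdist_le[OF that, of x] by (simp add: d_def dist_norm)
  have "\<exists>v\<in>V. norm (x - v) < d + inverse (real (Suc n))" for n
  proof -
    have ne: "V \<noteq> {}" using V0 by blast
    have "(INF v\<in>V. dist x v) < d + inverse (real (Suc n))"
      using infdist_notempty[OF ne, of x] by (simp add: d_def)
    then show ?thesis
      using cINF_less_iff[OF ne bdd_below_dist_image, of x] by (simp add: dist_norm)
  qed
  then obtain v where vV: "\<And>n. v n \<in> V" and vd: "\<And>n. norm (x - v n) < d + inverse (real (Suc n))"
    by metis
  have lim: "(\<lambda>n. norm (x - v n)) \<longlonglongrightarrow> d"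
  proof (rule tendsto_sandwich[where f = "\<lambda>_. d" and h = "\<lambda>n. d + inverse (real (Suc n))"])
    show "(\<lambda>n. d + inverse (real (Suc n))) \<longlonglongrightarrow> d"
      using LIMSEQ_inverse_real_of_nat_add by simp
  qed (use dle vV vd in \<open>auto intro!: always_eventually less_imp_le\<close>)
  \<comment> \<open>Parallelogram law for \<open>x - v m\<close> and \<open>x - v n\<close>; the
    midpoint of \<open>v m\<close> and \<open>v n\<close> lies in \<open>V\<close>, so its distance
    from \<open>x\<close> is at least \<open>d\<close>.\<close>
  have para: "(norm (v m - v n))\<^sup>2 \<le> 2 * (norm (x - v m))\<^sup>2 + 2 * (norm (x - v n))\<^sup>2 - 4 * d\<^sup>2" for m n
  proof -
    have "(1/2) *\<^sub>R (v m + v n) \<in> V" using assms(2) vV by (simp add: subspace_add subspace_scale)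
    from dle[OF this] d0 have "d\<^sup>2 \<le> (norm (x - (1/2) *\<^sub>R (v m + v n)))\<^sup>2" by (simp add: power_mono)
    moreover have "(norm (v m - v n))\<^sup>2 = 2 * (norm (x - v m))\<^sup>2 + 2 * (norm (x - v n))\<^sup>2
        - 4 * (norm (x - (1/2) *\<^sub>R (v m + v n)))\<^sup>2"
      unfolding power2_norm_eq_inner by (simp add: algebra_simps inner_commute)
    ultimately show ?thesis by linarith
  qed
  have "Cauchy v"
  proof (rule metric_CauchyI)
    fix e :: real assume "0 < e"
    have "(\<lambda>n. (norm (x - v n))\<^sup>2) \<longlonglongrightarrow> d\<^sup>2" using lim by (rule tendsto_power)
    then have "eventually (\<lambda>n. (norm (x - v n))\<^sup>2 < d\<^sup>2 + e\<^sup>2 / 4) sequentially"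
      using \<open>0 < e\<close> by (intro order_tendstoD) auto
    then obtain N where N: "\<And>n. n \<ge> N \<Longrightarrow> (norm (x - v n))\<^sup>2 < d\<^sup>2 + e\<^sup>2 / 4"
      by (auto simp: eventually_sequentially)
    have "dist (v m) (v n) < e" if "m \<ge> N" "n \<ge> N" for m n
    proof -
      have "(norm (v m - v n))\<^sup>2 < e\<^sup>2" using para[of m n] N[OF that(1)] N[OF that(2)] by linarith
      then show ?thesis using \<open>0 < e\<close> by (simp add: dist_norm power_less_imp_less_base)
    qed
    then show "\<exists>M. \<forall>m\<ge>M. \<forall>n\<ge>M. dist (v m) (v n) < e" by blast
  qed
  then obtain p where p: "v \<longlonglongrightarrow> p" using Cauchy_convergent_iff convergent_def by blast
  have pV: "p \<in> V" using assms(1) vV p closed_sequentially by blast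
  have "(\<lambda>n. norm (x - v n)) \<longlonglongrightarrow> norm (x - p)" by (intro tendsto_intros p)
  then have np: "norm (x - p) = d" using lim LIMSEQ_unique by blast
  have "(x - p) \<bullet> w = 0" if w: "w \<in> V" for w
  proof (cases "w = 0")
    case False
    \<comment> \<open>This \<open>t\<close> minimizes the distance from \<open>x\<close> along the
      line through \<open>p\<close> in direction \<open>w\<close>.\<close>
    define t where "t = ((x - p) \<bullet> w) / (w \<bullet> w)"
    have "p + t *\<^sub>R w \<in> V" using assms(2) w pV by (simp add: subspace_add subspace_scale)
    from dle[OF this] d0 have "d\<^sup>2 \<le> (norm (x - (p + t *\<^sub>R w)))\<^sup>2" by (simp add: power_mono)
    also have "\<dots> = (norm ((x - p) - t *\<^sub>R w))\<^sup>2" by (simp add: algebra_simps)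
    also have "\<dots> = (norm (x - p))\<^sup>2 - 2 * t * ((x - p) \<bullet> w) + t\<^sup>2 * (w \<bullet> w)"
      by (simp only: power2_norm_eq_inner inner_diff_left inner_diff_right) (simp add: algebra_simps power2_eq_square inner_commute)
    also have "\<dots> = d\<^sup>2 - ((x - p) \<bullet> w)\<^sup>2 / (w \<bullet> w)"
      using False by (simp add: np t_def power2_eq_square field_simps)
    finally have "((x - p) \<bullet> w)\<^sup>2 / (w \<bullet> w) \<le> 0" by simp
    moreover have "0 < w \<bullet> w" using False by simp
    ultimately show ?thesis by (simp add: divide_le_0_iff)
  qed simp
  then show ?thesis using pV by blast
qed

lemma orth_proj_props:
  fixes V :: "'a::{real_inner,banach} set"
  assumes "closed V" "subspace V"
  shows orth_proj_in: "orth_proj V x \<in> V"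
    and orth_proj_orth: "w \<in> V \<Longrightarrow> (x - orth_proj V x) \<bullet> w = 0"
    and orth_proj_unique: "v \<in> V \<Longrightarrow> (\<And>w. w \<in> V \<Longrightarrow> (x - v) \<bullet> w = 0) \<Longrightarrow> orth_proj V x = v"
proof -
  have uniq: "v = v'" if "v \<in> V" "v' \<in> V" "\<forall>w\<in>V. (x - v) \<bullet> w = 0" "\<forall>w\<in>V. (x - v') \<bullet> w = 0" for v v'
  proof -
    have "v - v' \<in> V" using that assms(2) by (simp add: subspace_diff)
    then have "(x - v) \<bullet> (v - v') = 0" "(x - v') \<bullet> (v - v') = 0" using that by blast+
    then have "(v - v') \<bullet> (v - v') = 0" by (simp add: inner_diff_left)
    then show ?thesis by simp
  qed
  have "\<exists>!v. v \<in> V \<and> (\<forall>w\<in>V. (x - v) \<bullet> w = 0)" using ex_orth_projection[OF assms, of x] uniq by blast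
  from theI'[OF this] have th: "orth_proj V x \<in> V \<and> (\<forall>w\<in>V. (x - orth_proj V x) \<bullet> w = 0)"
    unfolding orth_proj_def .
  then show "orth_proj V x \<in> V" "w \<in> V \<Longrightarrow> (x - orth_proj V x) \<bullet> w = 0" by auto
  show "v \<in> V \<Longrightarrow> (\<And>w. w \<in> V \<Longrightarrow> (x - v) \<bullet> w = 0) \<Longrightarrow> orth_proj V x = v"
    using uniq th by blast
qed

lemma riesz_representation:
  fixes f :: "'a::{real_inner,banach} \<Rightarrow> real"
  assumes "bounded_linear f"
  shows "\<exists>y. \<forall>x. f x = x \<bullet> y"
proof (cases "\<forall>x. f x = 0")
  case True
  then show ?thesis by (intro exI[of _ 0]) simp
next
  case False
  then obtain x where x: "f x \<noteq> 0" by blast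
  interpret f: bounded_linear f by fact
  define V where "V = {x. f x = 0}"
  have "closed V" unfolding V_def
    by (intro closed_Collect_eq continuous_intros f.continuous_on)
  moreover have "subspace V" unfolding V_def by (simp add: subspace_def f.zero f.add f.scale)
  ultimately obtain v where v: "v \<in> V" "\<forall>w\<in>V. (x - v) \<bullet> w = 0" using ex_orth_projection by blast
  define q where "q = x - v"
  have fq: "f q \<noteq> 0" using x v(1) by (simp add: q_def V_def f.diff)
  then have "q \<noteq> 0" using f.zero by auto
  have "f z = z \<bullet> ((f q / (q \<bullet> q)) *\<^sub>R q)" for z
  proof -
    have "z - (f z / f q) *\<^sub>R q \<in> V" using fq by (simp add: V_def f.diff f.scale)
    then have "q \<bullet> (z - (f z / f q) *\<^sub>R q) = 0" using v(2) q_def by blast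
    then show ?thesis using fq \<open>q \<noteq> 0\<close> by (simp add: inner_diff_right inner_commute field_simps)
  qed
  then show ?thesis by blast
qed

text \<open>\<open>adjoint\<close> is a Hilbert choice, so its defining property needs a witness:
  Riesz, applied to the functional \<open>\<lambda>x. f x \<bullet> y\<close> for each
  \<open>y\<close>.\<close>

lemma adjoint_inner:
  fixes f :: "'a::{real_inner,banach} \<Rightarrow> 'b::real_inner"
  assumes "bounded_linear f"
  shows "f x \<bullet> y = x \<bullet> adjoint f y"
proof -
  have "\<exists>z. \<forall>x. f x \<bullet> y = x \<bullet> z" for y
    using riesz_representation[of "\<lambda>x. f x \<bullet> y"] assms
      bounded_linear_compose[OF bounded_linear_inner_left assms] by auto
  then obtain g where "\<forall>x y. f x \<bullet> y = x \<bullet> g y" by metis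
  then have "\<forall>x y. f x \<bullet> y = x \<bullet> adjoint f y"
    unfolding adjoint_def by (rule someI[where P = "\<lambda>g. \<forall>x y. f x \<bullet> y = x \<bullet> g y"])
  then show ?thesis by blast
qed

lemma eq_if_inner_eq:
  fixes x y :: "'a::real_inner"
  assumes "\<And>z. z \<bullet> x = z \<bullet> y"
  shows "x = y"
  using assms[of "x - y"] by (metis eq_iff_diff_eq_0 inner_diff_right inner_eq_zero_iff)

lemma bounded_linear_adjoint:
  fixes f :: "'a::{real_inner,banach} \<Rightarrow> 'b::real_inner"
  assumes "bounded_linear f"
  shows "bounded_linear (adjoint f)"
proof -
  obtain K where K: "\<And>x. norm (f x) \<le> norm x * K" "K \<ge> 0"
    using bounded_linear.nonneg_bounded[OF assms] by blast
  note a = adjoint_inner[OF assms, symmetric]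
  show ?thesis
  proof (rule bounded_linear_intro)
    show "adjoint f (x + y) = adjoint f x + adjoint f y" for x y
      by (rule eq_if_inner_eq) (simp add: a inner_add_right)
    show "adjoint f (r *\<^sub>R x) = r *\<^sub>R adjoint f x" for r x
      by (rule eq_if_inner_eq) (simp add: a)
    show "norm (adjoint f y) \<le> norm y * K" for y
    proof -
      have "(norm (adjoint f y))\<^sup>2 = f (adjoint f y) \<bullet> y"
        by (simp add: power2_norm_eq_inner a)
      also have "\<dots> \<le> norm (f (adjoint f y)) * norm y" by (rule norm_cauchy_schwarz)
      also have "\<dots> \<le> norm (adjoint f y) * K * norm y"
        by (intro mult_right_mono K) simp
      finally have "norm (adjoint f y) * norm (adjoint f y) \<le> norm (adjoint f y) * (norm y * K)"
        by (simp add: power2_eq_square mult_ac)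
      then show ?thesis
        using K(2) by (cases "norm (adjoint f y) = 0") (auto simp: zero_le_mult_iff)
    qed
  qed
qed

text \<open>Lax-Milgram: for suitable \<tau> the map
  \<open>\<lambda>x. x - \<tau> *\<^sub>R (L x - y)\<close> is a contraction, and its fixed point
  solves \<open>L x = y\<close>.\<close>

lemma coercive_bij:
  fixes L :: "'a::{real_inner,banach} \<Rightarrow> 'a"
  assumes "bounded_linear L" "0 < \<alpha>" "\<And>x. \<alpha> * (norm x)\<^sup>2 \<le> L x \<bullet> x"
  shows "bij L"
proof -
  interpret L: bounded_linear L by fact
  have "x = y" if "L x = L y" for x y
  proof -
    have "\<alpha> * (norm (x - y))\<^sup>2 \<le> 0" using assms(3)[of "x - y"] that by (simp add: L.diff)
    then show ?thesis using assms(2) by (simp add: mult_le_0_iff)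
  qed
  then have "inj L" by (rule injI)
  obtain M where M: "0 < M" "\<And>x. norm (L x) \<le> norm x * M" using L.pos_bounded by blast
  \<comment> \<open>Enlarging the bound by \<alpha> makes it strictly larger than \<alpha>, so that
    the root defining \<open>q\<close> has a positive argument.\<close>
  define M' where "M' = M + \<alpha>"
  have M': "0 < M'" "\<alpha> < M'" "\<And>x. norm (L x) \<le> norm x * M'"
    using M assms(2) by (auto simp: M'_def distrib_left intro!: add_increasing2)
  \<comment> \<open>The minimizer of
    \<open>1 - 2 * \<tau> * \<alpha> + \<tau>\<^sup>2 * M'\<^sup>2\<close>; the minimum is
    \<open>q\<^sup>2\<close>.\<close>
  define \<tau> where "\<tau> = \<alpha> / M'\<^sup>2"
  define q where "q = sqrt (1 - \<alpha>\<^sup>2 / M'\<^sup>2)"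
  have "\<alpha>\<^sup>2 < M'\<^sup>2" using M' assms(2) by (simp add: power_strict_mono)
  then have q: "0 \<le> q" "q < 1" "q\<^sup>2 = 1 - \<alpha>\<^sup>2 / M'\<^sup>2" using M'(1,2) assms(2) by (auto simp: q_def)
  have contr: "norm (x - \<tau> *\<^sub>R L x) \<le> q * norm x" for x
  proof -
    have "(norm (x - \<tau> *\<^sub>R L x))\<^sup>2 = (norm x)\<^sup>2 - 2 * \<tau> * (L x \<bullet> x) + \<tau>\<^sup>2 * (norm (L x))\<^sup>2"
      unfolding power2_norm_eq_inner by (simp add: inner_diff_left inner_diff_right inner_commute power2_eq_square)
    also have "\<dots> \<le> (norm x)\<^sup>2 - 2 * \<tau> * (\<alpha> * (norm x)\<^sup>2) + \<tau>\<^sup>2 * (norm x * M')\<^sup>2"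
      using assms M' by (intro add_mono diff_mono mult_left_mono power_mono) (auto simp: \<tau>_def)
    also have "\<dots> = (norm x)\<^sup>2 * (1 - 2 * (\<tau> * \<alpha>) + \<tau>\<^sup>2 * M'\<^sup>2)"
      by (simp add: power_mult_distrib algebra_simps)
    also have "\<tau> * \<alpha> = \<alpha>\<^sup>2 / M'\<^sup>2" by (simp add: \<tau>_def power2_eq_square)
    also have "\<tau>\<^sup>2 * M'\<^sup>2 = \<alpha>\<^sup>2 / M'\<^sup>2"
      using M'(1) by (simp add: \<tau>_def power_divide power2_eq_square)
    also have "(norm x)\<^sup>2 * (1 - 2 * (\<alpha>\<^sup>2 / M'\<^sup>2) + \<alpha>\<^sup>2 / M'\<^sup>2) = q\<^sup>2 * (norm x)\<^sup>2"
      unfolding q(3) by (simp add: algebra_simps)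
    also have "\<dots> = (q * norm x)\<^sup>2" by (simp add: power_mult_distrib)
    finally show ?thesis by (rule power2_le_imp_le) (use q(1) in simp)
  qed
  have "\<exists>x. L x = y" for y
  proof -
    have "\<exists>!x. (\<lambda>x. x - \<tau> *\<^sub>R L x + \<tau> *\<^sub>R y) x = x"
    proof (rule banach_fix_type[of q])
      show "0 \<le> q" "q < 1" using q by auto
      show "\<forall>x z. dist (x - \<tau> *\<^sub>R L x + \<tau> *\<^sub>R y) (z - \<tau> *\<^sub>R L z + \<tau> *\<^sub>R y) \<le> q * dist x z"
      proof (intro allI)
        fix x z
        have "(x - \<tau> *\<^sub>R L x + \<tau> *\<^sub>R y) - (z - \<tau> *\<^sub>R L z + \<tau> *\<^sub>R y) = (x - z) - \<tau> *\<^sub>R L (x - z)"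
          by (simp add: L.diff algebra_simps)
        then show "dist (x - \<tau> *\<^sub>R L x + \<tau> *\<^sub>R y) (z - \<tau> *\<^sub>R L z + \<tau> *\<^sub>R y) \<le> q * dist x z"
          unfolding dist_norm using contr[of "x - z"] by (simp only:)
      qed
    qed
    then obtain x where "x - \<tau> *\<^sub>R L x + \<tau> *\<^sub>R y = x" by blast
    then have "\<tau> *\<^sub>R L x = \<tau> *\<^sub>R y" by (auto simp: algebra_simps)
    then show ?thesis using M' assms(2) by (auto simp: \<tau>_def)
  qed
  then have "surj L" by (metis surjI)
  with \<open>inj L\<close> show ?thesis by (simp add: bij_def)
qed

section \<open>Resolutions of the identity\<close>

text \<open>Has two uses: the rank-one projections of an orthonormal basis and the eigenprojections
  of \<open>S\<close>. Density of the span is what can be checked in both; convergence of the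
  expansion is derived from it.\<close>

locale orth_resolution =
  fixes I :: "'i set" and P :: "'i \<Rightarrow> 'x::real_inner \<Rightarrow> 'x"
  assumes lin: "i \<in> I \<Longrightarrow> linear (P i)"
    and sym: "i \<in> I \<Longrightarrow> P i x \<bullet> y = x \<bullet> P i y"
    and idem: "i \<in> I \<Longrightarrow> P i (P i x) = P i x"
    and orth: "i \<in> I \<Longrightarrow> j \<in> I \<Longrightarrow> i \<noteq> j \<Longrightarrow> P i (P j x) = 0"
    and dense: "closure (span (\<Union>i\<in>I. range (P i))) = UNIV"
begin

lemma inner_self: "i \<in> I \<Longrightarrow> P i x \<bullet> x = (norm (P i x))\<^sup>2"
  by (metis (no_types) idem sym[of i "P i x" x] power2_norm_eq_inner)

lemma inner_distinct: "i \<in> I \<Longrightarrow> j \<in> I \<Longrightarrow> i \<noteq> j \<Longrightarrow> P i x \<bullet> P j y = 0"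
  by (simp add: sym orth)

lemma norm_sum:
  assumes "finite F" "F \<subseteq> I"
  shows "(norm (\<Sum>i\<in>F. r i *\<^sub>R P i x))\<^sup>2 = (\<Sum>i\<in>F. (r i)\<^sup>2 * (norm (P i x))\<^sup>2)"
proof -
  have "(norm (\<Sum>i\<in>F. r i *\<^sub>R P i x))\<^sup>2 = (\<Sum>i\<in>F. (norm (r i *\<^sub>R P i x))\<^sup>2)"
    by (intro norm_sum_Pythagorean)
       (use assms in \<open>simp_all add: pairwise_def orthogonal_def inner_distinct subset_iff\<close>)
  then show ?thesis by (simp add: power_mult_distrib)
qed

lemma proj_sum:
  assumes "finite F" "F \<subseteq> I" "j \<in> I"
  shows "P j (\<Sum>i\<in>F. r i *\<^sub>R P i x) = (if j \<in> F then r j *\<^sub>R P j x else 0)"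
proof -
  interpret L: linear "P j" using lin assms(3) .
  have "P j (\<Sum>i\<in>F. r i *\<^sub>R P i x) = (\<Sum>i\<in>F. if i = j then r j *\<^sub>R P j x else 0)"
    unfolding L.sum L.scale using assms by (intro sum.cong) (auto simp: orth idem subset_iff)
  also have "\<dots> = (if j \<in> F then r j *\<^sub>R P j x else 0)" using assms(1) by (simp add: sum.delta)
  finally show ?thesis .
qed

lemma norm_diff_sum:
  assumes "finite F" "F \<subseteq> I"
  shows "(norm (x - (\<Sum>i\<in>F. P i x)))\<^sup>2 = (norm x)\<^sup>2 - (\<Sum>i\<in>F. (norm (P i x))\<^sup>2)"
proof -
  have "(\<Sum>i\<in>F. P i x) \<bullet> x = (\<Sum>i\<in>F. (norm (P i x))\<^sup>2)"
    using assms by (auto simp: inner_sum_left inner_self subset_iff intro!: sum.cong)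
  moreover have "(norm (\<Sum>i\<in>F. P i x))\<^sup>2 = (\<Sum>i\<in>F. (norm (P i x))\<^sup>2)"
    using norm_sum[OF assms, of "\<lambda>_. 1"] by simp
  moreover have "(norm (x - s))\<^sup>2 = (norm x)\<^sup>2 - 2 * (s \<bullet> x) + (norm s)\<^sup>2" for s
    by (simp add: power2_norm_eq_inner inner_diff_left inner_diff_right inner_commute)
  ultimately show ?thesis by simp
qed

lemma bessel:
  assumes "finite F" "F \<subseteq> I"
  shows "(\<Sum>i\<in>F. (norm (P i x))\<^sup>2) \<le> (norm x)\<^sup>2"
  using norm_diff_sum[OF assms, of x] zero_le_power2[of "norm (x - (\<Sum>i\<in>F. P i x))"] by linarith

text \<open>Exactness for all larger \<open>G\<close>, and not just for one \<open>F\<close>, is the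
  form that unordered summation requires.\<close>

lemma finite_expansion:
  assumes "y \<in> span (\<Union>i\<in>I. range (P i))"
  shows "\<exists>F. finite F \<and> F \<subseteq> I \<and> (\<forall>G. finite G \<and> F \<subseteq> G \<and> G \<subseteq> I \<longrightarrow> (\<Sum>i\<in>G. P i y) = y)"
  using assms
proof (induction rule: span_induct_alt)
  case base
  show ?case by (intro exI[of _ "{}"]) (simp add: subset_iff linear_0 lin)
next
  case (step c x y)
  then obtain j z where j: "j \<in> I" "x = P j z" by blast
  from step.IH obtain F where F: "finite F" "F \<subseteq> I"
    "\<forall>G. finite G \<and> F \<subseteq> G \<and> G \<subseteq> I \<longrightarrow> (\<Sum>i\<in>G. P i y) = y" by (elim exE conjE)
  have "(\<Sum>i\<in>G. P i (c *\<^sub>R x + y)) = c *\<^sub>R x + y" if G: "finite G" "insert j F \<subseteq> G" "G \<subseteq> I" for G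
  proof -
    have "(\<Sum>i\<in>G. P i (c *\<^sub>R x + y)) = (\<Sum>i\<in>G. (if i = j then c *\<^sub>R x else 0) + P i y)"
    proof (rule sum.cong[OF refl])
      fix i assume "i \<in> G"
      then have "i \<in> I" using G by blast
      then interpret L: linear "P i" using lin by blast
      show "P i (c *\<^sub>R x + y) = (if i = j then c *\<^sub>R x else 0) + P i y"
        using \<open>i \<in> I\<close> j by (auto simp: L.add L.scale idem orth)
    qed
    also have "\<dots> = c *\<^sub>R x + (\<Sum>i\<in>G. P i y)" using G by (simp add: sum.distrib sum.delta)
    also have "(\<Sum>i\<in>G. P i y) = y" using F(3) G by simp
    finally show ?thesis .
  qed
  then show ?case using F(1,2) j(1) by (intro exI[of _ "insert j F"]) simp
qed

text \<open>A nearby \<open>y\<close> in the span is reproduced exactly by large finite sums, so the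
  residual of \<open>x\<close> equals that of \<open>x - y\<close>, and taking residuals does not
  increase the norm.\<close>

lemma has_sum: "((\<lambda>i. P i x) has_sum x) I"
  unfolding has_sum_def tendsto_iff eventually_finite_subsets_at_top
proof (intro allI impI)
  fix e :: real assume "0 < e"
  have "x \<in> closure (span (\<Union>i\<in>I. range (P i)))" using dense by simp
  then obtain y where y: "y \<in> span (\<Union>i\<in>I. range (P i))" "dist y x < e"
    using \<open>0 < e\<close> unfolding closure_approachable by blast
  from finite_expansion[OF y(1)] obtain F where F0: "finite F" "F \<subseteq> I"
    "\<forall>G. finite G \<and> F \<subseteq> G \<and> G \<subseteq> I \<longrightarrow> (\<Sum>i\<in>G. P i y) = y" by auto
  have F: "(\<Sum>i\<in>G. P i y) = y" if "finite G" "F \<subseteq> G" "G \<subseteq> I" for G using F0(3) that by simp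
  have "dist (\<Sum>i\<in>G. P i x) x < e" if G: "finite G" "F \<subseteq> G" "G \<subseteq> I" for G
  proof -
    have e: "x - (\<Sum>i\<in>G. P i x) = (x - y) - (\<Sum>i\<in>G. P i (x - y))"
    proof -
      have "(\<Sum>i\<in>G. P i (x - y)) = (\<Sum>i\<in>G. P i x - P i y)"
        by (rule sum.cong[OF refl], rule linear_diff, rule lin) (use G(3) in blast)
      then show ?thesis using F[OF G] by (simp add: sum_subtractf)
    qed
    have "(norm (x - (\<Sum>i\<in>G. P i x)))\<^sup>2 \<le> (norm (x - y))\<^sup>2"
      unfolding e norm_diff_sum[OF G(1,3), of "x - y"] by (simp add: sum_nonneg)
    then have "norm (x - (\<Sum>i\<in>G. P i x)) \<le> norm (x - y)" by (rule power2_le_imp_le) simp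
    then show ?thesis using y(2) by (simp add: dist_norm norm_minus_commute)
  qed
  then show "\<exists>X. finite X \<and> X \<subseteq> I \<and> (\<forall>Y. finite Y \<and> X \<subseteq> Y \<and> Y \<subseteq> I \<longrightarrow> dist (\<Sum>i\<in>Y. P i x) x < e)"
    using F0(1,2) by (intro exI[of _ F]) simp
qed

lemma norm_has_sum: "((\<lambda>i. (norm (P i x))\<^sup>2) has_sum (norm x)\<^sup>2) I"
proof -
  have "((\<lambda>i. P i x \<bullet> x) has_sum x \<bullet> x) I"
    using has_sum_bounded_linear[OF bounded_linear_inner_left has_sum] .
  then have "((\<lambda>i. P i x \<bullet> x) has_sum (norm x)\<^sup>2) I" by (simp add: power2_norm_eq_inner)
  moreover have "((\<lambda>i. P i x \<bullet> x) has_sum (norm x)\<^sup>2) I \<longleftrightarrow> ((\<lambda>i. (norm (P i x))\<^sup>2) has_sum (norm x)\<^sup>2) I"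
    by (rule has_sum_cong) (rule inner_self)
  ultimately show ?thesis by (simp only:)
qed

lemma norm_le_if_finite_sums_le:
  assumes "\<And>F. finite F \<Longrightarrow> F \<subseteq> I \<Longrightarrow> (\<Sum>i\<in>F. (norm (P i x))\<^sup>2) \<le> B"
  shows "(norm x)\<^sup>2 \<le> B"
  by (rule has_sum_le_finite_sums[OF norm_has_sum]) (rule assms)

end

lemma orthonormal_basis_resolution:
  assumes "orthonormal_basis E"
  shows "orth_resolution E (\<lambda>e x. (x \<bullet> e) *\<^sub>R e)"
proof (rule orth_resolution.intro, goal_cases)
  case (1 i)
  show ?case by (rule linearI) (auto simp: inner_add_left scaleR_add_left)
next
  case (2 i x y)
  show ?case by (simp add: inner_commute)
next
  case (3 i x)
  then have "i \<bullet> i = 1" using assms by (simp add: orthonormal_basis_def power2_norm_eq_inner[symmetric])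
  then show ?case by simp
next
  case (4 i j x)
  then show ?case using assms by (auto simp: orthonormal_basis_def pairwise_def orthogonal_def)
next
  case 5
  have "E \<subseteq> (\<Union>i\<in>E. range (\<lambda>x. (x \<bullet> i) *\<^sub>R i))"
  proof
    fix e assume e: "e \<in> E"
    then have "e \<bullet> e = 1" using assms by (simp add: orthonormal_basis_def power2_norm_eq_inner[symmetric])
    then have "e = (e \<bullet> e) *\<^sub>R e" by simp
    then show "e \<in> (\<Union>i\<in>E. range (\<lambda>x. (x \<bullet> i) *\<^sub>R i))" using e by blast
  qed
  then have "closure (span E) \<subseteq> closure (span (\<Union>i\<in>E. range (\<lambda>x. (x \<bullet> i) *\<^sub>R i)))"
    by (intro closure_mono span_mono)
  then show ?case using assms by (simp add: orthonormal_basis_def top.extremum_unique)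
qed

lemma parseval:
  assumes "orthonormal_basis E"
  shows "((\<lambda>e. (x \<bullet> e)\<^sup>2) has_sum (norm x)\<^sup>2) E"
proof -
  interpret orth_resolution E "\<lambda>e x. (x \<bullet> e) *\<^sub>R e" using orthonormal_basis_resolution[OF assms] .
  have "(norm ((x \<bullet> e) *\<^sub>R e))\<^sup>2 = (x \<bullet> e)\<^sup>2" if "e \<in> E" for e
    using assms that by (simp add: orthonormal_basis_def)
  then have "((\<lambda>e. (norm ((x \<bullet> e) *\<^sub>R e))\<^sup>2) has_sum (norm x)\<^sup>2) E
      \<longleftrightarrow> ((\<lambda>e. (x \<bullet> e)\<^sup>2) has_sum (norm x)\<^sup>2) E"
    by (intro has_sum_cong)
  then show ?thesis using norm_has_sum[of x] by (rule iffD1)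
qed

section \<open>Positive forms, and compactness of positive trace class operators\<close>

lemma closed_eigenspace: "bounded_linear T \<Longrightarrow> closed (eigenspace T l)"
  unfolding eigenspace_def
  by (intro closed_Collect_eq continuous_intros linear_continuous_on)

lemma subspace_eigenspace: "linear T \<Longrightarrow> subspace (eigenspace T l)"
  by (auto simp: subspace_def eigenspace_def linear_0 linear_add linear_scale scaleR_add_right)

text \<open>The form is nonnegative at \<open>x - t *\<^sub>R S x\<close>, and
  \<open>t = 1 / M\<close> is the best choice. The restriction to an invariant \<open>W\<close>
  serves the search for eigenvectors in an orthogonal complement, with \<open>M\<close> the supremum
  of the form on the unit sphere there.\<close>

lemma psd_norm_le:
  fixes S :: "'x::real_inner \<Rightarrow> 'x"
  assumes lin: "linear S" and sym: "\<And>x y. S x \<bullet> y = x \<bullet> S y"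
    and W: "subspace W" "\<And>x. x \<in> W \<Longrightarrow> S x \<in> W"
    and pos: "\<And>x. x \<in> W \<Longrightarrow> 0 \<le> S x \<bullet> x"
    and bd: "\<And>x. x \<in> W \<Longrightarrow> S x \<bullet> x \<le> M * (norm x)\<^sup>2" and x: "x \<in> W"
  shows "(norm (S x))\<^sup>2 \<le> M * (S x \<bullet> x)"
proof (cases "S x = 0")
  case False
  interpret S: linear S by fact
  define b where "b = S (S x) \<bullet> S x"
  have b: "0 \<le> b" "b \<le> M * (norm (S x))\<^sup>2" using W pos bd x by (auto simp: b_def)
  have q: "0 \<le> S x \<bullet> x - 2 * t * (norm (S x))\<^sup>2 + t\<^sup>2 * b" for t
  proof -
    have "x - t *\<^sub>R S x \<in> W" using W x by (simp add: subspace_diff subspace_scale)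
    from pos[OF this] have "0 \<le> S (x - t *\<^sub>R S x) \<bullet> (x - t *\<^sub>R S x)" .
    also have "\<dots> = S x \<bullet> x - t * (S x \<bullet> S x) - t * (S (S x) \<bullet> x) + t\<^sup>2 * b"
      by (simp add: S.diff S.scale inner_diff_left inner_diff_right b_def power2_eq_square algebra_simps)
    also have "S (S x) \<bullet> x = S x \<bullet> S x" by (simp add: sym)
    finally show ?thesis by (simp add: power2_norm_eq_inner)
  qed
  have n: "0 < (norm (S x))\<^sup>2" using False by simp
  have M: "0 \<le> M" using b n by (meson order_trans zero_le_mult_iff not_le less_le_trans)
  show ?thesis
  proof (cases "M = 0")
    case True
    then have "S x \<bullet> x \<le> 0" "b \<le> 0" using bd[OF x] b by auto
    moreover have "0 \<le> S x \<bullet> x - 2 * (norm (S x))\<^sup>2 + b" using q[of 1] by simp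
    ultimately show ?thesis using n by linarith
  next
    case False
    then have "0 < M" using M by simp
    have "0 \<le> S x \<bullet> x - 2 * (1 / M) * (norm (S x))\<^sup>2 + (1 / M)\<^sup>2 * (M * (norm (S x))\<^sup>2)"
      using q[of "1 / M"] b(2) mult_left_mono[OF b(2), of "(1 / M)\<^sup>2"] by simp
    also have "\<dots> = S x \<bullet> x - (norm (S x))\<^sup>2 / M" using \<open>0 < M\<close> by (simp add: field_simps power2_eq_square)
    finally show ?thesis using \<open>0 < M\<close> by (simp add: field_simps)
  qed
next
  case True then show ?thesis by simp
qed

lemma psd_cauchy_schwarz:
  fixes S :: "'x::real_inner \<Rightarrow> 'x"
  assumes "linear S" "\<And>x y. S x \<bullet> y = x \<bullet> S y" "\<And>x. 0 \<le> S x \<bullet> x"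
  shows "(S x \<bullet> y)\<^sup>2 \<le> (S x \<bullet> x) * (S y \<bullet> y)"
proof -
  interpret S: linear S by fact
  have q: "0 \<le> S x \<bullet> x - 2 * t * (S x \<bullet> y) + t\<^sup>2 * (S y \<bullet> y)" for t
  proof -
    have "0 \<le> S (x - t *\<^sub>R y) \<bullet> (x - t *\<^sub>R y)" by (rule assms)
    also have "\<dots> = S x \<bullet> x - t * (S x \<bullet> y) - t * (S y \<bullet> x) + t\<^sup>2 * (S y \<bullet> y)"
      by (simp add: S.diff S.scale inner_diff_left inner_diff_right power2_eq_square algebra_simps)
    also have "S y \<bullet> x = S x \<bullet> y" by (metis assms(2) inner_commute)
    finally show ?thesis by simp
  qed
  show ?thesis
  proof (cases "S y \<bullet> y = 0")
    case True
    have "S x \<bullet> y = 0"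
    proof (rule ccontr)
      assume n: "S x \<bullet> y \<noteq> 0"
      \<comment> \<open>Without quadratic term the bound is affine in \<open>t\<close>; this
        \<open>t\<close> makes it equal to -1.\<close>
      have "0 \<le> S x \<bullet> x - 2 * ((S x \<bullet> x + 1) / (2 * (S x \<bullet> y))) * (S x \<bullet> y)"
        using q[of "(S x \<bullet> x + 1) / (2 * (S x \<bullet> y))"] True by simp
      also have "\<dots> = -1" using n by (simp add: field_simps)
      finally show False by simp
    qed
    then show ?thesis using assms by simp
  next
    case False
    then have p: "0 < S y \<bullet> y" using assms(3)[of y] by simp
    have "0 \<le> S x \<bullet> x - (S x \<bullet> y)\<^sup>2 / (S y \<bullet> y)"
      using q[of "(S x \<bullet> y) / (S y \<bullet> y)"] p by (simp add: power2_eq_square field_simps)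
    then show ?thesis using p by (simp add: field_simps)
  qed
qed

text \<open>Coefficients on \<open>F\<close> vanish, so Cauchy-Schwarz for sums and for the form
  bounds \<open>q = S x \<bullet> x\<close> by the root of
  \<open>(norm x)\<^sup>2 * (\<epsilon> * q)\<close>; one factor \<open>q\<close> then
  cancels.\<close>

lemma form_le_tail_trace:
  fixes S :: "'x::real_inner \<Rightarrow> 'x"
  assumes S: "positive_selfadjoint S" and E: "orthonormal_basis E"
    and sum: "\<And>G. finite G \<Longrightarrow> G \<subseteq> E - F \<Longrightarrow> (\<Sum>e\<in>G. S e \<bullet> e) \<le> \<epsilon>"
    and x: "\<And>e. e \<in> F \<Longrightarrow> x \<bullet> e = 0"
  shows "S x \<bullet> x \<le> \<epsilon> * (norm x)\<^sup>2"
proof -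
  interpret S: bounded_linear S using S by (simp add: positive_selfadjoint_def)
  have S_sym: "S x \<bullet> y = x \<bullet> S y" and pos: "0 \<le> S x \<bullet> x" for x y
    using S by (auto simp: positive_selfadjoint_def)
  interpret orth_resolution E "\<lambda>e x. (x \<bullet> e) *\<^sub>R e" using orthonormal_basis_resolution[OF E] .
  define q where "q = S x \<bullet> x"
  have "((\<lambda>e. (x \<bullet> e) *\<^sub>R e \<bullet> S x) has_sum x \<bullet> S x) E"
    using has_sum_bounded_linear[OF bounded_linear_inner_left has_sum] .
  then have hs: "((\<lambda>e. (x \<bullet> e) * (S x \<bullet> e)) has_sum q) E"
    by (simp add: q_def inner_commute)
  have "q \<le> sqrt ((norm x)\<^sup>2 * (\<epsilon> * q))"
  proof (rule has_sum_le_finite_sums[OF hs])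
    fix H assume H: "finite H" "H \<subseteq> E"
    have G: "finite (H - F)" "H - F \<subseteq> E - F" "H - F \<subseteq> E" using H by auto
    have "(\<Sum>e\<in>H. (x \<bullet> e) * (S x \<bullet> e)) = (\<Sum>e\<in>H - F. (x \<bullet> e) * (S x \<bullet> e))"
      using H x by (intro sum.mono_neutral_right) auto
    also have "\<dots> \<le> sqrt ((\<Sum>e\<in>H - F. (x \<bullet> e) * (S x \<bullet> e))\<^sup>2)" by (simp add: real_le_rsqrt)
    also have "\<dots> \<le> sqrt ((\<Sum>e\<in>H - F. (x \<bullet> e)\<^sup>2) * (\<Sum>e\<in>H - F. (S x \<bullet> e)\<^sup>2))"
      by (intro real_sqrt_le_mono Cauchy_Schwarz_ineq_sum)
    also have "\<dots> \<le> sqrt ((norm x)\<^sup>2 * (\<epsilon> * q))"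
    proof (intro real_sqrt_le_mono mult_mono)
      have "norm ((x \<bullet> e) *\<^sub>R e) = \<bar>x \<bullet> e\<bar>" if "e \<in> H - F" for e
        using E that G(3) by (auto simp: orthonormal_basis_def)
      then have "(\<Sum>e\<in>H - F. (x \<bullet> e)\<^sup>2) = (\<Sum>e\<in>H - F. (norm ((x \<bullet> e) *\<^sub>R e))\<^sup>2)"
        by (intro sum.cong) (simp_all only: power2_abs)
      also have "\<dots> \<le> (norm x)\<^sup>2" by (rule bessel[OF G(1,3)])
      finally show "(\<Sum>e\<in>H - F. (x \<bullet> e)\<^sup>2) \<le> (norm x)\<^sup>2" .
      have "(\<Sum>e\<in>H - F. (S x \<bullet> e)\<^sup>2) \<le> (\<Sum>e\<in>H - F. (S x \<bullet> x) * (S e \<bullet> e))"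
        by (intro sum_mono psd_cauchy_schwarz S.linear pos) (rule S_sym)
      also have "\<dots> = q * (\<Sum>e\<in>H - F. S e \<bullet> e)" by (simp add: q_def sum_distrib_left)
      also have "\<dots> \<le> q * \<epsilon>" by (intro mult_left_mono sum G) (simp add: q_def pos)
      finally show "(\<Sum>e\<in>H - F. (S x \<bullet> e)\<^sup>2) \<le> \<epsilon> * q" by (simp add: mult.commute)
    qed (auto intro: sum_nonneg)
    finally show "(\<Sum>e\<in>H. (x \<bullet> e) * (S x \<bullet> e)) \<le> sqrt ((norm x)\<^sup>2 * (\<epsilon> * q))" .
  qed
  moreover have "0 \<le> q" "0 \<le> \<epsilon>" using pos[of x] sum[of "{}"] by (auto simp: q_def)
  ultimately have "q\<^sup>2 \<le> (norm x)\<^sup>2 * (\<epsilon> * q)"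
    by (metis mult_nonneg_nonneg power_mono real_sqrt_pow2 zero_le_power2)
  then have "q * q \<le> q * (\<epsilon> * (norm x)\<^sup>2)" by (simp add: power2_eq_square mult_ac)
  then have "q \<le> \<epsilon> * (norm x)\<^sup>2"
    using \<open>0 \<le> q\<close> \<open>0 \<le> \<epsilon>\<close> by (cases "q = 0") auto
  then show ?thesis by (simp add: q_def)
qed

text \<open>A small tail of the trace makes the form small on the unit vectors orthogonal to
  finitely many basis vectors, and \<open>psd_norm_le\<close> turns this into smallness of
  \<open>S\<close> there. The image of the unit ball is thus close to a compact set of finite
  dimension.\<close>

lemma compact_operator_trace_class:
  fixes S :: "'x::{real_inner,banach} \<Rightarrow> 'x"
  assumes S: "positive_selfadjoint S" and tr: "trace_class_pos S"
  shows "compact_operator S"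
proof -
  interpret S: bounded_linear S using S by (simp add: positive_selfadjoint_def)
  have sym: "S x \<bullet> y = x \<bullet> S y" and pos: "0 \<le> S x \<bullet> x" for x y
    using S by (auto simp: positive_selfadjoint_def)
  obtain K where K: "0 < K" "\<And>x. norm (S x) \<le> norm x * K" using S.pos_bounded by blast
  have SK: "S x \<bullet> x \<le> K * (norm x)\<^sup>2" for x
    using norm_cauchy_schwarz[of "S x" x] mult_right_mono[OF K(2)[of x], of "norm x"]
    by (simp add: power2_eq_square mult_ac)
  obtain E where E: "orthonormal_basis E" and sE: "(\<lambda>e. S e \<bullet> e) summable_on E"
    using tr by (auto simp: trace_class_pos_def)
  interpret E: orth_resolution E "\<lambda>e x. (x \<bullet> e) *\<^sub>R e" using orthonormal_basis_resolution[OF E] .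
  have E1: "norm e = 1" if "e \<in> E" for e using E that by (simp add: orthonormal_basis_def)
  have cover: "\<exists>k. finite k \<and> S ` cball 0 1 \<subseteq> (\<Union>x\<in>k. ball x \<delta>)" if "0 < \<delta>" for \<delta>
  proof -
    \<comment> \<open>Chosen so that \<open>K * \<epsilon> = (\<delta> / 3)\<^sup>2\<close>, which
      makes the tail contribute at most \<delta> / 3.\<close>
    define \<epsilon> where "\<epsilon> = (\<delta> / 3)\<^sup>2 / K"
    have "0 < \<epsilon>" using that K by (simp add: \<epsilon>_def)
    from has_sum_finite_approximation[OF has_sum_infsum[OF sE] this]
    obtain F where F: "finite F" "F \<subseteq> E" "dist (\<Sum>e\<in>F. S e \<bullet> e) (\<Sum>\<^sub>\<infinity>e\<in>E. S e \<bullet> e) \<le> \<epsilon>" by blast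
    have tail: "(\<Sum>e\<in>G. S e \<bullet> e) \<le> \<epsilon>" if G: "finite G" "G \<subseteq> E - F" for G
    proof -
      have "(\<Sum>e\<in>F \<union> G. S e \<bullet> e) \<le> (\<Sum>\<^sub>\<infinity>e\<in>E. S e \<bullet> e)"
        using F G by (intro finite_sum_le_infsum sE pos) auto
      moreover have "(\<Sum>e\<in>F \<union> G. S e \<bullet> e) = (\<Sum>e\<in>F. S e \<bullet> e) + (\<Sum>e\<in>G. S e \<bullet> e)"
        using F G by (intro sum.union_disjoint) auto
      ultimately show ?thesis using F(3) by (simp add: dist_real_def abs_le_iff)
    qed
    \<comment> \<open>The image of a coefficient cube. It contains \<open>S\<close> of the projected
      unit ball, because the coefficients \<open>x \<bullet> e\<close> are at most 1 in absolute
      value.\<close>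
    define C where "C = (\<lambda>h. \<Sum>e\<in>F. h e *\<^sub>R S e) ` (\<Pi>\<^sub>E e\<in>F. {-1..1::real})"
    have "compact C"
    proof -
      have "compact {\<Sum>e\<in>H. h e *\<^sub>R S e | h. \<forall>e\<in>H. h e \<in> {-1..1::real}}" if "finite H" for H
        using that
      proof (induction H)
        case empty
        then show ?case by simp
      next
        case (insert e H)
        have "{\<Sum>e\<in>insert e H. h e *\<^sub>R S e | h. \<forall>e\<in>insert e H. h e \<in> {-1..1::real}} =
          (\<lambda>(t, y). t *\<^sub>R S e + y) ` ({-1..1} \<times> {\<Sum>e\<in>H. h e *\<^sub>R S e | h. \<forall>e\<in>H. h e \<in> {-1..1::real}})"
          (is "?L = ?R")
        proof
          show "?L \<subseteq> ?R" using insert.hyps by (auto simp: image_iff)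
          show "?R \<subseteq> ?L"
          proof
            fix z assume "z \<in> ?R"
            then obtain t h where th: "t \<in> {-1..1}" "\<forall>e\<in>H. h e \<in> {-1..1::real}"
              "z = t *\<^sub>R S e + (\<Sum>e\<in>H. h e *\<^sub>R S e)" by auto
            have "(\<Sum>e'\<in>insert e H. (h(e := t)) e' *\<^sub>R S e') = z"
              using insert.hyps th by (auto intro!: sum.cong)
            moreover have "\<forall>e'\<in>insert e H. (h(e := t)) e' \<in> {-1..1}" using th by auto
            ultimately show "z \<in> ?L" by blast
          qed
        qed
        moreover have "compact ?R"
          by (intro compact_continuous_image compact_Times insert.IH)
             (auto intro!: continuous_intros simp: case_prod_unfold)
        ultimately show ?case by simp
      qed
      from this[OF F(1)] show ?thesis
      proof (rule back_subst[of compact])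
        show "{\<Sum>e\<in>F. h e *\<^sub>R S e |h. \<forall>e\<in>F. h e \<in> {- 1..1}} = C"
        proof
          show "{\<Sum>e\<in>F. h e *\<^sub>R S e |h. \<forall>e\<in>F. h e \<in> {- 1..1}} \<subseteq> C"
          proof
            fix z assume "z \<in> {\<Sum>e\<in>F. h e *\<^sub>R S e |h. \<forall>e\<in>F. h e \<in> {- 1..1}}"
            then obtain h where h: "\<forall>e\<in>F. h e \<in> {-1..1}" "z = (\<Sum>e\<in>F. h e *\<^sub>R S e)" by auto
            then have "z = (\<Sum>e\<in>F. restrict h F e *\<^sub>R S e)" by simp
            then show "z \<in> C" unfolding C_def using h(1) by (intro image_eqI[where x = "restrict h F"]) auto
          qed
        qed (auto simp: C_def PiE_def Pi_def)
      qed
    qed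
    then have "\<exists>k. finite k \<and> C \<subseteq> (\<Union>x\<in>k. ball x (\<delta> / 3))"
      using that unfolding compact_eq_totally_bounded by auto
    then obtain k where k: "finite k" "C \<subseteq> (\<Union>x\<in>k. ball x (\<delta> / 3))" by blast
    have "S x \<in> (\<Union>y\<in>k. ball y \<delta>)" if x: "x \<in> cball 0 1" for x
    proof -
      define x1 where "x1 = (\<Sum>e\<in>F. (x \<bullet> e) *\<^sub>R e)"
      have nx: "norm x \<le> 1" using x by simp
      have "(norm (x - x1))\<^sup>2 \<le> (norm x)\<^sup>2"
        unfolding x1_def E.norm_diff_sum[OF F(1,2)] by (simp add: sum_nonneg)
      then have "(norm (x - x1))\<^sup>2 \<le> 1" using nx by (meson norm_ge_zero order_trans power_le_one)
      have perp: "(x - x1) \<bullet> e = 0" if "e \<in> F" for e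
      proof -
        have "x1 \<bullet> e = (\<Sum>f\<in>F. if f = e then x \<bullet> e else 0)"
          unfolding x1_def inner_sum_left
        proof (rule sum.cong[OF refl])
          fix f assume "f \<in> F"
          then show "(x \<bullet> f) *\<^sub>R f \<bullet> e = (if f = e then x \<bullet> e else 0)"
            using E that F(2) by (auto simp: orthonormal_basis_def pairwise_def orthogonal_def power2_norm_eq_inner[symmetric] subset_iff)
        qed
        then show ?thesis using F(1) that by (simp add: inner_diff_left)
      qed
      have "S (x - x1) \<bullet> (x - x1) \<le> \<epsilon> * (norm (x - x1))\<^sup>2"
        using form_le_tail_trace[OF S E tail perp] by blast
      also have "\<dots> \<le> \<epsilon> * 1" using \<open>0 < \<epsilon>\<close> \<open>(norm (x - x1))\<^sup>2 \<le> 1\<close> by (intro mult_left_mono) auto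
      finally have "(norm (S (x - x1)))\<^sup>2 \<le> K * \<epsilon>"
        using psd_norm_le[of S UNIV K "x - x1"] S.linear sym pos SK K(1)
        by (smt (verit, ccfv_SIG) UNIV_I mult_left_mono subspace_UNIV)
      also have "\<dots> = (\<delta> / 3)\<^sup>2" using K(1) by (simp add: \<epsilon>_def)
      finally have d1: "norm (S (x - x1)) \<le> \<delta> / 3" by (rule power2_le_imp_le) (use \<open>0 < \<delta>\<close> in simp)
      have "\<bar>x \<bullet> e\<bar> \<le> 1" if "e \<in> F" for e
        using Cauchy_Schwarz_ineq2[of x e] E1[of e] that F(2) nx by auto
      then have "S x1 \<in> C" unfolding C_def x1_def S.sum S.scaleR
        by (intro image_eqI[where x = "restrict (\<lambda>e. x \<bullet> e) F"]) (auto simp: abs_le_iff minus_le_iff)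
      then obtain y where y: "y \<in> k" "dist y (S x1) < \<delta> / 3" using k(2) by auto
      have "dist y (S x) \<le> dist y (S x1) + dist (S x1) (S x)" by (rule dist_triangle)
      also have "dist (S x1) (S x) = norm (S (x - x1))" by (simp add: S.diff dist_norm norm_minus_commute)
      finally have "dist y (S x) < \<delta>" using y(2) d1 \<open>0 < \<delta>\<close> by linarith
      then show ?thesis using y(1) by auto
    qed
    then show ?thesis using k(1) by blast
  qed
  have "compact (closure (S ` cball 0 1))"
    unfolding compact_eq_totally_bounded
  proof (intro conjI allI impI)
    show "uniform_space_class.complete (closure (S ` cball 0 1))" by (simp add: complete_eq_closed)
    fix \<delta> :: real assume "0 < \<delta>"
    \<comment> \<open>Half the radius, since the cover must survive the closure: closed balls of
      radius \<delta> / 2 lie in open balls of radius \<delta>.\<close>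
    then obtain k where k: "finite k" "S ` cball 0 1 \<subseteq> (\<Union>x\<in>k. ball x (\<delta> / 2))" using cover[of "\<delta> / 2"] by auto
    have "closure (S ` cball 0 1) \<subseteq> (\<Union>x\<in>k. cball x (\<delta> / 2))"
    proof (rule closure_minimal)
      show "S ` cball 0 1 \<subseteq> (\<Union>x\<in>k. cball x (\<delta> / 2))"
        by (rule order_trans[OF k(2)]) (intro UN_mono order_refl ball_subset_cball)
      show "closed (\<Union>x\<in>k. cball x (\<delta> / 2))" using k(1) by (intro closed_UN) auto
    qed
    also have "\<dots> \<subseteq> (\<Union>x\<in>k. ball x \<delta>)"
      by (rule UN_mono[OF order_refl subsetI]) (use \<open>0 < \<delta>\<close> in auto)
    finally show "\<exists>k. finite k \<and> closure (S ` cball 0 1) \<subseteq> (\<Union>x\<in>k. ball x \<delta>)" using k(1) by blast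
  qed
  then show ?thesis unfolding compact_operator_def using S.bounded_linear_axioms by blast
qed

section \<open>The spectral theorem for positive trace class operators\<close>

text \<open>The supremum \<open>l\<close> of the form on the unit sphere of \<open>W\<close> is an
  eigenvalue: by \<open>psd_norm_le\<close>, a maximizing sequence consists of approximate
  eigenvectors, and compactness yields a limit.\<close>

lemma compact_positive_has_eigenvector:
  fixes S :: "'x::{real_inner,banach} \<Rightarrow> 'x"
  assumes comp: "compact_operator S" and sym: "\<And>x y. S x \<bullet> y = x \<bullet> S y"
    and pos: "\<And>x. 0 \<le> S x \<bullet> x"
    and W: "closed W" "subspace W" "\<And>x. x \<in> W \<Longrightarrow> S x \<in> W"
    and w: "w \<in> W" "0 < S w \<bullet> w"
  shows "\<exists>l>0. \<exists>x\<in>W. x \<noteq> 0 \<and> S x = l *\<^sub>R x"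
proof -
  interpret S: bounded_linear S using comp by (simp add: compact_operator_def)
  obtain K where K: "0 < K" "\<And>x. norm (S x) \<le> norm x * K" using S.pos_bounded by blast
  define U where "U = (\<lambda>x. S x \<bullet> x) ` {x \<in> W. norm x = 1}"
  have bdd: "bdd_above U"
  proof (rule bdd_aboveI)
    fix q assume "q \<in> U"
    then obtain x where x: "norm x = 1" "q = S x \<bullet> x" by (auto simp: U_def)
    then show "q \<le> K" using norm_cauchy_schwarz[of "S x" x] K(2)[of x] by simp
  qed
  define l where "l = Sup U"
  have bd: "S x \<bullet> x \<le> l * (norm x)\<^sup>2" if "x \<in> W" for x
  proof (cases "x = 0")
    case False
    define y where "y = x /\<^sub>R norm x"
    have "y \<in> W" "norm y = 1" using False that W(2) by (auto simp: y_def subspace_scale)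
    then have "S y \<bullet> y \<le> l" unfolding l_def using bdd by (intro cSup_upper) (auto simp: U_def)
    then show ?thesis using False by (simp add: y_def S.scaleR power2_eq_square field_simps)
  qed (simp add: S.zero)
  have "w \<noteq> 0" using w(2) S.zero by auto
  then have "0 < l" using bd[OF w(1)] w(2) by (smt (verit) mult_nonpos_nonneg zero_le_power2)
  have "U \<noteq> {}"
  proof -
    have "w /\<^sub>R norm w \<in> {x \<in> W. norm x = 1}" using \<open>w \<noteq> 0\<close> w(1) W(2) by (auto simp: subspace_scale)
    then show ?thesis unfolding U_def by blast
  qed
  have "\<exists>x\<in>W. norm x = 1 \<and> l - inverse (real (Suc n)) < S x \<bullet> x" for n
  proof -
    have "l - inverse (real (Suc n)) < Sup U" by (simp add: l_def)
    from less_cSupD[OF \<open>U \<noteq> {}\<close> this] show ?thesis by (auto simp: U_def)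
  qed
  then obtain x where x: "\<And>n. x n \<in> W" "\<And>n. norm (x n) = 1"
    "\<And>n. l - inverse (real (Suc n)) < S (x n) \<bullet> x n" by metis
  have "\<And>n. S (x n) \<in> closure (S ` cball 0 1)"
    using x(2) closure_subset by (force intro!: subsetD[OF closure_subset])
  \<comment> \<open>Compactness makes the images converge, not the vectors. As
    \<open>S (x n) - l *\<^sub>R x n\<close> tends to 0 and \<open>l\<close> is positive, the
    subsequence of vectors converges to \<open>inverse l *\<^sub>R g\<close>.\<close>
  then obtain g r where r: "strict_mono (r :: nat \<Rightarrow> nat)" "((\<lambda>n. S (x n)) \<circ> r) \<longlonglongrightarrow> g"
    using comp unfolding compact_operator_def compact_eq_seq_compact_metric seq_compact_def by metis
  have est: "(norm (S (x n) - l *\<^sub>R x n))\<^sup>2 \<le> l * inverse (real (Suc n))" for n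
  proof -
    have "(norm (S (x n) - l *\<^sub>R x n))\<^sup>2 = (norm (S (x n)))\<^sup>2 - 2 * l * (S (x n) \<bullet> x n) + l\<^sup>2 * (norm (x n))\<^sup>2"
      unfolding power2_norm_eq_inner
      by (simp add: inner_diff_left inner_diff_right inner_commute power2_eq_square)
    also have "\<dots> \<le> l * (S (x n) \<bullet> x n) - 2 * l * (S (x n) \<bullet> x n) + l\<^sup>2"
      using psd_norm_le[OF S.linear sym W(2,3) pos bd x(1)[of n]] x(2)[of n] by simp
    also have "\<dots> = l * (l - S (x n) \<bullet> x n)" by (simp add: power2_eq_square algebra_simps)
    also have "\<dots> \<le> l * inverse (real (Suc n))"
      using \<open>0 < l\<close> x(3)[of n] by (intro mult_left_mono) auto
    finally show ?thesis .
  qed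
  have "(\<lambda>n. (norm (S (x n) - l *\<^sub>R x n))\<^sup>2) \<longlonglongrightarrow> 0"
  proof (rule tendsto_sandwich[where f = "\<lambda>_. 0" and h = "\<lambda>n. l * inverse (real (Suc n))"])
    show "(\<lambda>n. l * inverse (real (Suc n))) \<longlonglongrightarrow> 0"
      by (rule tendsto_mult_right_zero[OF LIMSEQ_inverse_real_of_nat])
  qed (use est in auto)
  then have "(\<lambda>n. sqrt ((norm (S (x n) - l *\<^sub>R x n))\<^sup>2)) \<longlonglongrightarrow> sqrt 0" by (rule tendsto_real_sqrt)
  then have "(\<lambda>n. S (x n) - l *\<^sub>R x n) \<longlonglongrightarrow> 0" by (simp add: tendsto_norm_zero_iff)
  from LIMSEQ_subseq_LIMSEQ[OF this r(1)]
  have "(\<lambda>n. S (x (r n)) - l *\<^sub>R x (r n)) \<longlonglongrightarrow> 0" by (simp add: o_def)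
  moreover have Sr: "(\<lambda>n. S (x (r n))) \<longlonglongrightarrow> g" using r(2) by (simp add: o_def)
  ultimately have "(\<lambda>n. S (x (r n)) - (S (x (r n)) - l *\<^sub>R x (r n))) \<longlonglongrightarrow> g - 0"
    by (intro tendsto_diff)
  then have "(\<lambda>n. l *\<^sub>R x (r n)) \<longlonglongrightarrow> g" by simp
  then have "(\<lambda>n. inverse l *\<^sub>R (l *\<^sub>R x (r n))) \<longlonglongrightarrow> inverse l *\<^sub>R g" by (intro tendsto_intros)
  then have y: "(\<lambda>n. x (r n)) \<longlonglongrightarrow> inverse l *\<^sub>R g" using \<open>0 < l\<close> by simp
  let ?y = "inverse l *\<^sub>R g"
  have "?y \<in> W" using closed_sequentially[OF W(1) _ y] x(1) by blast
  moreover have "norm ?y = 1"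
    using tendsto_norm[OF y] x(2) by (metis (mono_tags, lifting) LIMSEQ_const_iff tendsto_cong always_eventually)
  moreover have "S ?y = g" using LIMSEQ_unique[OF S.tendsto[OF y] Sr] .
  then have "S ?y = l *\<^sub>R ?y" using \<open>0 < l\<close> by simp
  ultimately show ?thesis using \<open>0 < l\<close> by (intro exI[of _ l] conjI bexI[of _ ?y]) auto
qed

lemma subspace_closure:
  fixes V :: "'a::real_normed_vector set"
  assumes "subspace V"
  shows "subspace (closure V)"
proof (rule subspaceI)
  show "0 \<in> closure V" using closure_subset subspace_0[OF assms] by blast
  fix x y assume "x \<in> closure V" "y \<in> closure V"
  then obtain f g where "\<forall>n. f n \<in> V" "f \<longlonglongrightarrow> x" "\<forall>n. g n \<in> V" "g \<longlonglongrightarrow> y"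
    unfolding closure_sequential by blast
  then show "x + y \<in> closure V"
    unfolding closure_sequential using assms
    by (intro exI[of _ "\<lambda>n. f n + g n"]) (auto intro: tendsto_add subspace_add)
next
  fix x and c :: real assume "x \<in> closure V"
  then obtain f where "\<forall>n. f n \<in> V" "f \<longlonglongrightarrow> x" unfolding closure_sequential by blast
  then show "c *\<^sub>R x \<in> closure V"
    unfolding closure_sequential using assms
    by (intro exI[of _ "\<lambda>n. c *\<^sub>R f n"]) (auto intro: tendsto_intros subspace_scale)
qed

lemma has_sum_sum_real:
  fixes f :: "'i \<Rightarrow> 'j \<Rightarrow> real"
  assumes "finite F" "\<And>i. i \<in> F \<Longrightarrow> (f i has_sum s i) A"
  shows "((\<lambda>j. \<Sum>i\<in>F. f i j) has_sum (\<Sum>i\<in>F. s i)) A"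
  using assms by (induction F) (auto intro!: has_sum_add)

context
  fixes S :: "'x::{real_inner,banach} \<Rightarrow> 'x"
  assumes S: "positive_selfadjoint S"
begin

interpretation S: bounded_linear S using S by (simp add: positive_selfadjoint_def)

lemma psa_sym: "S x \<bullet> y = x \<bullet> S y"
  and psa_pos: "0 \<le> S x \<bullet> x"
  using S by (auto simp: positive_selfadjoint_def)

private lemmas eig = closed_eigenspace[OF S.bounded_linear_axioms] subspace_eigenspace[OF S.linear]

lemma eigen_orth_proj: "S (orth_proj (eigenspace S l) x) = l *\<^sub>R orth_proj (eigenspace S l) x"
  using orth_proj_in[OF eig, of l x] by (simp add: eigenspace_def)

text \<open>Cauchy-Schwarz for the form, with \<open>S x\<close> as second argument. With
  injectivity it makes the form strictly positive off zero.\<close>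

lemma psa_kernel:
  assumes "S x \<bullet> x = 0"
  shows "S x = 0"
proof -
  have "(S x \<bullet> S x)\<^sup>2 \<le> (S x \<bullet> x) * (S (S x) \<bullet> S x)"
    by (rule psd_cauchy_schwarz[OF S.linear]) (rule psa_sym psa_pos)+
  then show ?thesis using assms by simp
qed

text \<open>Density is the only clause beyond algebra. The orthogonal complement \<open>W\<close> of
  the positive eigenspaces is invariant; if it contained a nonzero vector, it would contain an
  eigenvector, which would be orthogonal to itself.\<close>

lemma eigenspaces_resolution:
  assumes "compact_operator S" "inj S"
  shows "orth_resolution (pos_eigenvalues S) (\<lambda>l. orth_proj (eigenspace S l))"
proof (rule orth_resolution.intro, goal_cases)
  case (1 l)
  note p = orth_proj_in[OF eig, of l] orth_proj_orth[OF eig, of _ l] 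
  show ?case
  proof (rule linearI)
    fix x y :: 'x and r :: real
    show "orth_proj (eigenspace S l) (x + y) = orth_proj (eigenspace S l) x + orth_proj (eigenspace S l) y"
      using p by (intro orth_proj_unique[OF eig])
        (auto simp: subspace_add[OF eig(2)] add_diff_add inner_add_left)
    have "(r *\<^sub>R x - r *\<^sub>R orth_proj (eigenspace S l) x) \<bullet> w = r * ((x - orth_proj (eigenspace S l) x) \<bullet> w)" for w
      by (simp add: inner_diff_left algebra_simps)
    then show "orth_proj (eigenspace S l) (r *\<^sub>R x) = r *\<^sub>R orth_proj (eigenspace S l) x"
      using p by (intro orth_proj_unique[OF eig]) (auto simp: subspace_scale[OF eig(2)])
  qed
next
  case (2 l x y)
  have "(x - orth_proj (eigenspace S l) x) \<bullet> orth_proj (eigenspace S l) y = 0"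
    "(y - orth_proj (eigenspace S l) y) \<bullet> orth_proj (eigenspace S l) x = 0"
    by (intro orth_proj_orth[OF eig] orth_proj_in[OF eig])+
  then show ?case by (metis inner_commute inner_diff_left right_minus_eq)
next
  case (3 l x)
  show ?case by (rule orth_proj_unique[OF eig]) (auto intro: orth_proj_in[OF eig])
next
  case (4 l m x)
  show ?case
  proof (rule orth_proj_unique[OF eig])
    show "0 \<in> eigenspace S l" by (rule subspace_0[OF eig(2)])
    fix w assume "w \<in> eigenspace S l"
    then have "S w = l *\<^sub>R w" by (simp add: eigenspace_def)
    then have "l * (orth_proj (eigenspace S m) x \<bullet> w) = m * (orth_proj (eigenspace S m) x \<bullet> w)"
      using psa_sym[of "orth_proj (eigenspace S m) x" w] by (auto simp: eigen_orth_proj)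
    then show "(orth_proj (eigenspace S m) x - 0) \<bullet> w = 0" using 4 by simp
  qed
next
  case 5
  let ?Eig = "\<Union>l\<in>pos_eigenvalues S. eigenspace S l"
  have V0: "?Eig \<subseteq> (\<Union>l\<in>pos_eigenvalues S. range (orth_proj (eigenspace S l)))"
  proof
    fix e assume "e \<in> ?Eig"
    then obtain l where l: "l \<in> pos_eigenvalues S" "e \<in> eigenspace S l" by blast
    then have "orth_proj (eigenspace S l) e = e" by (intro orth_proj_unique[OF eig]) auto
    then show "e \<in> (\<Union>l\<in>pos_eigenvalues S. range (orth_proj (eigenspace S l)))" using l by (metis UN_I rangeI)
  qed
  let ?V = "closure (span (\<Union>l\<in>pos_eigenvalues S. range (orth_proj (eigenspace S l))))"
  show ?case
  proof (rule ccontr)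
    assume "?V \<noteq> UNIV"
    then obtain x0 where x0: "x0 \<notin> ?V" by blast
    have "closed ?V" "subspace ?V" by (auto intro: subspace_closure subspace_span)
    from ex_orth_projection[OF this, of x0] obtain v where v: "v \<in> ?V" "\<forall>w\<in>?V. (x0 - v) \<bullet> w = 0" by blast
    define w0 where "w0 = x0 - v"
    have "w0 \<noteq> 0" using x0 v(1) by (auto simp: w0_def)
    define W where "W = (\<Inter>e\<in>?Eig. {w. w \<bullet> e = 0})"
    have "closed W" unfolding W_def by (intro closed_INT ballI closed_Collect_eq continuous_intros)
    moreover have "subspace W" by (auto simp: W_def subspace_def inner_add_left)
    moreover have "S w \<in> W" if "w \<in> W" for w
      using that by (auto simp: W_def psa_sym eigenspace_def)
    moreover have "w0 \<in> W"
      using v(2) V0 closure_subset[of "span (\<Union>l\<in>pos_eigenvalues S. range (orth_proj (eigenspace S l)))"]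
        span_superset[of "\<Union>l\<in>pos_eigenvalues S. range (orth_proj (eigenspace S l))"]
      unfolding W_def w0_def by blast
    moreover have "0 < S w0 \<bullet> w0"
    proof -
      have "S w0 \<noteq> 0" using \<open>w0 \<noteq> 0\<close> assms(2) S.zero by (metis injD)
      then show ?thesis using psa_kernel[of w0] psa_pos[of w0] by linarith
    qed
    ultimately obtain l x where lx: "0 < l" "x \<in> W" "x \<noteq> 0" "S x = l *\<^sub>R x"
      using compact_positive_has_eigenvector[OF assms(1) psa_sym psa_pos, of W w0] by blast
    then have "x \<in> ?Eig" by (auto simp: eigenspace_def pos_eigenvalues_def)
    then have "x \<bullet> x = 0" using lx(2) unfolding W_def by blast
    then show False using lx(3) by simp
  qed
qed

lemma quadratic_form_has_sum:
  assumes "compact_operator S" "inj S"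
  shows "((\<lambda>l. l * (norm (orth_proj (eigenspace S l) x))\<^sup>2) has_sum S x \<bullet> x) (pos_eigenvalues S)"
proof -
  interpret P: orth_resolution "pos_eigenvalues S" "\<lambda>l. orth_proj (eigenspace S l)"
    by (rule eigenspaces_resolution[OF assms])
  have "bounded_linear (\<lambda>v. S v \<bullet> x)"
    by (rule bounded_linear_compose[OF bounded_linear_inner_left S.bounded_linear_axioms])
  from has_sum_bounded_linear[OF this P.has_sum[of x]]
  have "((\<lambda>l. S (orth_proj (eigenspace S l) x) \<bullet> x) has_sum S x \<bullet> x) (pos_eigenvalues S)" .
  moreover have "S (orth_proj (eigenspace S l) x) \<bullet> x = l * (norm (orth_proj (eigenspace S l) x))\<^sup>2"
    if "l \<in> pos_eigenvalues S" for l
    using P.inner_self[OF that, of x] by (simp add: eigen_orth_proj)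
  then have "((\<lambda>l. S (orth_proj (eigenspace S l) x) \<bullet> x) has_sum S x \<bullet> x) (pos_eigenvalues S)
    \<longleftrightarrow> ((\<lambda>l. l * (norm (orth_proj (eigenspace S l) x))\<^sup>2) has_sum S x \<bullet> x) (pos_eigenvalues S)"
    by (rule has_sum_cong)
  ultimately show ?thesis by (simp only:)
qed

text \<open>Trace class refers to some basis, while \<open>op_trace\<close> sums over a basis picked
  by \<open>SOME\<close>. The eigenprojections mediate between the two: each
  \<open>(norm (P\<^sub>l f))\<^sup>2\<close> is expanded along \<open>E\<close> by Parseval, and
  the partial sums over the new basis stay below the sum over \<open>E\<close>.\<close>

lemma trace_class_summable_on_basis:
  assumes "inj S" "trace_class_pos S" "orthonormal_basis E'"
  shows "(\<lambda>e. S e \<bullet> e) summable_on E'"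
proof (rule nonneg_bdd_above_summable_on)
  show "0 \<le> S e \<bullet> e" for e by (rule psa_pos)
  have comp: "compact_operator S" by (rule compact_operator_trace_class[OF S assms(2)])
  let ?P = "\<lambda>l. orth_proj (eigenspace S l)"
  interpret P: orth_resolution "pos_eigenvalues S" ?P
    by (rule eigenspaces_resolution[OF comp assms(1)])
  obtain E where E: "orthonormal_basis E" and sE: "(\<lambda>e. S e \<bullet> e) summable_on E"
    using assms(2) by (auto simp: trace_class_pos_def)
  show "bdd_above (sum (\<lambda>e. S e \<bullet> e) ` {F. F \<subseteq> E' \<and> finite F})"
  proof (rule bdd_aboveI, elim imageE CollectE conjE)
    fix q F assume F: "q = (\<Sum>e\<in>F. S e \<bullet> e)" "F \<subseteq> E'" "finite F"
    have bess: "(\<Sum>f\<in>F. (f \<bullet> x)\<^sup>2) \<le> (norm x)\<^sup>2" for x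
      using finite_sum_le_has_sum[OF parseval[OF assms(3), of x] F(3,2)] by (simp add: inner_commute)
    have hs: "((\<lambda>l. \<Sum>f\<in>F. l * (norm (?P l f))\<^sup>2) has_sum q) (pos_eigenvalues S)"
      unfolding F(1) by (intro has_sum_sum_real F(3) quadratic_form_has_sum[OF comp assms(1)])
    show "q \<le> (\<Sum>\<^sub>\<infinity>e\<in>E. S e \<bullet> e)"
    proof (rule has_sum_le_finite_sums[OF hs])
      fix G assume G: "finite G" "G \<subseteq> pos_eigenvalues S"
      have "((\<lambda>e. \<Sum>l\<in>G. \<Sum>f\<in>F. l * (?P l f \<bullet> e)\<^sup>2) has_sum (\<Sum>l\<in>G. \<Sum>f\<in>F. l * (norm (?P l f))\<^sup>2)) E"
        using G(1) F(3) by (intro has_sum_sum_real has_sum_cmult_right parseval E)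
      then show "(\<Sum>l\<in>G. \<Sum>f\<in>F. l * (norm (?P l f))\<^sup>2) \<le> (\<Sum>\<^sub>\<infinity>e\<in>E. S e \<bullet> e)"
      proof (rule has_sum_mono[OF _ has_sum_infsum[OF sE]])
        fix e assume "e \<in> E"
        \<comment> \<open>Symmetry moves the projection from \<open>f\<close> to \<open>e\<close>,
          so that Bessel for the new basis removes the sum over \<open>F\<close>.\<close>
        have "(\<Sum>l\<in>G. \<Sum>f\<in>F. l * (?P l f \<bullet> e)\<^sup>2) = (\<Sum>l\<in>G. l * (\<Sum>f\<in>F. (f \<bullet> ?P l e)\<^sup>2))"
          using G(2) P.sym by (auto simp: sum_distrib_left subset_iff intro!: sum.cong)
        also have "\<dots> \<le> (\<Sum>l\<in>G. l * (norm (?P l e))\<^sup>2)"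
          using G(2) by (intro sum_mono mult_left_mono bess) (auto simp: pos_eigenvalues_def)
        also have "\<dots> \<le> S e \<bullet> e"
          using G by (intro finite_sum_le_has_sum[OF quadratic_form_has_sum[OF comp assms(1)]])
            (auto simp: pos_eigenvalues_def)
        finally show "(\<Sum>l\<in>G. \<Sum>f\<in>F. l * (?P l f \<bullet> e)\<^sup>2) \<le> S e \<bullet> e" .
      qed
    qed
  qed
qed

text \<open>A summable family of positive reals is countable. Countability of the basis later
  permits exchanging its sum with the expectation.\<close>

lemma trace_class_basis_countable:
  fixes E :: "'x set"
  assumes "inj S" "trace_class_pos S" "orthonormal_basis E"
  shows "countable E"
proof -
  have "0 < S e \<bullet> e" if "e \<in> E" for e
  proof -
    have "e \<noteq> 0" using assms(3) that by (auto simp: orthonormal_basis_def)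
    then have "S e \<noteq> 0" using assms(1) S.zero by (metis injD)
    then show ?thesis using psa_kernel[of e] psa_pos[of e] by linarith
  qed
  moreover have "countable {e \<in> E. S e \<bullet> e \<noteq> 0}"
    using trace_class_summable_on_basis[OF assms] by (rule summable_countable_real)
  ultimately show ?thesis by (metis (mono_tags, lifting) Collect_mem_eq Collect_mono countable_subset less_numeral_extra(3))
qed

end

section \<open>Powers of a contraction that is symmetric for a form\<close>

text \<open>The space need not be complete for the form of \<open>S\<close>, so no spectral theorem
  for \<open>R\<close> is invoked: the powers are controlled through the scalar sequence
  \<open>k \<mapsto> S (R\<^sup>k x) \<bullet> x\<close> alone.\<close>

locale symmetric_contraction =
  fixes S R :: "'x::real_inner \<Rightarrow> 'x"
  assumes linS: "linear S" and linR: "linear R"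
    and symS: "S x \<bullet> y = x \<bullet> S y" and posS: "0 \<le> S x \<bullet> x"
    and symR: "S (R x) \<bullet> y = S x \<bullet> R y"
    and posR: "0 \<le> S (R x) \<bullet> x" and leR: "S (R x) \<bullet> x \<le> S x \<bullet> x"
begin

interpretation S: linear S by (rule linS)
interpretation R: linear R by (rule linR)

lemma linear_pow: "linear (R ^^ n)"
proof (induction n)
  case 0
  show ?case by (simp only: funpow.simps linear_id)
next
  case (Suc n)
  show ?case unfolding funpow.simps by (rule linear_compose[OF Suc linR])
qed

lemma form_pow_add: "S ((R ^^ (m + n)) x) \<bullet> y = S ((R ^^ m) x) \<bullet> (R ^^ n) y"
proof (induction n arbitrary: y)
  case (Suc n)
  have "S ((R ^^ (m + Suc n)) x) \<bullet> y = S ((R ^^ (m + n)) x) \<bullet> R y" by (simp add: symR)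
  also have "\<dots> = S ((R ^^ m) x) \<bullet> (R ^^ n) (R y)" by (rule Suc)
  also have "(R ^^ n) (R y) = (R ^^ Suc n) y" by (simp add: funpow_swap1)
  finally show ?case .
qed simp

text \<open>Half of the powers move to the right argument; an odd exponent leaves one
  \<open>R\<close>, which \<open>posR\<close> handles.\<close>

lemma form_pow_nonneg: "0 \<le> S ((R ^^ k) x) \<bullet> x"
proof (cases "even k")
  case True
  then obtain i where "k = i + i" by (metis dvdE mult_2)
  then show ?thesis by (simp add: form_pow_add posS)
next
  case False
  then obtain i where "k = Suc i + i" by (metis oddE mult_2 Suc_eq_plus1 add_Suc)
  then show ?thesis using form_pow_add[of "Suc i" i x x] posR by simp
qed

text \<open>The right side is a second difference in \<open>k\<close>, so nonnegativity of the left
  side is convexity.\<close>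

lemma form_pow_diff:
  "S ((R ^^ k) (x - R x)) \<bullet> (x - R x) =
   S ((R ^^ k) x) \<bullet> x - 2 * (S ((R ^^ Suc k) x) \<bullet> x) + S ((R ^^ Suc (Suc k)) x) \<bullet> x"
proof -
  interpret Rk: linear "R ^^ k" by (rule linear_pow)
  have 1: "S ((R ^^ k) x) \<bullet> R x = S ((R ^^ Suc k) x) \<bullet> x" using form_pow_add[of k 1 x x] by simp
  have 2: "(R ^^ k) (R x) = (R ^^ Suc k) x" by (simp add: funpow_swap1)
  have 3: "S ((R ^^ Suc k) x) \<bullet> R x = S ((R ^^ Suc (Suc k)) x) \<bullet> x"
    using form_pow_add[of "Suc k" 1 x x] by simp
  show ?thesis
    unfolding Rk.diff S.diff inner_diff_left inner_diff_right 1 2 3 by simp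
qed

lemma form_pow_Suc_le: "S ((R ^^ Suc k) x) \<bullet> x \<le> S ((R ^^ k) x) \<bullet> x"
proof (cases "even k")
  case True
  then obtain i where i: "k = i + i" by (metis dvdE mult_2)
  have "S ((R ^^ (Suc i + i)) x) \<bullet> x \<le> S ((R ^^ (i + i)) x) \<bullet> x"
    unfolding form_pow_add using leR by simp
  then show ?thesis by (simp add: i)
next
  case False
  then obtain i where i: "k = Suc i + i" by (metis oddE mult_2 Suc_eq_plus1 add_Suc)
  have e: "Suc k = Suc i + Suc i" "Suc (Suc k) = Suc (Suc i) + Suc i" by (simp_all add: i)
  let ?y = "(R ^^ i) x"
  have a: "S ((R ^^ k) x) \<bullet> x = S (R ?y) \<bullet> ?y" unfolding i form_pow_add by simp
  have b: "S ((R ^^ Suc k) x) \<bullet> x = S (R (R ?y)) \<bullet> ?y"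
    unfolding e form_pow_add by (simp add: symR)
  \<comment> \<open>Write \<open>f i\<close> for \<open>S ((R ^^ i) ?y) \<bullet> ?y\<close>. Then
    \<open>leR\<close> at \<open>R ?y\<close> gives \<open>f 3 \<le> f 2\<close>, and
    \<open>posR\<close> at \<open>?y - R ?y\<close> gives \<open>2 * f 2 \<le> f 1 + f 3\<close>;
    together \<open>f 2 \<le> f 1\<close>.\<close>
  have c: "S (R (R ?y)) \<bullet> R ?y \<le> S (R ?y) \<bullet> R ?y" by (rule leR)
  have d: "0 \<le> S (R (?y - R ?y)) \<bullet> (?y - R ?y)" by (rule posR)
  also have "\<dots> = S (R ?y) \<bullet> ?y - 2 * (S (R (R ?y)) \<bullet> ?y) + S (R (R ?y)) \<bullet> R ?y"
    by (simp add: R.diff S.diff inner_diff_left inner_diff_right symR)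
  finally show ?thesis using a b c by (simp add: symR)
qed

lemma form_pow_le: "S ((R ^^ k) x) \<bullet> x \<le> S x \<bullet> x"
  by (induction k) (auto intro: order_trans[OF form_pow_Suc_le] simp del: funpow.simps(2))

lemma form_contraction: "S ((R ^^ k) x) \<bullet> (R ^^ k) x \<le> S x \<bullet> x"
  using form_pow_le[of "k + k" x] by (simp add: form_pow_add)

text \<open>The sequence \<open>k \<mapsto> S (R\<^sup>k x) \<bullet> x\<close> is nonnegative, decreasing and convex, so \<open>k + 1\<close> times
  its decrement at \<open>k\<close> is at most the sum of the decrements up to \<open>k\<close>, which telescopes.\<close>

lemma form_decrement_le:
  "real (Suc k) * (S ((R ^^ k) x) \<bullet> x - S ((R ^^ Suc k) x) \<bullet> x) \<le> S x \<bullet> x"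
proof -
  define d where "d k = S ((R ^^ k) x) \<bullet> x - S ((R ^^ Suc k) x) \<bullet> x" for k
  have "d (Suc k) \<le> d k" for k
    using form_pow_nonneg[of k "x - R x"] unfolding form_pow_diff d_def by linarith
  then have dec: "d k \<le> d i" if "i \<le> k" for i k using that lift_Suc_antimono_le by blast
  have "real (Suc k) * d k = (\<Sum>i\<in>{..<Suc k}. d k)" by simp
  also have "\<dots> \<le> (\<Sum>i\<in>{..<Suc k}. d i)" by (intro sum_mono dec) simp
  also have "\<dots> = S ((R ^^ 0) x) \<bullet> x - S ((R ^^ Suc k) x) \<bullet> x"
    unfolding d_def by (rule sum_lessThan_telescope')
  also have "\<dots> \<le> S x \<bullet> x" using form_pow_nonneg[of "Suc k" x] by (simp del: funpow.simps)
  finally show ?thesis by (simp add: d_def)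
qed

end

section \<open>The regularized inverse, the gain and the error propagator\<close>

locale regularized =
  fixes A :: "'x::{real_inner,banach} \<Rightarrow> 'y::{real_inner,banach}" and S :: "'x \<Rightarrow> 'x" and \<alpha> :: real
  assumes A: "bounded_linear A" and S: "positive_selfadjoint S" and \<alpha>: "0 < \<alpha>"
begin

interpretation A: bounded_linear A by (rule A)
interpretation S: bounded_linear S using S by (simp add: positive_selfadjoint_def)

lemma symS: "S x \<bullet> y = x \<bullet> S y" and posS: "0 \<le> S x \<bullet> x"
  using S by (auto simp: positive_selfadjoint_def)

interpretation A': bounded_linear "adjoint A" by (rule bounded_linear_adjoint[OF A])

lemma adjA: "A x \<bullet> y = x \<bullet> adjoint A y" by (rule adjoint_inner[OF A])

definition L :: "'y \<Rightarrow> 'y" where "L = (\<lambda>w. A (S (adjoint A w)) + \<alpha> *\<^sub>R w)"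
definition Li :: "'y \<Rightarrow> 'y" where "Li = inv L"
definition R :: "'x \<Rightarrow> 'x" where "R x = x - adjoint A (Li (A (S x)))"
definition T :: "'x \<Rightarrow> 'x" where "T x = x - S (adjoint A (Li (A x)))"

lemma H_sym: "A (S (adjoint A v)) \<bullet> w = v \<bullet> A (S (adjoint A w))"
  by (metis adjA symS inner_commute)

lemma bounded_linear_L: "bounded_linear L"
  unfolding L_def
  by (intro bounded_linear_add bounded_linear_compose[OF A] bounded_linear_compose[OF S.bounded_linear_axioms]
      A'.bounded_linear_axioms bounded_linear_scaleR_right)

lemma L_coercive: "\<alpha> * (norm w)\<^sup>2 \<le> L w \<bullet> w"
proof -
  have "A (S (adjoint A w)) \<bullet> w = S (adjoint A w) \<bullet> adjoint A w" by (rule adjA)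
  then show ?thesis using posS[of "adjoint A w"] by (simp add: L_def inner_add_left power2_norm_eq_inner)
qed

lemma bij_L: "bij L" by (rule coercive_bij[OF bounded_linear_L \<alpha> L_coercive])

lemma L_Li: "L (Li v) = v" unfolding Li_def using bij_L by (simp add: bij_is_surj surj_f_inv_f)
lemma Li_L: "Li (L v) = v" unfolding Li_def using bij_L by (simp add: bij_is_inj)

text \<open>The source of both smoothing identities: it turns \<open>A S R\<close> into
  \<open>\<alpha> Li A S\<close> and \<open>A T\<close> into \<open>\<alpha> Li A\<close>.\<close>

lemma H_Li: "A (S (adjoint A (Li v))) = v - \<alpha> *\<^sub>R Li v"
  using L_Li[of v] by (simp add: L_def algebra_simps)

lemma norm_Li: "\<alpha> * norm (Li v) \<le> norm v"
proof -
  have "\<alpha> * (norm (Li v))\<^sup>2 \<le> v \<bullet> Li v" using L_coercive[of "Li v"] by (simp add: L_Li)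
  also have "\<dots> \<le> norm v * norm (Li v)" by (rule norm_cauchy_schwarz)
  finally have "(\<alpha> * norm (Li v)) * norm (Li v) \<le> norm v * norm (Li v)"
    by (simp add: power2_eq_square mult_ac)
  then show ?thesis by (cases "Li v = 0") auto
qed

lemma Li_nonneg: "0 \<le> Li v \<bullet> v"
proof -
  have "0 \<le> \<alpha> * (norm (Li v))\<^sup>2" using \<alpha> by simp
  then show ?thesis using L_coercive[of "Li v"] by (simp add: L_Li inner_commute)
qed

lemma Li_sym: "Li v \<bullet> w = v \<bullet> Li w"
proof -
  have "L x \<bullet> y = x \<bullet> L y" for x y by (simp add: L_def inner_add_left inner_add_right H_sym)
  from this[of "Li v" "Li w"] show ?thesis by (simp add: L_Li)
qed

lemma bounded_linear_Li: "bounded_linear Li"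
proof (rule bounded_linear_intro)
  interpret L: bounded_linear L by (rule bounded_linear_L)
  show "Li (v + w) = Li v + Li w" for v w by (metis L.add L_Li Li_L)
  show "Li (r *\<^sub>R v) = r *\<^sub>R Li v" for r v by (metis L.scaleR L_Li Li_L)
  show "norm (Li v) \<le> norm v * inverse \<alpha>" for v
    using norm_Li[of v] \<alpha> by (simp add: field_simps)
qed

interpretation Li: bounded_linear Li by (rule bounded_linear_Li)

lemma gain_eq: "gain A S \<alpha> v = S (adjoint A (Li v))"
  by (simp add: gain_def Li_def L_def)

lemma adjoint_gain: "adjoint (gain A S \<alpha>) x = Li (A (S x))"
proof -
  have "adjoint (gain A S \<alpha>) = (\<lambda>x. Li (A (S x)))"
    by (rule adjoint_unique) (metis gain_eq adjA symS Li_sym inner_commute)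
  then show ?thesis by simp
qed

lemma bounded_linear_R: "bounded_linear R"
  unfolding R_def
  by (intro bounded_linear_sub bounded_linear_ident bounded_linear_compose[OF A'.bounded_linear_axioms]
    bounded_linear_compose[OF bounded_linear_Li] bounded_linear_compose[OF A] S.bounded_linear_axioms)

lemma bounded_linear_T: "bounded_linear T"
  unfolding T_def
  by (intro bounded_linear_sub bounded_linear_ident bounded_linear_compose[OF A'.bounded_linear_axioms]
    bounded_linear_compose[OF bounded_linear_Li] A bounded_linear_compose[OF S.bounded_linear_axioms])

lemma form_R: "S (R x) \<bullet> y = S x \<bullet> y - Li (A (S x)) \<bullet> A (S y)"
  by (metis R_def S.diff inner_diff_left adjA symS inner_commute)

lemma ASR: "A (S (R x)) = \<alpha> *\<^sub>R Li (A (S x))"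
  by (simp add: R_def S.diff A.diff H_Li)

sublocale symmetric_contraction S R
proof (rule symmetric_contraction.intro, goal_cases)
  case 1
  show ?case by (rule S.linear)
next
  case 2
  show ?case by (rule bounded_linear.linear[OF bounded_linear_R])
next
  case (3 x y)
  show ?case by (rule symS)
next
  case (4 x)
  show ?case by (rule posS)
next
  case (5 x y)
  show ?case by (metis form_R Li_sym symS inner_commute)
next
  case (6 x)
  let ?v = "Li (A (S x))"
  \<comment> \<open>By definition \<open>x = R x + adjoint A ?v\<close>; both resulting terms are
    nonnegative, the second because of \<open>ASR\<close>.\<close>
  have "S (R x) \<bullet> x = S (R x) \<bullet> R x + S (R x) \<bullet> adjoint A ?v"
    by (simp add: R_def inner_diff_right)
  also have "S (R x) \<bullet> adjoint A ?v = A (S (R x)) \<bullet> ?v" by (simp add: adjA)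
  also have "\<dots> = \<alpha> * (?v \<bullet> ?v)" by (simp add: ASR)
  finally show ?case using posS[of "R x"] \<alpha> by simp
next
  case (7 x)
  show ?case using Li_nonneg[of "A (S x)"] by (simp add: form_R)
qed

text \<open>The squared norm is exactly \<alpha> times the decrement of the form sequence at the odd
  index 2 m - 1, and \<open>form_decrement_le\<close> at that index carries the factor 2 m.\<close>

lemma norm_ASR_pow:
  assumes "1 \<le> m"
  shows "2 * real m * (norm (A (S ((R ^^ m) x))))\<^sup>2 \<le> \<alpha> * (S x \<bullet> x)"
proof -
  obtain j where m: "m = Suc j" using assms by (cases m) auto
  let ?y = "(R ^^ j) x"
  have e: "2 * j + 1 = j + Suc j" "Suc (2 * j + 1) = Suc j + Suc j" by auto
  have "S ((R ^^ (2 * j + 1)) x) \<bullet> x = S ?y \<bullet> R ?y"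
    unfolding e(1) form_pow_add by simp
  moreover have "S ((R ^^ Suc (2 * j + 1)) x) \<bullet> x = S (R ?y) \<bullet> R ?y"
    unfolding e(2) form_pow_add by simp
  ultimately have "S ((R ^^ (2 * j + 1)) x) \<bullet> x - S ((R ^^ Suc (2 * j + 1)) x) \<bullet> x = S (?y - R ?y) \<bullet> R ?y"
    by (simp add: S.diff inner_diff_left)
  also have "\<dots> = adjoint A (Li (A (S ?y))) \<bullet> S (R ?y)" by (simp add: R_def symS)
  also have "\<dots> = Li (A (S ?y)) \<bullet> A (S (R ?y))" by (metis adjA inner_commute)
  finally have "\<alpha> * (S ((R ^^ (2 * j + 1)) x) \<bullet> x - S ((R ^^ Suc (2 * j + 1)) x) \<bullet> x)
    = A (S (R ?y)) \<bullet> A (S (R ?y))"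
    by (simp only: ASR inner_scaleR_left inner_scaleR_right)
  then have "\<alpha> * (S ((R ^^ (2 * j + 1)) x) \<bullet> x - S ((R ^^ Suc (2 * j + 1)) x) \<bullet> x)
    = (norm (A (S ((R ^^ m) x))))\<^sup>2"
    by (simp add: m power2_norm_eq_inner)
  moreover have "2 * real m * q = \<alpha> * (real (Suc (2 * j + 1)) * D)" if "\<alpha> * D = q" for D q
    using that by (auto simp: m algebra_simps)
  ultimately have "2 * real m * (norm (A (S ((R ^^ m) x))))\<^sup>2 = \<alpha> * (real (Suc (2 * j + 1)) *
      (S ((R ^^ (2 * j + 1)) x) \<bullet> x - S ((R ^^ Suc (2 * j + 1)) x) \<bullet> x))"
    by blast
  also have "\<dots> \<le> \<alpha> * (S x \<bullet> x)" using \<alpha> by (intro mult_left_mono form_decrement_le) simp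
  finally show ?thesis .
qed

text \<open>By \<open>ASR\<close>, \<alpha> times the adjoint gain after \<open>j\<close> steps is
  \<open>A S R\<^sup>j\<^sup>+\<^sup>1\<close>. The shift produces j + 1, and dividing by
  \<open>\<alpha>\<^sup>2\<close> leaves one \<alpha> in the denominator of the variance.\<close>

lemma norm_adjoint_gain_pow:
  "2 * real (Suc j) * \<alpha> * (norm (adjoint (gain A S \<alpha>) ((R ^^ j) x)))\<^sup>2 \<le> S x \<bullet> x"
proof -
  have "A (S ((R ^^ Suc j) x)) = \<alpha> *\<^sub>R adjoint (gain A S \<alpha>) ((R ^^ j) x)"
    by (simp add: ASR adjoint_gain)
  then have "2 * real (Suc j) * (\<alpha>\<^sup>2 * (norm (adjoint (gain A S \<alpha>) ((R ^^ j) x)))\<^sup>2) \<le> \<alpha> * (S x \<bullet> x)"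
    using norm_ASR_pow[of "Suc j" x] by (simp add: power_mult_distrib del: of_nat_Suc)
  then have "\<alpha> * (2 * real (Suc j) * \<alpha> * (norm (adjoint (gain A S \<alpha>) ((R ^^ j) x)))\<^sup>2) \<le> \<alpha> * (S x \<bullet> x)"
    by (simp only: power2_eq_square mult_ac)
  then show ?thesis using \<alpha> by (simp only: mult_le_cancel_left_pos)
qed

lemma T_S: "T (S z) = S (R z)"
  by (simp add: T_def R_def S.diff)

lemma T_pow_S: "(T ^^ n) (S z) = S ((R ^^ n) z)"
  by (induction n) (auto simp: T_S)

lemma T_adj: "T x \<bullet> y = x \<bullet> R y"
proof -
  have "S (adjoint A (Li (A x))) \<bullet> y = x \<bullet> adjoint A (Li (A (S y)))"
    by (metis symS adjA Li_sym inner_commute)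
  then show ?thesis by (simp add: T_def R_def inner_diff_left inner_diff_right)
qed

lemma T_pow_adj: "(T ^^ n) x \<bullet> y = x \<bullet> (R ^^ n) y"
proof (induction n arbitrary: y)
  case (Suc n)
  have "(T ^^ Suc n) x \<bullet> y = (T ^^ n) x \<bullet> R y" by (simp add: T_adj)
  also have "\<dots> = x \<bullet> (R ^^ n) (R y)" by (rule Suc)
  also have "(R ^^ n) (R y) = (R ^^ Suc n) y" by (simp add: funpow_swap1)
  finally show ?case .
qed simp

text \<open>\<open>A T = \<alpha> Li A\<close>, and \<open>\<alpha> Li\<close> is a contraction.
  Through the link between \<open>A\<close> and \<open>S\<close> this bounds the powers in the norm
  of order a.\<close>

lemma norm_AT_pow: "norm (A ((T ^^ n) x)) \<le> norm (A x)"
proof (induction n)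
  case (Suc n)
  have "A (T y) = \<alpha> *\<^sub>R Li (A y)" for y by (simp add: T_def A.diff H_Li)
  then have "norm (A ((T ^^ Suc n) x)) = \<alpha> * norm (Li (A ((T ^^ n) x)))" using \<alpha> by simp
  also have "\<dots> \<le> norm (A ((T ^^ n) x))" by (rule norm_Li)
  finally show ?case using Suc by simp
qed simp

lemma bounded_linear_T_pow: "bounded_linear (T ^^ n)"
proof (induction n)
  case 0
  show ?case by (simp add: id_def)
next
  case (Suc n)
  show ?case using bounded_linear_compose[OF bounded_linear_T Suc] by (simp add: o_def)
qed

end

section \<open>Interpolation and the bias\<close>

text \<open>A constant multiple of \<open>\<mu> powr p\<close> for positive \<mu>: the power as a
  superposition of the fractions that occur in quadratic K-functionals. Values in
  \<open>ennreal\<close> spare integrability arguments.\<close>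

definition stieltjes_integral :: "real \<Rightarrow> real \<Rightarrow> ennreal" where
  "stieltjes_integral p \<mu> =
     (\<integral>\<^sup>+t. ennreal (t powr (- p - 1) * (t * \<mu> / (1 + t * \<mu>))) * indicator {0<..} t \<partial>lborel)"

lemma stieltjes_integral_scale:
  assumes "0 < \<mu>"
  shows "stieltjes_integral p \<mu> = ennreal (\<mu> powr p) * stieltjes_integral p 1"
proof -
  have pt: "ennreal ((0 + 1 / \<mu> * t) powr (- p - 1) * ((0 + 1 / \<mu> * t) * \<mu> / (1 + (0 + 1 / \<mu> * t) * \<mu>)))
        * indicator {0<..} (0 + 1 / \<mu> * t) =
      ennreal (\<mu> powr (p + 1)) * (ennreal (t powr (- p - 1) * (t * 1 / (1 + t * 1))) * indicator {0<..} t)" for t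
  proof (cases "0 < t")
    case True
    have "(1 / \<mu> * t) powr (- p - 1) = \<mu> powr (p + 1) * t powr (- p - 1)"
      using assms True by (simp add: powr_divide powr_minus_divide powr_diff powr_add field_simps)
    then show ?thesis using assms True by (simp add: ennreal_mult' mult.assoc flip: ennreal_mult)
  next
    case False
    then have "\<not> 0 < 1 / \<mu> * t" using assms by (simp add: zero_less_divide_iff)
    then show ?thesis using False by simp
  qed
  have "stieltjes_integral p \<mu> = \<bar>1 / \<mu>\<bar> * (\<integral>\<^sup>+t. ennreal ((0 + 1 / \<mu> * t) powr (- p - 1) *
      ((0 + 1 / \<mu> * t) * \<mu> / (1 + (0 + 1 / \<mu> * t) * \<mu>))) * indicator {0<..} (0 + 1 / \<mu> * t) \<partial>lborel)"
    unfolding stieltjes_integral_def using assms by (intro nn_integral_real_affine) auto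
  also have "\<dots> = ennreal (1 / \<mu>) * (ennreal (\<mu> powr (p + 1)) * stieltjes_integral p 1)"
    unfolding pt stieltjes_integral_def using assms by (subst nn_integral_cmult) auto
  also have "\<dots> = ennreal (1 / \<mu> * \<mu> powr (p + 1)) * stieltjes_integral p 1"
    using assms by (subst ennreal_mult) (simp_all add: mult.assoc)
  also have "1 / \<mu> * \<mu> powr (p + 1) = \<mu> powr p" using assms by (simp add: powr_add)
  finally show ?thesis .
qed

lemma stieltjes_integral_finite:
  assumes "0 < p" "p < 1"
  shows "stieltjes_integral p 1 < \<infinity>"
proof -
  \<comment> \<open>Near 0 the integrand is at most \<open>t powr (- p)\<close>, integrable as
    \<open>p < 1\<close>; near infinity it is at most \<open>t powr (- p - 1)\<close>, integrable as
    \<open>0 < p\<close>.\<close>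
  have "stieltjes_integral p 1 \<le> (\<integral>\<^sup>+t. ennreal (t powr (- p)) * indicator {0..1} t +
      ennreal (t powr (- p - 1)) * indicator {1..} t \<partial>lborel)"
    unfolding stieltjes_integral_def
  proof (intro nn_integral_mono)
    fix t :: real
    show "ennreal (t powr (- p - 1) * (t * 1 / (1 + t * 1))) * indicator {0<..} t
      \<le> ennreal (t powr (- p)) * indicator {0..1} t + ennreal (t powr (- p - 1)) * indicator {1..} t"
    proof (cases "0 < t")
      case True
      have 1: "t powr (- p - 1) * (t / (1 + t)) \<le> t powr (- p - 1)"
        using True by (intro mult_left_le) auto
      have "t powr (- p - 1) * (t / (1 + t)) \<le> t powr (- p - 1) * t"
        using True by (intro mult_left_mono) (auto simp: field_simps)
      also have "\<dots> = t powr (- p)" using True by (simp add: powr_diff)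
      finally have 2: "t powr (- p - 1) * (t / (1 + t)) \<le> t powr (- p)" .
      show ?thesis
      proof (cases "t \<le> 1")
        case t: True
        have "ennreal (t powr (- p - 1) * (t * 1 / (1 + t * 1))) * indicator {0<..} t
            \<le> ennreal (t powr (- p)) * indicator {0..1} t"
          using True t 2 by (simp add: ennreal_leI)
        then show ?thesis by (simp add: add_increasing2)
      next
        case False
        then show ?thesis using True 1 by (simp add: ennreal_leI)
      qed
    qed simp
  qed
  also have "\<dots> = (\<integral>\<^sup>+t. ennreal (t powr (- p)) * indicator {0..1} t \<partial>lborel) +
      (\<integral>\<^sup>+t. ennreal (t powr (- p - 1)) * indicator {1..} t \<partial>lborel)"
    by (intro nn_integral_add) auto
  also have "(\<integral>\<^sup>+t. ennreal (t powr (- p)) * indicator {0..1} t \<partial>lborel) = ennreal (1 powr (- p + 1) / (- p + 1))"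
    using assms by (intro nn_integral_has_integral_lebesgue' has_integral_powr_from_0) auto
  also have "(\<integral>\<^sup>+t. ennreal (t powr (- p - 1)) * indicator {1..} t \<partial>lborel)
      = ennreal (- (1 powr (- p - 1 + 1)) / (- p - 1 + 1))"
    using assms by (intro nn_integral_has_integral_lebesgue' has_integral_powr_to_inf) auto
  finally show ?thesis by (rule le_less_trans) simp
qed

lemma stieltjes_integral_pos: "0 < stieltjes_integral p 1"
proof -
  \<comment> \<open>On [1, 2] the power is at least its smaller endpoint value, whatever the sign of
    the exponent, and t / (1 + t) is at least 1/2.\<close>
  have "0 < ennreal (min 1 (2 powr (- p - 1)) / 2) * emeasure lborel {1..2::real}"
    by (simp add: ennreal_zero_less_mult_iff)
  also have "\<dots> = (\<integral>\<^sup>+t. ennreal (min 1 (2 powr (- p - 1)) / 2) * indicator {1..2::real} t \<partial>lborel)"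
    by (simp add: nn_integral_cmult_indicator)
  also have "\<dots> \<le> stieltjes_integral p 1"
    unfolding stieltjes_integral_def
  proof (intro nn_integral_mono)
    fix t :: real
    show "ennreal (min 1 (2 powr (- p - 1)) / 2) * indicator {1..2} t
      \<le> ennreal (t powr (- p - 1) * (t * 1 / (1 + t * 1))) * indicator {0<..} t"
    proof (cases "t \<in> {1..2}")
      case True
      have "min 1 (2 powr (- p - 1)) \<le> t powr (- p - 1)"
      proof (cases "0 \<le> - p - 1")
        case nonneg: True
        then have "1 powr (- p - 1) \<le> t powr (- p - 1)" using True by (intro powr_mono2) auto
        then show ?thesis by simp
      next
        case False
        then have "2 powr (- p - 1) \<le> t powr (- p - 1)" using True by (intro powr_mono2') auto
        then show ?thesis by simp
      qed
      then have "min 1 (2 powr (- p - 1)) * (1 / 2) \<le> t powr (- p - 1) * (t / (1 + t))"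
        using True by (intro mult_mono) (auto simp: field_simps)
      then show ?thesis using True by (simp add: ennreal_leI)
    qed simp
  qed
  finally show ?thesis .
qed

text \<open>A comparison of the quadratic \<open>K\<close>-functionals of two interpolation couples for every parameter
  \<open>t\<close> yields, after integration against \<open>t\<^sup>-\<^sup>p\<^sup>-\<^sup>1 dt\<close>, the comparison of the intermediate norms.\<close>

lemma interpolation_sum_le:
  assumes p: "0 < p" "p < (1::real)" and C: "0 \<le> C"
    and \<mu>: "\<And>i. i \<in> F \<union> F' \<Longrightarrow> 0 < \<mu> i"
    and b: "\<And>i. i \<in> F' \<Longrightarrow> 0 \<le> b i" and d: "\<And>i. i \<in> F \<Longrightarrow> 0 \<le> d i"
    and le: "\<And>t. 0 < t \<Longrightarrow> (\<Sum>i\<in>F'. b i * (t * \<mu> i / (1 + t * \<mu> i)))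
      \<le> C * (\<Sum>i\<in>F. d i * (t * \<mu> i / (1 + t * \<mu> i)))"
  shows "(\<Sum>i\<in>F'. b i * \<mu> i powr p) \<le> C * (\<Sum>i\<in>F. d i * \<mu> i powr p)"
proof -
  define f where "f i t = ennreal (t powr (- p - 1) * (t * \<mu> i / (1 + t * \<mu> i))) * indicator {0<..} t" for i t
  have [measurable]: "f i \<in> borel_measurable borel" for i unfolding f_def by measurable
  \<comment> \<open>The common factor of all the integrals. Being finite and positive, it cancels at
    the end.\<close>
  obtain J where J: "stieltjes_integral p 1 = ennreal J" "0 < J"
    using stieltjes_integral_finite[OF p] stieltjes_integral_pos[of p]
    by (metis ennreal_cases ennreal_less_zero_iff infinity_ennreal_def less_irrefl)
  have int: "(\<integral>\<^sup>+t. (\<Sum>i\<in>G. ennreal (g i) * f i t) \<partial>lborel) = ennreal ((\<Sum>i\<in>G. g i * \<mu> i powr p) * J)"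
    if "G \<subseteq> F \<union> F'" "\<And>i. i \<in> G \<Longrightarrow> 0 \<le> g i" for g G
  proof -
    have "(\<integral>\<^sup>+t. (\<Sum>i\<in>G. ennreal (g i) * f i t) \<partial>lborel) = (\<Sum>i\<in>G. \<integral>\<^sup>+t. ennreal (g i) * f i t \<partial>lborel)"
      by (intro nn_integral_sum) auto
    also have "\<dots> = (\<Sum>i\<in>G. ennreal (g i) * stieltjes_integral p (\<mu> i))"
      by (simp add: nn_integral_cmult stieltjes_integral_def f_def)
    also have "\<dots> = (\<Sum>i\<in>G. ennreal (g i * \<mu> i powr p * J))"
      using that J(2) \<mu> by (intro sum.cong) (auto simp: stieltjes_integral_scale[of "\<mu> _"] J(1) ennreal_mult mult.assoc subset_iff)
    also have "\<dots> = ennreal (\<Sum>i\<in>G. g i * \<mu> i powr p * J)"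
      using that J(2) by (intro sum_ennreal) auto
    finally show ?thesis by (simp add: sum_distrib_right)
  qed
  have pt: "(\<Sum>i\<in>G. ennreal (g i) * f i t) = ennreal (t powr (- p - 1) * (\<Sum>i\<in>G. g i * (t * \<mu> i / (1 + t * \<mu> i))))"
    if "0 < t" "G \<subseteq> F \<union> F'" "\<And>i. i \<in> G \<Longrightarrow> 0 \<le> g i" for g G t
  proof -
    have "(\<Sum>i\<in>G. ennreal (g i) * f i t) = (\<Sum>i\<in>G. ennreal (t powr (- p - 1) * (g i * (t * \<mu> i / (1 + t * \<mu> i)))))"
    proof (rule sum.cong[OF refl])
      fix i assume i: "i \<in> G"
      then have "0 \<le> g i" "0 < \<mu> i" using that \<mu> by auto
      then show "ennreal (g i) * f i t = ennreal (t powr (- p - 1) * (g i * (t * \<mu> i / (1 + t * \<mu> i))))"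
        using that(1) by (simp add: f_def mult_ac flip: ennreal_mult')
    qed
    also have "\<dots> = ennreal (\<Sum>i\<in>G. t powr (- p - 1) * (g i * (t * \<mu> i / (1 + t * \<mu> i))))"
      using that \<mu> by (intro sum_ennreal mult_nonneg_nonneg) (auto intro!: divide_nonneg_nonneg simp: subset_iff less_imp_le add_nonneg_nonneg)
    finally show ?thesis by (simp add: sum_distrib_left)
  qed
  have "ennreal ((\<Sum>i\<in>F'. b i * \<mu> i powr p) * J) = (\<integral>\<^sup>+t. (\<Sum>i\<in>F'. ennreal (b i) * f i t) \<partial>lborel)"
    by (rule int[symmetric]) (auto simp: b)
  also have "\<dots> \<le> (\<integral>\<^sup>+t. (\<Sum>i\<in>F. ennreal (C * d i) * f i t) \<partial>lborel)"
  proof (intro nn_integral_mono)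
    fix t :: real
    show "(\<Sum>i\<in>F'. ennreal (b i) * f i t) \<le> (\<Sum>i\<in>F. ennreal (C * d i) * f i t)"
    proof (cases "0 < t")
      case True
      have "(\<Sum>i\<in>F'. b i * (t * \<mu> i / (1 + t * \<mu> i))) \<le> (\<Sum>i\<in>F. C * d i * (t * \<mu> i / (1 + t * \<mu> i)))"
        using le[OF True] by (simp add: sum_distrib_left mult.assoc)
      then have "t powr (- p - 1) * (\<Sum>i\<in>F'. b i * (t * \<mu> i / (1 + t * \<mu> i)))
          \<le> t powr (- p - 1) * (\<Sum>i\<in>F. C * d i * (t * \<mu> i / (1 + t * \<mu> i)))"
        by (intro mult_left_mono) auto
      then show ?thesis
        using True b d C by (subst (1 2) pt) (auto intro: ennreal_leI)
    qed (simp add: f_def)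
  qed
  also have "\<dots> = ennreal ((\<Sum>i\<in>F. C * d i * \<mu> i powr p) * J)"
    by (rule int) (auto simp: C d)
  finally have "(\<Sum>i\<in>F'. b i * \<mu> i powr p) * J \<le> (\<Sum>i\<in>F. C * d i * \<mu> i powr p) * J"
    using J(2) C d by (subst (asm) ennreal_le_iff) (auto intro!: mult_nonneg_nonneg sum_nonneg)
  then show ?thesis using J(2) by (simp add: sum_distrib_left mult.assoc)
qed

text \<open>A sharp bound, with equality at \<open>u = \<mu> *\<^sub>R v\<close>: the left side is
  the least value of the right side over all splittings of the given sum.\<close>

lemma norm_add_weighted:
  fixes u v :: "'a::real_inner"
  assumes "0 < \<mu>"
  shows "(norm (u + v))\<^sup>2 * (\<mu> / (1 + \<mu>)) \<le> (norm u)\<^sup>2 + \<mu> * (norm v)\<^sup>2"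
proof -
  have "(1 + \<mu>) * ((norm u)\<^sup>2 + \<mu> * (norm v)\<^sup>2) - \<mu> * (norm (u + v))\<^sup>2 = (norm (u - \<mu> *\<^sub>R v))\<^sup>2"
    unfolding power2_norm_eq_inner by (simp add: algebra_simps inner_commute)
  then have "\<mu> * (norm (u + v))\<^sup>2 \<le> (1 + \<mu>) * ((norm u)\<^sup>2 + \<mu> * (norm v)\<^sup>2)"
    using zero_le_power2[of "norm (u - \<mu> *\<^sub>R v)"] by linarith
  then show ?thesis using assms by (simp add: field_simps)
qed

lemma has_sum_norm_le:
  fixes f :: "'i \<Rightarrow> 'a::real_normed_vector"
  assumes "(f has_sum s) I" "\<And>F. finite F \<Longrightarrow> F \<subseteq> I \<Longrightarrow> norm (sum f F) \<le> B"
  shows "norm s \<le> B"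
proof (rule tendsto_upperbound)
  show "((\<lambda>F. norm (sum f F)) \<longlongrightarrow> norm s) (finite_subsets_at_top I)"
    using assms(1) unfolding has_sum_def by (rule tendsto_norm)
  show "\<forall>\<^sub>F F in finite_subsets_at_top I. norm (sum f F) \<le> B"
    using assms(2) by (auto intro!: eventually_finite_subsets_at_top_weakI)
qed simp


text \<open>Assumption A recast in finite sums over eigenvalues, so that the estimates avoid
  summability questions. The upper link is stated for finite spectral combinations, the only vectors
  produced by splitting a truncated one.\<close>

locale linked = regularized A S \<alpha> + P: orth_resolution I P
  for A :: "'x::{real_inner,banach} \<Rightarrow> 'y::{real_inner,banach}" and S \<alpha>
    and I :: "real set" and P :: "real \<Rightarrow> 'x \<Rightarrow> 'x" +
  fixes a c :: real
  assumes I_pos: "l \<in> I \<Longrightarrow> 0 < l"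
    and S_P: "l \<in> I \<Longrightarrow> S (P l x) = l *\<^sub>R P l x"
    and form_ge: "finite F \<Longrightarrow> F \<subseteq> I \<Longrightarrow> (\<Sum>l\<in>F. l * (norm (P l x))\<^sup>2) \<le> S x \<bullet> x"
    and a_pos: "0 < a" and c_ge: "1 \<le> c"
    and link_ge: "finite F \<Longrightarrow> F \<subseteq> I \<Longrightarrow>
      (\<Sum>l\<in>F. l powr a * (norm (P l x))\<^sup>2) \<le> c\<^sup>2 * (norm (A x))\<^sup>2"
    and link_le: "finite F \<Longrightarrow> F \<subseteq> I \<Longrightarrow>
      (norm (A (\<Sum>l\<in>F. r l *\<^sub>R P l x)))\<^sup>2 \<le> c\<^sup>2 * (\<Sum>l\<in>F. l powr a * ((r l)\<^sup>2 * (norm (P l x))\<^sup>2))"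
begin

lemma P_S: "l \<in> I \<Longrightarrow> P l (S x) = l *\<^sub>R P l x"
  by (rule eq_if_inner_eq) (metis P.sym S_P symS inner_scaleR_left inner_scaleR_right inner_commute)

lemma c_pow: "c\<^sup>2 \<le> c ^ 4"
  using c_ge by (intro power_increasing) auto

interpretation S: bounded_linear S using S by (simp add: positive_selfadjoint_def)
interpretation Tn: bounded_linear "T ^^ n" for n by (rule bounded_linear_T_pow)

lemma S_sum: "(\<And>l. l \<in> F \<Longrightarrow> l \<in> I) \<Longrightarrow> S (\<Sum>l\<in>F. (r l / l) *\<^sub>R P l x) = (\<Sum>l\<in>F. r l *\<^sub>R P l x)"
  using I_pos by (auto simp: S.sum S.scaleR S_P intro!: sum.cong) (metis less_irrefl)

text \<open>For each parameter \<open>t\<close> the truncated vector is split into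
  \<open>y + w\<close>. The part \<open>y = S z\<close> is controlled in order -1 by
  \<open>form_contraction\<close>, the part \<open>w\<close> in order a by
  \<open>norm_AT_pow\<close> and the link in both directions. Integration over \<open>t\<close> then
  gives order 0.\<close>

lemma T_pow_finite_bounded:
  assumes F: "finite F" "F \<subseteq> I" and F': "finite F'" "F' \<subseteq> I"
  shows "(\<Sum>l\<in>F'. (norm (P l ((T ^^ n) (\<Sum>l\<in>F. P l x))))\<^sup>2) \<le> c ^ 4 * (\<Sum>l\<in>F. (norm (P l x))\<^sup>2)"
proof -
  define xF where "xF = (\<Sum>l\<in>F. P l x)"
  \<comment> \<open>Squared components weighted to order -1. The ratio of the weights of orders a
    and -1 is \<open>l powr (a + 1)\<close>, and its power \<open>p = 1 / (a + 1)\<close> brings the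
    weight back to order 0.\<close>
  define b where "b l = (norm (P l ((T ^^ n) xF)))\<^sup>2 / l" for l
  define d where "d l = (norm (P l x))\<^sup>2 / l" for l
  define p where "p = 1 / (a + 1)"
  have p: "0 < p" "p < 1" using a_pos by (auto simp: p_def)
  have \<mu>p: "(l powr (a + 1)) powr p = l" if "l \<in> I" for l
    using I_pos[OF that] a_pos by (simp add: powr_powr p_def)
  have K: "(\<Sum>l\<in>F'. b l * (t * l powr (a + 1) / (1 + t * l powr (a + 1))))
      \<le> c ^ 4 * (\<Sum>l\<in>F. d l * (t * l powr (a + 1) / (1 + t * l powr (a + 1))))" if t: "0 < t" for t
  proof -
    \<comment> \<open>The minimizer of
      \<open>\<theta>\<^sup>2 / l + t * l powr a * (1 - \<theta>)\<^sup>2\<close>, hence the optimal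
      splitting at each eigenvalue; its minimum is \<open>\<theta> / l\<close>.\<close>
    define \<theta> where "\<theta> l = t * l powr (a + 1) / (1 + t * l powr (a + 1))" for l
    define y where "y = (\<Sum>l\<in>F. \<theta> l *\<^sub>R P l x)"
    define z where "z = (\<Sum>l\<in>F. (\<theta> l / l) *\<^sub>R P l x)"
    define w where "w = (\<Sum>l\<in>F. (1 - \<theta> l) *\<^sub>R P l x)"
    have xF: "xF = y + w" by (simp add: xF_def y_def w_def scaleR_diff_left flip: sum.distrib)
    have Sz: "S z = y" unfolding z_def y_def using F(2) by (intro S_sum) auto
    have "(\<Sum>l\<in>F'. b l * \<theta> l) \<le>
      (\<Sum>l\<in>F'. l * (norm (P l ((R ^^ n) z)))\<^sup>2 + t * (l powr a * (norm (P l ((T ^^ n) w)))\<^sup>2))"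
    proof (rule sum_mono)
      fix l assume "l \<in> F'"
      then have l: "l \<in> I" "0 < l" using F'(2) I_pos by auto
      interpret Pl: linear "P l" using P.lin l(1) .
      have "(norm (P l ((T ^^ n) xF)))\<^sup>2 * \<theta> l
        \<le> (norm (P l ((T ^^ n) y)))\<^sup>2 + (t * l powr (a + 1)) * (norm (P l ((T ^^ n) w)))\<^sup>2"
        unfolding xF \<theta>_def Tn.add Pl.add using t l by (intro norm_add_weighted) auto
      also have "P l ((T ^^ n) y) = l *\<^sub>R P l ((R ^^ n) z)"
        unfolding Sz[symmetric] T_pow_S by (rule P_S[OF l(1)])
      also have "l powr (a + 1) = l * l powr a" using l(2) by (simp add: powr_add)
      finally have "(norm (P l ((T ^^ n) xF)))\<^sup>2 * \<theta> l \<le>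
        l * (l * (norm (P l ((R ^^ n) z)))\<^sup>2 + t * (l powr a * (norm (P l ((T ^^ n) w)))\<^sup>2))"
        by (simp add: power_mult_distrib power2_eq_square algebra_simps)
      then show "b l * \<theta> l \<le> l * (norm (P l ((R ^^ n) z)))\<^sup>2 + t * (l powr a * (norm (P l ((T ^^ n) w)))\<^sup>2)"
        using l(2) by (simp add: b_def pos_divide_le_eq mult.commute)
    qed
    also have "\<dots> = (\<Sum>l\<in>F'. l * (norm (P l ((R ^^ n) z)))\<^sup>2)
        + t * (\<Sum>l\<in>F'. l powr a * (norm (P l ((T ^^ n) w)))\<^sup>2)"
      by (simp add: sum.distrib sum_distrib_left)
    also have "\<dots> \<le> (\<Sum>l\<in>F. d l * (\<theta> l)\<^sup>2)
        + t * (c\<^sup>2 * (c\<^sup>2 * (\<Sum>l\<in>F. l powr a * ((1 - \<theta> l)\<^sup>2 * (norm (P l x))\<^sup>2))))"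
    proof (intro add_mono mult_left_mono)
      have "(\<Sum>l\<in>F'. l * (norm (P l ((R ^^ n) z)))\<^sup>2) \<le> S ((R ^^ n) z) \<bullet> (R ^^ n) z"
        by (rule form_ge[OF F'])
      also have "\<dots> \<le> S z \<bullet> z" by (rule form_contraction)
      also have "\<dots> = (\<Sum>l\<in>F. (\<theta> l / l) * (P l x \<bullet> y))" 
        unfolding Sz unfolding z_def inner_sum_right by (simp add: inner_commute)
      also have "\<dots> = (\<Sum>l\<in>F. d l * (\<theta> l)\<^sup>2)"
      proof (rule sum.cong[OF refl])
        fix l assume l: "l \<in> F"
        then have lI: "l \<in> I" using F(2) by blast
        have "P l x \<bullet> y = P l x \<bullet> P l y" by (metis P.idem P.sym lI)
        also have "P l y = \<theta> l *\<^sub>R P l x" unfolding y_def using P.proj_sum[OF F lI] l by simp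
        finally show "(\<theta> l / l) * (P l x \<bullet> y) = d l * (\<theta> l)\<^sup>2"
          by (simp add: d_def power2_norm_eq_inner) (simp add: power2_eq_square)
      qed
      finally show "(\<Sum>l\<in>F'. l * (norm (P l ((R ^^ n) z)))\<^sup>2) \<le> (\<Sum>l\<in>F. d l * (\<theta> l)\<^sup>2)" .
      have "(\<Sum>l\<in>F'. l powr a * (norm (P l ((T ^^ n) w)))\<^sup>2) \<le> c\<^sup>2 * (norm (A ((T ^^ n) w)))\<^sup>2"
        by (rule link_ge[OF F'])
      also have "\<dots> \<le> c\<^sup>2 * (norm (A w))\<^sup>2" by (intro mult_left_mono power_mono norm_AT_pow) auto
      also have "\<dots> \<le> c\<^sup>2 * (c\<^sup>2 * (\<Sum>l\<in>F. l powr a * ((1 - \<theta> l)\<^sup>2 * (norm (P l x))\<^sup>2)))"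
        unfolding w_def by (intro mult_left_mono link_le F) auto
      finally show "(\<Sum>l\<in>F'. l powr a * (norm (P l ((T ^^ n) w)))\<^sup>2)
        \<le> c\<^sup>2 * (c\<^sup>2 * (\<Sum>l\<in>F. l powr a * ((1 - \<theta> l)\<^sup>2 * (norm (P l x))\<^sup>2)))" .
    qed (use t in auto)
    also have "\<dots> \<le> c ^ 4 * (\<Sum>l\<in>F. d l * (\<theta> l)\<^sup>2)
        + c ^ 4 * (\<Sum>l\<in>F. t * (l powr a * ((1 - \<theta> l)\<^sup>2 * (norm (P l x))\<^sup>2)))"
    proof (intro add_mono)
      have "0 \<le> (\<Sum>l\<in>F. d l * (\<theta> l)\<^sup>2)"
        using F(2) I_pos by (intro sum_nonneg mult_nonneg_nonneg) (auto simp: d_def subset_iff less_imp_le)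
      moreover have "1 \<le> c ^ 4" using c_ge by (simp add: one_le_power)
      ultimately show "(\<Sum>l\<in>F. d l * (\<theta> l)\<^sup>2) \<le> c ^ 4 * (\<Sum>l\<in>F. d l * (\<theta> l)\<^sup>2)"
        using mult_right_mono[of 1 "c ^ 4"] by fastforce
      have c4: "c\<^sup>2 * c\<^sup>2 = c ^ 4" by (simp flip: power_add)
      show "t * (c\<^sup>2 * (c\<^sup>2 * (\<Sum>l\<in>F. l powr a * ((1 - \<theta> l)\<^sup>2 * (norm (P l x))\<^sup>2))))
        \<le> c ^ 4 * (\<Sum>l\<in>F. t * (l powr a * ((1 - \<theta> l)\<^sup>2 * (norm (P l x))\<^sup>2)))"
        unfolding sum_distrib_left[symmetric] c4[symmetric] by (simp add: mult_ac)
    qed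
    also have "\<dots> = c ^ 4 * (\<Sum>l\<in>F. d l * \<theta> l)"
      unfolding distrib_left[symmetric] sum.distrib[symmetric]
    proof (intro arg_cong[where f = "(*) (c ^ 4)"] sum.cong refl)
      fix l assume "l \<in> F"
      then have l: "0 < l" using F(2) I_pos by auto
      define m where "m = t * l powr (a + 1)"
      have m: "0 < m" "\<theta> l = m / (1 + m)" "t * l powr a = m / l"
        using t l by (auto simp: m_def \<theta>_def powr_add)
      have "\<theta> l * \<theta> l + m * ((1 - \<theta> l) * (1 - \<theta> l)) = \<theta> l"
      proof -
        have e: "1 - \<theta> l = 1 / (1 + m)" using m(1) by (simp add: m(2) field_simps)
        have "(1 + m) * (\<theta> l * \<theta> l + m * ((1 - \<theta> l) * (1 - \<theta> l))) = (1 + m) * \<theta> l"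
          unfolding e unfolding m(2) using m(1) by (simp add: divide_simps) (simp add: algebra_simps)
        then show ?thesis using m(1) by simp
      qed
      then have "d l * \<theta> l = (norm (P l x))\<^sup>2 / l * (\<theta> l * \<theta> l + m * ((1 - \<theta> l) * (1 - \<theta> l)))"
        by (simp add: d_def)
      also have "\<dots> = d l * (\<theta> l)\<^sup>2 + m / l * ((1 - \<theta> l)\<^sup>2 * (norm (P l x))\<^sup>2)"
        by (simp add: d_def power2_eq_square distrib_left)
      finally show "d l * (\<theta> l)\<^sup>2 + t * (l powr a * ((1 - \<theta> l)\<^sup>2 * (norm (P l x))\<^sup>2)) = d l * \<theta> l"
        using m(3) by (simp add: mult.assoc[symmetric])
    qed
    finally show ?thesis unfolding \<theta>_def .
  qed
  have "(\<Sum>l\<in>F'. b l * (l powr (a + 1)) powr p) \<le> c ^ 4 * (\<Sum>l\<in>F. d l * (l powr (a + 1)) powr p)"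
  proof (rule interpolation_sum_le[OF p _ _ _ _ K])
    show "0 \<le> c ^ 4" by simp
    show "0 < l powr (a + 1)" if "l \<in> F \<union> F'" for l using that F(2) F'(2) I_pos by force
    show "0 \<le> b l" if "l \<in> F'" for l using that F'(2) I_pos[of l] by (auto simp: b_def)
    show "0 \<le> d l" if "l \<in> F" for l using that F(2) I_pos[of l] by (auto simp: d_def)
  qed
  moreover have "(\<Sum>l\<in>F'. b l * (l powr (a + 1)) powr p) = (\<Sum>l\<in>F'. (norm (P l ((T ^^ n) xF)))\<^sup>2)"
    using F'(2) I_pos by (intro sum.cong) (force simp: \<mu>p b_def)+
  moreover have "(\<Sum>l\<in>F. d l * (l powr (a + 1)) powr p) = (\<Sum>l\<in>F. (norm (P l x))\<^sup>2)"
    using F(2) I_pos by (intro sum.cong) (force simp: \<mu>p d_def)+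
  ultimately show ?thesis by (simp only: xF_def)
qed

lemma T_pow_sum_bounded:
  assumes F: "finite F" "F \<subseteq> I"
  shows "(norm ((T ^^ n) (\<Sum>l\<in>F. P l x)))\<^sup>2 \<le> c ^ 4 * (\<Sum>l\<in>F. (norm (P l x))\<^sup>2)"
  by (rule P.norm_le_if_finite_sums_le) (rule T_pow_finite_bounded[OF F])

text \<open>The case \<open>s = a + 2\<close>: with \<open>x = S z\<close>, bound the energies of \<open>T\<^sup>n x\<close> of orders \<open>-1\<close> and
  \<open>a\<close>, and interpolate with \<open>1 \<le> \<tau> / l + (l / \<tau>)\<^sup>a\<close>.\<close>

lemma T_pow_smooth:
  assumes F: "finite F" "F \<subseteq> I" and n: "2 \<le> n"
  shows "(norm ((T ^^ n) (\<Sum>l\<in>F. P l x)))\<^sup>2 \<le> 3 * c ^ 4 * (\<alpha> / real n) powr ((a + 2) / (a + 1)) *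
    (\<Sum>l\<in>F. l powr (- (a + 2)) * (norm (P l x))\<^sup>2)"
proof -
  \<comment> \<open>\<open>z\<close> is the preimage under \<open>S\<close> of the truncated vector.
    \<open>X m\<close> and \<open>Y m\<close> stand for the energies of orders -1 and a after
    \<open>m\<close> steps, the latter measured by \<open>A\<close>.\<close>
  define B where "B = (\<Sum>l\<in>F. l powr (- (a + 2)) * (norm (P l x))\<^sup>2)"
  define z where "z = (\<Sum>l\<in>F. (1 / l) *\<^sub>R P l x)"
  define X where "X m = S ((R ^^ m) z) \<bullet> (R ^^ m) z" for m
  define Y where "Y m = (norm (A (S ((R ^^ m) z))))\<^sup>2" for m
  have Sz: "S z = (\<Sum>l\<in>F. P l x)" unfolding z_def using F(2) S_sum[of F "\<lambda>_. 1" x] by auto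
  have B0: "0 \<le> B" unfolding B_def by (intro sum_nonneg) auto
  have e0: "2 * (- (a + 2) / 2) = - (a + 2)" by (simp add: field_simps)
  have sq: "(l powr q)\<^sup>2 = l powr (2 * q)" for l q :: real by (simp add: power2_eq_square flip: powr_add)
  have X0: "0 \<le> X m" for m by (simp add: X_def posS)
  have YX: "2 * real k * Y (k + m) \<le> \<alpha> * X m" if "1 \<le> k" for k m
    using norm_ASR_pow[OF that, of "(R ^^ m) z"] by (simp add: Y_def X_def funpow_add)
  \<comment> \<open>Duality: \<open>X m\<close> pairs \<open>S (R\<^sup>2\<^sup>m z)\<close> in
    order a with the source in order -(a + 2). The first factor is bounded by \<open>X m\<close>
    again through \<open>YX\<close>, and one \<open>X m\<close> cancels.\<close>
  have Xm: "2 * real m * X m \<le> \<alpha> * (c\<^sup>2 * B)" if m: "1 \<le> m" for m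
  proof (cases "X m = 0")
    case False
    define v where "v = S ((R ^^ (m + m)) z)"
    have "X m = v \<bullet> z" by (simp add: X_def v_def form_pow_add)
    also have "\<dots> = (\<Sum>l\<in>F. (l powr (a / 2) *\<^sub>R P l v) \<bullet> (l powr (- (a + 2) / 2) *\<^sub>R P l x))"
      unfolding z_def inner_sum_right
    proof (rule sum.cong[OF refl])
      fix l assume "l \<in> F"
      then have l: "l \<in> I" "0 < l" using F(2) I_pos by auto
      have "l powr (a / 2) * l powr (- (a + 2) / 2) = l powr (- 1)"
        by (simp add: powr_add[symmetric] field_simps)
      also have "\<dots> = 1 / l" using l(2) by (simp add: powr_minus_divide)
      finally have "l powr (- (a + 2) / 2) * l powr (a / 2) = 1 / l" by (simp add: mult.commute)
      moreover have "v \<bullet> P l x = P l v \<bullet> P l x" by (metis P.idem P.sym l(1))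
      ultimately show "v \<bullet> (1 / l) *\<^sub>R P l x = (l powr (a / 2) *\<^sub>R P l v) \<bullet> (l powr (- (a + 2) / 2) *\<^sub>R P l x)"
        by (simp add: mult.assoc[symmetric])
    qed
    also have "\<dots> \<le> (\<Sum>l\<in>F. norm (l powr (a / 2) *\<^sub>R P l v) * norm (l powr (- (a + 2) / 2) *\<^sub>R P l x))"
      by (intro sum_mono norm_cauchy_schwarz)
    finally have "(X m)\<^sup>2 \<le> (\<Sum>l\<in>F. norm (l powr (a / 2) *\<^sub>R P l v) * norm (l powr (- (a + 2) / 2) *\<^sub>R P l x))\<^sup>2"
      using X0 by (intro power_mono) auto
    also have "\<dots> \<le> (\<Sum>l\<in>F. (norm (l powr (a / 2) *\<^sub>R P l v))\<^sup>2) * (\<Sum>l\<in>F. (norm (l powr (- (a + 2) / 2) *\<^sub>R P l x))\<^sup>2)"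
      by (rule Cauchy_Schwarz_ineq_sum)
    also have "(\<Sum>l\<in>F. (norm (l powr (a / 2) *\<^sub>R P l v))\<^sup>2) = (\<Sum>l\<in>F. l powr a * (norm (P l v))\<^sup>2)"
      by (intro sum.cong) (auto simp: power_mult_distrib sq)
    also have "(\<Sum>l\<in>F. (norm (l powr (- (a + 2) / 2) *\<^sub>R P l x))\<^sup>2) = B"
      unfolding B_def by (intro sum.cong) (simp_all only: norm_scaleR power_mult_distrib sq power2_abs e0)
    also have "(\<Sum>l\<in>F. l powr a * (norm (P l v))\<^sup>2) * B \<le> c\<^sup>2 * Y (m + m) * B"
      unfolding Y_def v_def[symmetric] by (intro mult_right_mono link_ge F B0)
    finally have "2 * real m * (X m)\<^sup>2 \<le> 2 * real m * (c\<^sup>2 * Y (m + m) * B)" by (intro mult_left_mono) auto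
    also have "\<dots> = (c\<^sup>2 * B) * (2 * real m * Y (m + m))" by simp
    also have "\<dots> \<le> (c\<^sup>2 * B) * (\<alpha> * X m)" using B0 by (intro mult_left_mono YX m) auto
    finally have "X m * (2 * real m * X m) \<le> X m * (\<alpha> * (c\<^sup>2 * B))" by (simp add: power2_eq_square mult_ac)
    moreover have "0 < X m" using X0[of m] False by linarith
    ultimately show ?thesis by (simp only: mult_le_cancel_left_pos)
  qed (use \<alpha> B0 in simp)
  define h where "h = \<alpha> / real n"
  have h: "0 < h" using \<alpha> n by (simp add: h_def)
  have Xn: "X n \<le> h * (c\<^sup>2 * B)"
  proof -
    have "real n * X n \<le> 2 * real n * X n" using X0[of n] by simp
    also have "\<dots> \<le> \<alpha> * (c\<^sup>2 * B)" using n by (intro Xm) simp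
    finally show ?thesis using n by (simp add: h_def field_simps)
  qed
  \<comment> \<open>Smoothing twice: \<open>k\<close> steps pass from \<open>Y n\<close> to
    \<open>X m\<close>, and the other \<open>m\<close> steps bound \<open>X m\<close>. Rounding down
    makes \<open>n \<le> 3 * m\<close> sharp at \<open>n = 3\<close>, whence 3/2;
    \<open>2 \<le> n\<close> ensures that \<open>m\<close> is not 0.\<close>
  have Yn: "Y n \<le> 3 / 2 * (h\<^sup>2 * (c\<^sup>2 * B))"
  proof -
    define m where "m = n div 2"
    define k where "k = n - m"
    have mk: "1 \<le> m" "1 \<le> k" "n = k + m" using n by (auto simp: m_def k_def)
    have "n \<le> 2 * k" "n \<le> 3 * m" using n unfolding m_def k_def by presburger+
    then have "real n \<le> real (2 * k)" "real n \<le> real (3 * m)" by (simp_all only: of_nat_le_iff)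
    then have nmk: "real n \<le> 2 * real k" "real n \<le> 3 * real m" by simp_all
    have Y0: "0 \<le> Y n" by (simp add: Y_def)
    have "(real n * real n) * Y n \<le> ((2 * real k) * (3 * real m)) * Y n"
      using nmk Y0 by (intro mult_right_mono mult_mono) auto
    also have "\<dots> = 3 * real m * (2 * real k * Y (k + m))" using mk(3) by simp
    also have "\<dots> \<le> 3 * real m * (\<alpha> * X m)" by (intro mult_left_mono YX mk) auto
    also have "\<dots> = 3 / 2 * \<alpha> * (2 * real m * X m)" by simp
    also have "\<dots> \<le> 3 / 2 * \<alpha> * (\<alpha> * (c\<^sup>2 * B))" using \<alpha> by (intro mult_left_mono Xm mk) auto
    finally have "Y n \<le> 3 / 2 * \<alpha> * (\<alpha> * (c\<^sup>2 * B)) / (real n * real n)"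
      using n by (simp add: pos_le_divide_eq mult.commute)
    also have "\<dots> = 3 / 2 * (h\<^sup>2 * (c\<^sup>2 * B))" by (simp add: h_def power2_eq_square)
    finally show ?thesis .
  qed
  define p where "p = 1 / (a + 1)"
  \<comment> \<open>Balances \<open>\<tau> * h\<close> against
    \<open>\<tau> powr (- a) * h\<^sup>2\<close>: they agree when
    \<open>\<tau> powr (a + 1) = h\<close>.\<close>
  define \<tau> where "\<tau> = h powr p"
  have \<tau>: "0 < \<tau>" using h by (simp add: \<tau>_def)
  have e: "(a + 2) / (a + 1) = p + 1" using a_pos by (simp add: p_def field_simps)
  have e1: "\<tau> * h = h powr ((a + 2) / (a + 1))" using h by (simp add: \<tau>_def e powr_add)
  have "p * - a + 2 = p + 1" using a_pos by (simp add: p_def field_simps)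
  then have "h powr (p * - a) * h powr 2 = h powr (p + 1)" by (simp only: powr_add[symmetric])
  then have e2: "\<tau> powr (- a) * h\<^sup>2 = h powr ((a + 2) / (a + 1))"
    using h by (simp add: \<tau>_def e powr_powr powr_numeral)
  define v where "v = (T ^^ n) (\<Sum>l\<in>F. P l x)"
  have v: "v = S ((R ^^ n) z)" by (simp add: v_def T_pow_S flip: Sz)
  have "(norm v)\<^sup>2 \<le> \<tau> * X n + \<tau> powr (- a) * (c\<^sup>2 * Y n)"
  proof (rule P.norm_le_if_finite_sums_le)
    fix G assume G: "finite G" "G \<subseteq> I"
    have "(\<Sum>l\<in>G. (norm (P l v))\<^sup>2) \<le>
      (\<Sum>l\<in>G. \<tau> * (l * (norm (P l ((R ^^ n) z)))\<^sup>2) + \<tau> powr (- a) * (l powr a * (norm (P l v))\<^sup>2))"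
    proof (rule sum_mono)
      fix l assume "l \<in> G"
      then have l: "l \<in> I" "0 < l" using G(2) I_pos by auto
      have "P l v = l *\<^sub>R P l ((R ^^ n) z)" unfolding v by (rule P_S[OF l(1)])
      then have q: "l * (norm (P l ((R ^^ n) z)))\<^sup>2 = (norm (P l v))\<^sup>2 / l"
        using l(2) by (simp add: power_mult_distrib power2_eq_square)
      have "1 \<le> \<tau> / l + \<tau> powr (- a) * l powr a"
      proof (cases "l \<le> \<tau>")
        case True
        then have "1 \<le> \<tau> / l" using l(2) by simp
        then show ?thesis by (simp add: add_increasing2)
      next
        case False
        then have "\<tau> powr a \<le> l powr a" using \<tau> a_pos by (intro powr_mono2) auto
        then have "1 \<le> \<tau> powr (- a) * l powr a" using \<tau> by (simp add: powr_minus field_simps)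
        then show ?thesis using \<tau> l(2) by (simp add: add_increasing)
      qed
      then have "1 * (norm (P l v))\<^sup>2 \<le> (\<tau> / l + \<tau> powr (- a) * l powr a) * (norm (P l v))\<^sup>2"
        by (intro mult_right_mono) auto
      then show "(norm (P l v))\<^sup>2 \<le> \<tau> * (l * (norm (P l ((R ^^ n) z)))\<^sup>2) + \<tau> powr (- a) * (l powr a * (norm (P l v))\<^sup>2)"
        unfolding q by (simp add: distrib_right mult.assoc)
    qed
    also have "\<dots> = \<tau> * (\<Sum>l\<in>G. l * (norm (P l ((R ^^ n) z)))\<^sup>2) + \<tau> powr (- a) * (\<Sum>l\<in>G. l powr a * (norm (P l v))\<^sup>2)"
      by (simp add: sum.distrib sum_distrib_left)
    also have "\<dots> \<le> \<tau> * X n + \<tau> powr (- a) * (c\<^sup>2 * Y n)"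
    proof (intro add_mono mult_left_mono)
      show "(\<Sum>l\<in>G. l * (norm (P l ((R ^^ n) z)))\<^sup>2) \<le> X n"
        unfolding X_def by (rule form_ge[OF G])
      show "(\<Sum>l\<in>G. l powr a * (norm (P l v))\<^sup>2) \<le> c\<^sup>2 * Y n"
        unfolding Y_def v[symmetric] by (rule link_ge[OF G])
    qed (use \<tau> in auto)
    finally show "(\<Sum>l\<in>G. (norm (P l v))\<^sup>2) \<le> \<tau> * X n + \<tau> powr (- a) * (c\<^sup>2 * Y n)" .
  qed
  also have "\<dots> \<le> \<tau> * (h * (c\<^sup>2 * B)) + \<tau> powr (- a) * (c\<^sup>2 * (3 / 2 * (h\<^sup>2 * (c\<^sup>2 * B))))"
    using \<tau> by (intro add_mono mult_left_mono Xn Yn) auto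
  also have "\<dots> = (\<tau> * h) * c\<^sup>2 * B + (\<tau> powr (- a) * h\<^sup>2) * (3 / 2 * (c\<^sup>2 * c\<^sup>2)) * B"
    by (simp only: mult_ac)
  also have "\<dots> = (c\<^sup>2 + 3 / 2 * c ^ 4) * (h powr ((a + 2) / (a + 1)) * B)"
    unfolding e1 e2 by (simp add: algebra_simps flip: power_add)
  also have "\<dots> \<le> (3 * c ^ 4) * (h powr ((a + 2) / (a + 1)) * B)"
    using c_pow zero_le_power2[of c] B0 by (intro mult_right_mono) (linarith, simp)
  finally show ?thesis unfolding v_def B_def h_def by (simp only: mult.assoc)
qed

text \<open>Below the cutoff boundedness suffices, since
  \<open>l powr s \<le> \<tau> powr s\<close>; above it, trading order a + 2 for order s costs
  \<open>\<tau> powr (s - (a + 2))\<close>. Both parts are of size \<open>\<tau> powr s\<close>. The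
  constant 8 is 2 * (1 + 3).\<close>

lemma T_pow_source:
  assumes s: "0 \<le> s" "s \<le> a + 2" and n: "2 \<le> n"
    and B: "\<And>F. finite F \<Longrightarrow> F \<subseteq> I \<Longrightarrow> (\<Sum>l\<in>F. l powr (- s) * (norm (P l x))\<^sup>2) \<le> B"
  shows "(norm ((T ^^ n) x))\<^sup>2 \<le> 8 * c ^ 4 * B * (\<alpha> / real n) powr (s / (a + 1))"
proof -
  define h where "h = \<alpha> / real n"
  have h: "0 < h" using \<alpha> n by (simp add: h_def)
  define p where "p = 1 / (a + 1)"
  define \<tau> where "\<tau> = h powr p"
  have \<tau>: "0 < \<tau>" using h by (simp add: \<tau>_def)
  have \<tau>s: "\<tau> powr s = h powr (s / (a + 1))" by (simp add: \<tau>_def p_def powr_powr)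
  have "(a + 2) / (a + 1) + p * (s - (a + 2)) = s / (a + 1)"
    using a_pos by (simp add: p_def diff_divide_distrib)
  then have \<tau>2: "h powr ((a + 2) / (a + 1)) * \<tau> powr (s - (a + 2)) = h powr (s / (a + 1))"
    by (simp add: \<tau>_def powr_powr flip: powr_add)
  have fin: "(norm ((T ^^ n) (\<Sum>l\<in>F. P l x)))\<^sup>2 \<le> 8 * c ^ 4 * B * h powr (s / (a + 1))"
    if F: "finite F" "F \<subseteq> I" for F
  proof -
    define F1 where "F1 = {l \<in> F. l < \<tau>}"
    define F2 where "F2 = {l \<in> F. \<not> l < \<tau>}"
    have F12: "finite F1" "F1 \<subseteq> I" "finite F2" "F2 \<subseteq> I" using F by (auto simp: F1_def F2_def)
    let ?x1 = "\<Sum>l\<in>F1. P l x" and ?x2 = "\<Sum>l\<in>F2. P l x"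
    have "(\<Sum>l\<in>F. P l x) = (\<Sum>l\<in>F1 \<union> F2. P l x)" by (intro sum.cong) (auto simp: F1_def F2_def)
    also have "\<dots> = ?x1 + ?x2" using F12 by (intro sum.union_disjoint) (auto simp: F1_def F2_def)
    finally have split: "(\<Sum>l\<in>F. P l x) = ?x1 + ?x2" .
    have "(norm ((T ^^ n) ?x1))\<^sup>2 \<le> c ^ 4 * (\<Sum>l\<in>F1. (norm (P l x))\<^sup>2)"
      by (rule T_pow_sum_bounded[OF F12(1,2)])
    also have "\<dots> \<le> c ^ 4 * (\<Sum>l\<in>F1. \<tau> powr s * (l powr (- s) * (norm (P l x))\<^sup>2))"
    proof (intro mult_left_mono sum_mono)
      fix l assume "l \<in> F1"
      then have l: "0 < l" "l < \<tau>" using F12(2) I_pos by (auto simp: F1_def)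
      then have "l powr s \<le> \<tau> powr s" using s(1) by (intro powr_mono2) auto
      then have "1 \<le> \<tau> powr s * l powr (- s)" using l(1) by (simp add: powr_minus field_simps)
      then have "1 * (norm (P l x))\<^sup>2 \<le> (\<tau> powr s * l powr (- s)) * (norm (P l x))\<^sup>2"
        by (intro mult_right_mono) auto
      then show "(norm (P l x))\<^sup>2 \<le> \<tau> powr s * (l powr (- s) * (norm (P l x))\<^sup>2)" by (simp add: mult.assoc)
    qed simp
    also have "\<dots> \<le> c ^ 4 * (\<tau> powr s * B)"
      unfolding sum_distrib_left[symmetric] by (intro mult_left_mono B F12) auto
    finally have 1: "(norm ((T ^^ n) ?x1))\<^sup>2 \<le> c ^ 4 * (h powr (s / (a + 1)) * B)" unfolding \<tau>s .
    have "(norm ((T ^^ n) ?x2))\<^sup>2 \<le> 3 * c ^ 4 * h powr ((a + 2) / (a + 1)) *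
        (\<Sum>l\<in>F2. l powr (- (a + 2)) * (norm (P l x))\<^sup>2)"
      unfolding h_def by (rule T_pow_smooth[OF F12(3,4) n])
    also have "\<dots> \<le> 3 * c ^ 4 * h powr ((a + 2) / (a + 1)) *
        (\<Sum>l\<in>F2. \<tau> powr (s - (a + 2)) * (l powr (- s) * (norm (P l x))\<^sup>2))"
    proof (intro mult_left_mono sum_mono)
      fix l assume "l \<in> F2"
      then have l: "\<tau> \<le> l" by (auto simp: F2_def)
      have "l powr (- (a + 2)) = l powr (s - (a + 2)) * l powr (- s)" by (simp flip: powr_add)
      also have "\<dots> \<le> \<tau> powr (s - (a + 2)) * l powr (- s)"
        using l \<tau> s(2) by (intro mult_right_mono powr_mono2') auto
      finally have "l powr (- (a + 2)) * (norm (P l x))\<^sup>2 \<le> (\<tau> powr (s - (a + 2)) * l powr (- s)) * (norm (P l x))\<^sup>2"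
        by (intro mult_right_mono) auto
      then show "l powr (- (a + 2)) * (norm (P l x))\<^sup>2 \<le> \<tau> powr (s - (a + 2)) * (l powr (- s) * (norm (P l x))\<^sup>2)"
        by (simp add: mult.assoc)
    qed simp
    also have "\<dots> \<le> 3 * c ^ 4 * h powr ((a + 2) / (a + 1)) * (\<tau> powr (s - (a + 2)) * B)"
      unfolding sum_distrib_left[symmetric] by (intro mult_left_mono B F12) auto
    also have "\<dots> = 3 * c ^ 4 * ((h powr ((a + 2) / (a + 1)) * \<tau> powr (s - (a + 2))) * B)"
      by (simp only: mult_ac)
    finally have 2: "(norm ((T ^^ n) ?x2))\<^sup>2 \<le> 3 * c ^ 4 * (h powr (s / (a + 1)) * B)" unfolding \<tau>2 .
    have "(norm ((T ^^ n) (\<Sum>l\<in>F. P l x)))\<^sup>2 \<le> 2 * (norm ((T ^^ n) ?x1))\<^sup>2 + 2 * (norm ((T ^^ n) ?x2))\<^sup>2"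
    proof -
      have "(norm (u + v))\<^sup>2 \<le> 2 * (norm u)\<^sup>2 + 2 * (norm v)\<^sup>2" for u v :: 'x
        using norm_add_weighted[of 1 u v] by simp
      then show ?thesis unfolding split Tn.add .
    qed
    also have "\<dots> \<le> 8 * c ^ 4 * B * h powr (s / (a + 1))" using 1 2 by (simp add: mult_ac)
    finally show ?thesis .
  qed
  \<comment> \<open>The bound for truncations is uniform, and each power of \<open>T\<close> is
    continuous, so it passes to the limit.\<close>
  have "norm ((T ^^ n) x) \<le> sqrt (8 * c ^ 4 * B * h powr (s / (a + 1)))"
  proof (rule has_sum_norm_le[OF has_sum_bounded_linear[OF bounded_linear_T_pow P.has_sum]])
    fix F assume F: "finite F" "F \<subseteq> I"
    show "norm (\<Sum>l\<in>F. (T ^^ n) (P l x)) \<le> sqrt (8 * c ^ 4 * B * h powr (s / (a + 1)))"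
      using fin[OF F] by (intro real_le_rsqrt) (simp add: Tn.sum)
  qed
  moreover have "0 \<le> 8 * c ^ 4 * B * h powr (s / (a + 1))"
    using fin[of "{}"] by (simp add: Tn.zero)
  ultimately show ?thesis unfolding h_def by (metis norm_ge_zero power_mono real_sqrt_pow2)
qed

end

text \<open>The norm of \<open>op_power\<close> is computed on finite spectral combinations, where
  the series has finitely many nonzero terms. The lower link for general \<open>x\<close> then
  follows by approximation and continuity of \<open>A\<close>.\<close>

lemma assumption_A_linked:
  assumes A: "compact_operator A" and AA: "assumption_A A S u z0 a c s" and \<alpha>: "0 < \<alpha>"
  shows "linked A S \<alpha> (pos_eigenvalues S) (\<lambda>l. orth_proj (eigenspace S l)) a c"
proof -
  have S: "positive_selfadjoint S" and inj: "inj S" and tr: "trace_class_pos S"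
    and a: "0 < a" and c: "1 \<le> c"
    and lower: "\<And>x. inverse c * norm (op_power S (a / 2) x) \<le> norm (A x)"
    and upper: "\<And>x. norm (A x) \<le> c * norm (op_power S (a / 2) x)"
    using AA by (auto simp: assumption_A_def)
  have blA: "bounded_linear A" using A by (simp add: compact_operator_def)
  have comp: "compact_operator S" by (rule compact_operator_trace_class[OF S tr])
  let ?I = "pos_eigenvalues S" and ?P = "\<lambda>l. orth_proj (eigenspace S l)"
  interpret P: orth_resolution ?I ?P by (rule eigenspaces_resolution[OF S comp inj])
  have sq: "(l powr (a / 2))\<^sup>2 = l powr a" for l :: real by (simp add: power2_eq_square flip: powr_add)
  have norm_power: "(norm (op_power S (a / 2) (\<Sum>l\<in>F. r l *\<^sub>R ?P l x)))\<^sup>2 =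
      (\<Sum>l\<in>F. l powr a * ((r l)\<^sup>2 * (norm (?P l x))\<^sup>2))" if F: "finite F" "F \<subseteq> ?I" for F r x
  proof -
    let ?y = "\<Sum>l\<in>F. r l *\<^sub>R ?P l x"
    have "op_power S (a / 2) ?y = (\<Sum>\<^sub>\<infinity>l\<in>F. (l powr (a / 2) * r l) *\<^sub>R ?P l x)"
      unfolding op_power_def
    proof (rule infsum_cong_neutral)
      show "l powr (a / 2) *\<^sub>R ?P l ?y = 0" if "l \<in> ?I - F" for l using P.proj_sum[OF F, of l r x] that by simp
      show "l powr (a / 2) *\<^sub>R ?P l ?y = (l powr (a / 2) * r l) *\<^sub>R ?P l x" if "l \<in> ?I \<inter> F" for l
        using P.proj_sum[OF F, of l r x] that by simp
    qed (use F in auto)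
    also have "\<dots> = (\<Sum>l\<in>F. (l powr (a / 2) * r l) *\<^sub>R ?P l x)" using F(1) by simp
    finally show ?thesis using P.norm_sum[OF F] by (simp add: power_mult_distrib sq mult.assoc)
  qed
  show ?thesis
  proof (rule linked.intro)
    show "regularized A S \<alpha>" by (rule regularized.intro[OF blA S \<alpha>])
    show "orth_resolution ?I ?P" by (rule P.orth_resolution_axioms)
    show "linked_axioms A S ?I ?P a c"
    proof (rule linked_axioms.intro)
      show "0 < l" if "l \<in> ?I" for l using that by (simp add: pos_eigenvalues_def)
      show "S (?P l x) = l *\<^sub>R ?P l x" for l x by (rule eigen_orth_proj[OF S])
      show "0 < a" "1 \<le> c" by (rule a, rule c)
      show "(\<Sum>l\<in>F. l * (norm (?P l x))\<^sup>2) \<le> S x \<bullet> x" if "finite F" "F \<subseteq> ?I" for F x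
        by (rule finite_sum_le_has_sum[OF quadratic_form_has_sum[OF S comp inj] that])
          (auto simp: pos_eigenvalues_def)
      show "(norm (A (\<Sum>l\<in>F. r l *\<^sub>R ?P l x)))\<^sup>2 \<le> c\<^sup>2 * (\<Sum>l\<in>F. l powr a * ((r l)\<^sup>2 * (norm (?P l x))\<^sup>2))"
        if F: "finite F" "F \<subseteq> ?I" for F r x
        using power_mono[OF upper norm_ge_zero, of "\<Sum>l\<in>F. r l *\<^sub>R ?P l x" 2]
        by (simp add: power_mult_distrib norm_power[OF F])
      show "(\<Sum>l\<in>F. l powr a * (norm (?P l x))\<^sup>2) \<le> c\<^sup>2 * (norm (A x))\<^sup>2"
        if F: "finite F" "F \<subseteq> ?I" for F x
      proof -
        have "((\<lambda>l. A (?P l x)) has_sum A x) ?I" by (rule has_sum_bounded_linear[OF blA P.has_sum])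
        then have "((\<lambda>G. c\<^sup>2 * (norm (\<Sum>l\<in>G. A (?P l x)))\<^sup>2) \<longlongrightarrow> c\<^sup>2 * (norm (A x))\<^sup>2) (finite_subsets_at_top ?I)"
          unfolding has_sum_def by (intro tendsto_intros)
        then show ?thesis
        proof (rule tendsto_lowerbound)
          show "\<forall>\<^sub>F G in finite_subsets_at_top ?I.
            (\<Sum>l\<in>F. l powr a * (norm (?P l x))\<^sup>2) \<le> c\<^sup>2 * (norm (\<Sum>l\<in>G. A (?P l x)))\<^sup>2"
            unfolding eventually_finite_subsets_at_top
          proof (intro exI[of _ F] conjI allI impI F)
            fix G assume G: "finite G \<and> F \<subseteq> G \<and> G \<subseteq> ?I"
            let ?y = "\<Sum>l\<in>G. 1 *\<^sub>R ?P l x"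
            have "norm (op_power S (a / 2) ?y) \<le> c * norm (A ?y)"
              using lower[of ?y] c by (simp add: field_simps)
            then have "(norm (op_power S (a / 2) ?y))\<^sup>2 \<le> (c * norm (A ?y))\<^sup>2" by (intro power_mono) auto
            also have "A ?y = (\<Sum>l\<in>G. A (?P l x))" using linear_sum[OF bounded_linear.linear[OF blA]] by simp
            finally have "(\<Sum>l\<in>G. l powr a * (norm (?P l x))\<^sup>2) \<le> c\<^sup>2 * (norm (\<Sum>l\<in>G. A (?P l x)))\<^sup>2"
              using norm_power[of G "\<lambda>_. 1" x] G by (simp add: power_mult_distrib)
            moreover have "(\<Sum>l\<in>F. l powr a * (norm (?P l x))\<^sup>2) \<le> (\<Sum>l\<in>G. l powr a * (norm (?P l x))\<^sup>2)"
              using G by (intro sum_mono2) auto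
            ultimately show "(\<Sum>l\<in>F. l powr a * (norm (?P l x))\<^sup>2) \<le> c\<^sup>2 * (norm (\<Sum>l\<in>G. A (?P l x)))\<^sup>2"
              by linarith
          qed
        qed simp
      qed
    qed
  qed
qed

text \<open>Beyond some finite \<open>X\<close> all partial sums are within 1 of the limit, and
  enlarging \<open>F\<close> by \<open>X\<close> only increases the sum of squares.\<close>

lemma op_power_dom_bound:
  fixes S :: "'x::{real_inner,banach} \<Rightarrow> 'x"
  assumes S: "positive_selfadjoint S" "inj S" "trace_class_pos S"
    and x: "x \<in> op_power_dom S q"
  shows "\<exists>B. \<forall>F. finite F \<and> F \<subseteq> pos_eigenvalues S \<longrightarrow>
    (\<Sum>l\<in>F. l powr (2 * q) * (norm (orth_proj (eigenspace S l) x))\<^sup>2) \<le> B"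
proof -
  let ?I = "pos_eigenvalues S" and ?P = "\<lambda>l. orth_proj (eigenspace S l)"
  interpret P: orth_resolution ?I ?P
    by (rule eigenspaces_resolution[OF S(1) compact_operator_trace_class[OF S(1,3)] S(2)])
  let ?f = "\<lambda>l. l powr q *\<^sub>R ?P l x"
  obtain v where "(?f has_sum v) ?I" using x by (auto simp: op_power_dom_def summable_on_def)
  then have "\<forall>\<^sub>F G in finite_subsets_at_top ?I. dist (sum ?f G) v < 1"
    unfolding has_sum_def by (rule tendstoD) simp
  then obtain X where X: "finite X" "X \<subseteq> ?I"
    "\<And>Y. finite Y \<Longrightarrow> X \<subseteq> Y \<Longrightarrow> Y \<subseteq> ?I \<Longrightarrow> dist (sum ?f Y) v < 1"
    unfolding eventually_finite_subsets_at_top by metis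
  have sq: "(l powr q)\<^sup>2 = l powr (2 * q)" for l :: real by (simp add: power2_eq_square flip: powr_add)
  have "(\<Sum>l\<in>F. l powr (2 * q) * (norm (?P l x))\<^sup>2) \<le> (norm v + 1)\<^sup>2" if F: "finite F" "F \<subseteq> ?I" for F
  proof -
    have "norm (sum ?f (F \<union> X)) \<le> norm v + 1"
      using X(3)[of "F \<union> X"] X(1,2) F norm_triangle_ineq2[of "sum ?f (F \<union> X)" v] by (simp add: dist_norm)
    then have "(norm (sum ?f (F \<union> X)))\<^sup>2 \<le> (norm v + 1)\<^sup>2" by (intro power_mono) auto
    moreover have "(norm (sum ?f (F \<union> X)))\<^sup>2 = (\<Sum>l\<in>F \<union> X. l powr (2 * q) * (norm (?P l x))\<^sup>2)"
      using P.norm_sum[of "F \<union> X" "\<lambda>l. l powr q" x] F X by (simp add: sq)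
    moreover have "(\<Sum>l\<in>F. l powr (2 * q) * (norm (?P l x))\<^sup>2) \<le> (\<Sum>l\<in>F \<union> X. l powr (2 * q) * (norm (?P l x))\<^sup>2)"
      using F X by (intro sum_mono2) auto
    ultimately show ?thesis by linarith
  qed
  then show ?thesis by blast
qed

section \<open>The mean square error\<close>

lemma nn_integral_count_space_has_sum:
  fixes f :: "'i \<Rightarrow> real"
  assumes "(f has_sum s) A" "\<And>i. i \<in> A \<Longrightarrow> 0 \<le> f i"
  shows "(\<integral>\<^sup>+i. ennreal (f i) \<partial>count_space A) = ennreal s"
proof -
  have "(\<lambda>i. norm (f i)) summable_on A \<longleftrightarrow> f summable_on A"
    by (rule summable_on_cong) (simp add: assms(2))
  moreover have "f summable_on A" using assms(1) by (rule has_sum_imp_summable)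
  ultimately have *: "Infinite_Set_Sum.abs_summable_on f A"
    by (intro abs_summable_equivalent[THEN iffD1]) blast
  have "(\<integral>\<^sup>+i. ennreal (f i) \<partial>count_space A) = ennreal (infsetsum f A)"
    by (rule nn_integral_conv_infsetsum[OF * assms(2)])
  also have "infsetsum f A = s" using infsetsum_infsum[OF *] infsumI[OF assms(1)] by (rule trans)
  finally show ?thesis .
qed

section \<open>Second moments of white noise\<close>

context prob_space
begin

lemma white_noise_moments:
  assumes wn: "white_noise M \<gamma> \<eta>" and \<gamma>: "0 < \<gamma>"
  shows "integrable M (\<eta> v)" "integrable M (\<lambda>\<omega>. (\<eta> v \<omega>)\<^sup>2)" "expectation (\<eta> v) = 0"
    "expectation (\<lambda>\<omega>. (\<eta> v \<omega>)\<^sup>2) = \<gamma>\<^sup>2 * (norm v)\<^sup>2"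
proof -
  have [measurable]: "\<eta> v \<in> borel_measurable M" using wn by (simp add: white_noise_def)
  have "integrable M (\<eta> v) \<and> integrable M (\<lambda>\<omega>. (\<eta> v \<omega>)\<^sup>2) \<and> expectation (\<eta> v) = 0 \<and>
    expectation (\<lambda>\<omega>. (\<eta> v \<omega>)\<^sup>2) = \<gamma>\<^sup>2 * (norm v)\<^sup>2"
  proof (cases "v = 0")
    case True
    \<comment> \<open>Linearity with zero coefficients forces \<open>\<eta> 0\<close> to vanish
      almost surely, which replaces the density for \<open>v = 0\<close>.\<close>
    have "AE \<omega> in M. \<eta> (0 *\<^sub>R v + 0 *\<^sub>R v) \<omega> = 0 * \<eta> v \<omega> + 0 * \<eta> v \<omega>"
      using wn unfolding white_noise_def by blast
    then have z: "AE \<omega> in M. \<eta> v \<omega> = 0" using True by simp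
    then have z2: "AE \<omega> in M. (\<eta> v \<omega>)\<^sup>2 = 0" by eventually_elim simp
    have i: "integrable M (\<eta> v) \<longleftrightarrow> integrable M (\<lambda>_. 0 :: real)"
      "integrable M (\<lambda>\<omega>. (\<eta> v \<omega>)\<^sup>2) \<longleftrightarrow> integrable M (\<lambda>_. 0 :: real)"
      by (rule integrable_cong_AE[OF _ _ z], simp, simp) (rule integrable_cong_AE[OF _ _ z2], simp, simp)
    have e: "expectation (\<eta> v) = expectation (\<lambda>_. 0 :: real)"
      "expectation (\<lambda>\<omega>. (\<eta> v \<omega>)\<^sup>2) = expectation (\<lambda>_. 0 :: real)"
      by (rule integral_cong_AE[OF _ _ z], simp, simp) (rule integral_cong_AE[OF _ _ z2], simp, simp)
    show ?thesis unfolding i e using True by simp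
  next
    case False
    then have \<sigma>: "0 < \<gamma> * norm v" using \<gamma> by simp
    have D: "distributed M lborel (\<eta> v) (normal_density 0 (\<gamma> * norm v))"
      using wn False unfolding white_noise_def by blast
    have 1: "integrable M (\<eta> v)"
      by (rule distributed_integrable_var[OF D normal_density_nonneg integrable_normal_moment_nz_1[OF \<sigma>]])
    have "integrable lborel (\<lambda>x. normal_density 0 (\<gamma> * norm v) x * x\<^sup>2)"
      using integrable_normal_moment[OF \<sigma>, of 0 2] by simp
    then have 2: "integrable M (\<lambda>\<omega>. (\<eta> v \<omega>)\<^sup>2)"
      by (rule distributed_integrable[OF D _ normal_density_nonneg, THEN iffD1, rotated]) simp
    have 3: "expectation (\<eta> v) = 0" by (rule normal_distributed_expectation[OF \<sigma> D])
    have "expectation (\<lambda>\<omega>. (\<eta> v \<omega>)\<^sup>2) = (\<gamma> * norm v)\<^sup>2"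
      using normal_distributed_variance[OF \<sigma> D] unfolding 3 by simp
    with 1 2 3 show ?thesis by (simp only: power_mult_distrib)
  qed
  then show "integrable M (\<eta> v)" "integrable M (\<lambda>\<omega>. (\<eta> v \<omega>)\<^sup>2)" "expectation (\<eta> v) = 0"
    "expectation (\<lambda>\<omega>. (\<eta> v \<omega>)\<^sup>2) = \<gamma>\<^sup>2 * (norm v)\<^sup>2" by auto
qed

text \<open>Each time contributes one scalar, a coordinate of the whole noise process at that time.
  Independence and zero mean then kill the cross terms.\<close>

lemma iid_white_noise_second_moment:
  fixes \<eta> :: "nat \<Rightarrow> 'y::real_inner \<Rightarrow> 'a \<Rightarrow> real"
  assumes iid: "iid_white_noise M \<gamma> \<eta>" and \<gamma>: "0 < \<gamma>" and J: "finite J" "J \<subseteq> {1..}"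
  shows "integrable M (\<lambda>\<omega>. (b + (\<Sum>j\<in>J. \<eta> j (v j) \<omega>))\<^sup>2)"
    "expectation (\<lambda>\<omega>. (b + (\<Sum>j\<in>J. \<eta> j (v j) \<omega>))\<^sup>2) = b\<^sup>2 + \<gamma>\<^sup>2 * (\<Sum>j\<in>J. (norm (v j))\<^sup>2)"
proof -
  define X where "X j = \<eta> j (v j)" for j
  have wn: "white_noise M \<gamma> (\<eta> j)" if "j \<in> J" for j using iid J(2) that by (auto simp: iid_white_noise_def)
  note mom = white_noise_moments[OF wn \<gamma>]
  have "indep_vars (\<lambda>_. \<Pi>\<^sub>M v\<in>UNIV. borel) (\<lambda>n \<omega> v. \<eta> n v \<omega>) {1..}"
    using iid by (simp add: iid_white_noise_def)
  then have "indep_vars (\<lambda>_. borel) (\<lambda>n \<omega>. (\<lambda>f. f (v n)) (\<lambda>v. \<eta> n v \<omega>)) {1..}"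
    by (rule indep_vars_compose2) (rule measurable_component_singleton, simp)
  then have ind: "indep_vars (\<lambda>_. borel) X {1..}" by (simp add: X_def[abs_def])
  have XX: "integrable M (\<lambda>\<omega>. X i \<omega> * X j \<omega>) \<and>
      expectation (\<lambda>\<omega>. X i \<omega> * X j \<omega>) = (if i = j then \<gamma>\<^sup>2 * (norm (v i))\<^sup>2 else 0)"
    if ij: "i \<in> J" "j \<in> J" for i j
  proof (cases "i = j")
    case True
    then show ?thesis using mom[OF ij(1), of "v i"] by (simp add: X_def power2_eq_square)
  next
    case False
    have "indep_vars (\<lambda>_. borel) X {i, j}" using ij J(2) by (intro indep_vars_subset[OF ind]) auto
    moreover have "integrable M (X k)" if "k \<in> {i, j}" for k using mom(1) ij that by (auto simp: X_def)
    ultimately have "integrable M (\<lambda>\<omega>. \<Prod>k\<in>{i, j}. X k \<omega>)"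
      "expectation (\<lambda>\<omega>. \<Prod>k\<in>{i, j}. X k \<omega>) = (\<Prod>k\<in>{i, j}. expectation (X k))"
      by (auto intro!: indep_vars_integrable indep_vars_lebesgue_integral)
    then show ?thesis using False mom(3)[OF ij(1), of "v i"] by (simp add: X_def)
  qed
  have expand: "(b + (\<Sum>j\<in>J. X j \<omega>))\<^sup>2 = b\<^sup>2 + 2 * b * (\<Sum>j\<in>J. X j \<omega>) + (\<Sum>i\<in>J. \<Sum>j\<in>J. X i \<omega> * X j \<omega>)" for \<omega>
    unfolding sum_product[symmetric] by (simp add: power2_eq_square algebra_simps)
  have i1: "integrable M (X j)" "expectation (X j) = 0" if "j \<in> J" for j using mom(1,3)[OF that] by (auto simp: X_def)
  have int: "integrable M (\<lambda>\<omega>. \<Sum>j\<in>J. X j \<omega>)" "integrable M (\<lambda>\<omega>. \<Sum>i\<in>J. \<Sum>j\<in>J. X i \<omega> * X j \<omega>)"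
    subgoal by (rule Bochner_Integration.integrable_sum) (rule i1)
    subgoal by (intro Bochner_Integration.integrable_sum) (simp add: XX)
    done
  show "integrable M (\<lambda>\<omega>. (b + (\<Sum>j\<in>J. \<eta> j (v j) \<omega>))\<^sup>2)"
    unfolding X_def[symmetric] expand using int by simp
  have "expectation (\<lambda>\<omega>. (b + (\<Sum>j\<in>J. X j \<omega>))\<^sup>2) = b\<^sup>2 + 2 * b * expectation (\<lambda>\<omega>. \<Sum>j\<in>J. X j \<omega>)
      + expectation (\<lambda>\<omega>. \<Sum>i\<in>J. \<Sum>j\<in>J. X i \<omega> * X j \<omega>)"
    unfolding expand using int by (simp add: prob_space)
  also have "expectation (\<lambda>\<omega>. \<Sum>j\<in>J. X j \<omega>) = 0"
    by (subst Bochner_Integration.integral_sum) (simp_all add: i1)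
  also have "expectation (\<lambda>\<omega>. \<Sum>i\<in>J. \<Sum>j\<in>J. X i \<omega> * X j \<omega>) = (\<Sum>i\<in>J. \<Sum>j\<in>J. expectation (\<lambda>\<omega>. X i \<omega> * X j \<omega>))"
    by (subst Bochner_Integration.integral_sum, intro Bochner_Integration.integrable_sum XX[THEN conjunct1])
      (auto intro!: sum.cong Bochner_Integration.integral_sum XX[THEN conjunct1])
  also have "\<dots> = (\<Sum>i\<in>J. \<Sum>j\<in>J. if i = j then \<gamma>\<^sup>2 * (norm (v i))\<^sup>2 else 0)"
    by (intro sum.cong refl XX[THEN conjunct2])
  also have "\<dots> = (\<Sum>i\<in>J. \<gamma>\<^sup>2 * (norm (v i))\<^sup>2)" using J(1) by (intro sum.cong) (auto simp: sum.delta)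
  finally show "expectation (\<lambda>\<omega>. (b + (\<Sum>j\<in>J. \<eta> j (v j) \<omega>))\<^sup>2) = b\<^sup>2 + \<gamma>\<^sup>2 * (\<Sum>j\<in>J. (norm (v j))\<^sup>2)"
    by (simp add: X_def sum_distrib_left)
qed

end

section \<open>Error components and the mean square error\<close>

context regularized
begin

text \<open>Stated for one \<open>x\<close> at a time because the null set may depend on
  \<open>x\<close>. The induction varies \<open>x\<close>, since unrolling one step replaces it by
  \<open>R x\<close>; \<open>j\<close> counts backwards, with \<open>j = 0\<close> the newest
  noise.\<close>

lemma threedvar_error_component:
  assumes tv: "threedvar M A S \<alpha> z0 y \<zeta>"
    and y: "\<And>n v \<omega>. 1 \<le> n \<Longrightarrow> y n v \<omega> = A u \<bullet> v + \<eta> n v \<omega>"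
  shows "AE \<omega> in M. (\<zeta> n \<omega> - u) \<bullet> x = (z0 - u) \<bullet> (R ^^ n) x
    + (\<Sum>j<n. \<eta> (n - j) (adjoint (gain A S \<alpha>) ((R ^^ j) x)) \<omega>)"
proof (induction n arbitrary: x)
  case 0
  have "AE \<omega> in M. \<zeta> 0 \<omega> = z0" using tv by (simp add: threedvar_def)
  then show ?case by eventually_elim simp
next
  case (Suc n)
  let ?g = "adjoint (gain A S \<alpha>)"
  have "\<forall>n\<ge>1. \<exists>Z. op_image M (gain A S \<alpha>) (\<lambda>v \<omega>. y n v \<omega> - A (\<zeta> (n - 1) \<omega>) \<bullet> v) Z \<and>
      (AE \<omega> in M. \<zeta> n \<omega> = \<zeta> (n - 1) \<omega> + Z \<omega>)"
    using tv by (simp add: threedvar_def)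
  from spec[OF this, of "Suc n"]
  obtain Z where Z: "op_image M (gain A S \<alpha>) (\<lambda>v \<omega>. y (Suc n) v \<omega> - A (\<zeta> n \<omega>) \<bullet> v) Z"
    "AE \<omega> in M. \<zeta> (Suc n) \<omega> = \<zeta> n \<omega> + Z \<omega>"
    by auto
  have "AE \<omega> in M. Z \<omega> \<bullet> x = y (Suc n) (?g x) \<omega> - A (\<zeta> n \<omega>) \<bullet> ?g x"
    using Z(1) by (simp add: op_image_def)
  with Z(2) Suc[of "R x"] show ?case
  proof eventually_elim
    case (elim \<omega>)
    interpret A: bounded_linear A by (rule A)
    have "(\<zeta> (Suc n) \<omega> - u) \<bullet> x = (\<zeta> n \<omega> - u) \<bullet> x - A (\<zeta> n \<omega> - u) \<bullet> ?g x + \<eta> (Suc n) (?g x) \<omega>"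
      using elim y[of "Suc n"] by (simp add: A.diff inner_diff_left inner_add_left)
    also have "A (\<zeta> n \<omega> - u) \<bullet> ?g x = (\<zeta> n \<omega> - u) \<bullet> adjoint A (?g x)" by (rule adjA)
    also have "(\<zeta> n \<omega> - u) \<bullet> x - (\<zeta> n \<omega> - u) \<bullet> adjoint A (?g x) = (\<zeta> n \<omega> - u) \<bullet> R x"
      by (simp add: R_def adjoint_gain inner_diff_right)
    also have "\<dots> = (z0 - u) \<bullet> (R ^^ n) (R x) + (\<Sum>j<n. \<eta> (n - j) (?g ((R ^^ j) (R x))) \<omega>)" by (rule elim)
    finally have "(\<zeta> (Suc n) \<omega> - u) \<bullet> x = (z0 - u) \<bullet> (R ^^ n) (R x)
        + (\<eta> (Suc n) (?g x) \<omega> + (\<Sum>j<n. \<eta> (n - j) (?g ((R ^^ j) (R x))) \<omega>))" by simp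
    then show ?case
      unfolding sum.lessThan_Suc_shift funpow_Suc_right o_def by simp
  qed
qed

lemma threedvar_component_second_moment:
  assumes "prob_space M" "0 < \<gamma>" "data_model M A u \<gamma> y" "threedvar M A S \<alpha> z0 y \<zeta>"
  shows "(\<integral>\<^sup>+\<omega>. ennreal (((\<zeta> n \<omega> - u) \<bullet> x)\<^sup>2) \<partial>M) =
    ennreal (((T ^^ n) (z0 - u) \<bullet> x)\<^sup>2 + \<gamma>\<^sup>2 * (\<Sum>j<n. (norm (adjoint (gain A S \<alpha>) ((R ^^ j) x)))\<^sup>2))"
proof -
  interpret prob_space M by fact
  obtain \<eta> where \<eta>: "iid_white_noise M \<gamma> \<eta>" "\<And>n v \<omega>. 1 \<le> n \<Longrightarrow> y n v \<omega> = A u \<bullet> v + \<eta> n v \<omega>"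
    using assms(3) unfolding data_model_def by blast
  let ?g = "adjoint (gain A S \<alpha>)"
  define v where "v i = ?g ((R ^^ (n - i)) x)" for i
  have bij: "bij_betw (\<lambda>j. n - j) {..<n} {1..n}"
    by (rule bij_betw_byWitness[where f' = "\<lambda>i. n - i"]) auto
  have "(\<Sum>j<n. \<eta> (n - j) (?g ((R ^^ j) x)) \<omega>) = (\<Sum>i\<in>{1..n}. \<eta> i (v i) \<omega>)" for \<omega>
    by (subst sum.reindex_bij_betw[OF bij, symmetric]) (simp add: v_def)
  then have "AE \<omega> in M. (\<zeta> n \<omega> - u) \<bullet> x = (z0 - u) \<bullet> (R ^^ n) x + (\<Sum>i\<in>{1..n}. \<eta> i (v i) \<omega>)"
    using threedvar_error_component[OF assms(4) \<eta>(2), of n x] by simp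
  then have "(\<integral>\<^sup>+\<omega>. ennreal (((\<zeta> n \<omega> - u) \<bullet> x)\<^sup>2) \<partial>M) =
      (\<integral>\<^sup>+\<omega>. ennreal (((z0 - u) \<bullet> (R ^^ n) x + (\<Sum>i\<in>{1..n}. \<eta> i (v i) \<omega>))\<^sup>2) \<partial>M)"
    by (rule nn_integral_cong_AE[OF eventually_mono]) simp
  also have "\<dots> = ennreal (expectation (\<lambda>\<omega>. ((z0 - u) \<bullet> (R ^^ n) x + (\<Sum>i\<in>{1..n}. \<eta> i (v i) \<omega>))\<^sup>2))"
    by (intro nn_integral_eq_integral iid_white_noise_second_moment(1)[OF \<eta>(1) assms(2)]) auto
  also have "expectation (\<lambda>\<omega>. ((z0 - u) \<bullet> (R ^^ n) x + (\<Sum>i\<in>{1..n}. \<eta> i (v i) \<omega>))\<^sup>2)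
      = ((z0 - u) \<bullet> (R ^^ n) x)\<^sup>2 + \<gamma>\<^sup>2 * (\<Sum>i\<in>{1..n}. (norm (v i))\<^sup>2)"
    by (intro iid_white_noise_second_moment(2)[OF \<eta>(1) assms(2)]) auto
  also have "(\<Sum>i\<in>{1..n}. (norm (v i))\<^sup>2) = (\<Sum>j<n. (norm (?g ((R ^^ j) x)))\<^sup>2)"
    by (subst sum.reindex_bij_betw[OF bij, symmetric]) (simp add: v_def)
  finally show ?thesis by (simp only: T_pow_adj)
qed

text \<open>Parseval and Tonelli over a countable basis reduce the error to its components. Working
  with nonnegative integrals gives integrability and the bound at once.\<close>

lemma threedvar_mean_square_error:
  assumes M: "prob_space M" "0 < \<gamma>" "data_model M A u \<gamma> y" "threedvar M A S \<alpha> z0 y \<zeta>"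
    and E: "orthonormal_basis E" "countable E" "(\<lambda>e. S e \<bullet> e) summable_on E"
  shows "integrable M (\<lambda>\<omega>. (norm (\<zeta> n \<omega> - u))\<^sup>2)"
    and "(\<integral>\<omega>. (norm (\<zeta> n \<omega> - u))\<^sup>2 \<partial>M) \<le> (norm ((T ^^ n) (z0 - u)))\<^sup>2
      + \<gamma>\<^sup>2 / (2 * \<alpha>) * (\<Sum>j<n. 1 / real (Suc j)) * (\<Sum>\<^sub>\<infinity>e\<in>E. S e \<bullet> e)"
proof -
  define \<kappa> where "\<kappa> = \<gamma>\<^sup>2 / (2 * \<alpha>) * (\<Sum>j<n. 1 / real (Suc j))"
  define B where "B = (norm ((T ^^ n) (z0 - u)))\<^sup>2 + \<kappa> * (\<Sum>\<^sub>\<infinity>e\<in>E. S e \<bullet> e)"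
  have \<kappa>0: "0 \<le> \<kappa>" 
    unfolding \<kappa>_def using \<alpha> by (intro mult_nonneg_nonneg sum_nonneg divide_nonneg_nonneg) auto
  have B0: "0 \<le> B" using \<kappa>0 posS by (auto simp: B_def intro!: add_nonneg_nonneg mult_nonneg_nonneg infsum_nonneg)
  have \<zeta>[measurable]: "\<zeta> n \<in> borel_measurable M" using M(4) by (simp add: threedvar_def)
  have m1: "(\<lambda>\<omega>. ennreal (((\<zeta> n \<omega> - u) \<bullet> e)\<^sup>2)) \<in> borel_measurable M" for e
  proof -
    have "(\<lambda>z. ((z - u) \<bullet> e)\<^sup>2) \<in> borel_measurable borel"
      by (intro borel_measurable_continuous_onI continuous_intros)
    from measurable_compose[OF \<zeta> this] show ?thesis by measurable
  qed
  have m2: "(\<lambda>\<omega>. (norm (\<zeta> n \<omega> - u))\<^sup>2) \<in> borel_measurable M"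
  proof -
    have "(\<lambda>z. (norm (z - u))\<^sup>2) \<in> borel_measurable borel"
      by (intro borel_measurable_continuous_onI continuous_intros)
    from measurable_compose[OF \<zeta> this] show ?thesis .
  qed
  have "(\<integral>\<^sup>+\<omega>. ennreal ((norm (\<zeta> n \<omega> - u))\<^sup>2) \<partial>M)
      = (\<integral>\<^sup>+\<omega>. \<integral>\<^sup>+e. ennreal (((\<zeta> n \<omega> - u) \<bullet> e)\<^sup>2) \<partial>count_space E \<partial>M)"
    by (intro nn_integral_cong nn_integral_count_space_has_sum[symmetric] parseval E) auto
  also have "\<dots> = (\<integral>\<^sup>+e. \<integral>\<^sup>+\<omega>. ennreal (((\<zeta> n \<omega> - u) \<bullet> e)\<^sup>2) \<partial>M \<partial>count_space E)"
    by (intro nn_integral_count_space_nn_integral E m1)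
  also have "\<dots> \<le> (\<integral>\<^sup>+e. ennreal (((T ^^ n) (z0 - u) \<bullet> e)\<^sup>2 + \<kappa> * (S e \<bullet> e)) \<partial>count_space E)"
    unfolding threedvar_component_second_moment[OF M]
  proof (intro nn_integral_mono ennreal_leI add_left_mono)
    fix e
    have "(\<Sum>j<n. (norm (adjoint (gain A S \<alpha>) ((R ^^ j) e)))\<^sup>2) \<le> (\<Sum>j<n. 1 / real (Suc j) * ((S e \<bullet> e) / (2 * \<alpha>)))"
    proof (rule sum_mono)
      fix j
      have "(norm (adjoint (gain A S \<alpha>) ((R ^^ j) e)))\<^sup>2 * (2 * real (Suc j) * \<alpha>) \<le> S e \<bullet> e"
        using norm_adjoint_gain_pow[of j e] by (simp only: mult.commute)
      then have "(norm (adjoint (gain A S \<alpha>) ((R ^^ j) e)))\<^sup>2 \<le> (S e \<bullet> e) / (2 * real (Suc j) * \<alpha>)"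
        using \<alpha> by (subst pos_le_divide_eq) auto
      then show "(norm (adjoint (gain A S \<alpha>) ((R ^^ j) e)))\<^sup>2 \<le> 1 / real (Suc j) * ((S e \<bullet> e) / (2 * \<alpha>))"
        by (simp add: mult_ac)
    qed
    then have "\<gamma>\<^sup>2 * (\<Sum>j<n. (norm (adjoint (gain A S \<alpha>) ((R ^^ j) e)))\<^sup>2)
        \<le> \<gamma>\<^sup>2 * ((\<Sum>j<n. 1 / real (Suc j)) * ((S e \<bullet> e) / (2 * \<alpha>)))"
      unfolding sum_distrib_right by (intro mult_left_mono) auto
    then show "\<gamma>\<^sup>2 * (\<Sum>j<n. (norm (adjoint (gain A S \<alpha>) ((R ^^ j) e)))\<^sup>2) \<le> \<kappa> * (S e \<bullet> e)"
      by (simp add: \<kappa>_def mult_ac)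
  qed
  also have "\<dots> = ennreal B"
    unfolding B_def
  proof (rule nn_integral_count_space_has_sum)
    show "((\<lambda>e. ((T ^^ n) (z0 - u) \<bullet> e)\<^sup>2 + \<kappa> * (S e \<bullet> e)) has_sum
        (norm ((T ^^ n) (z0 - u)))\<^sup>2 + \<kappa> * (\<Sum>\<^sub>\<infinity>e\<in>E. S e \<bullet> e)) E"
      by (intro has_sum_add parseval has_sum_cmult_right has_sum_infsum E)
    show "0 \<le> ((T ^^ n) (z0 - u) \<bullet> e)\<^sup>2 + \<kappa> * (S e \<bullet> e)" for e using \<kappa>0 posS by simp
  qed
  finally have le: "(\<integral>\<^sup>+\<omega>. ennreal ((norm (\<zeta> n \<omega> - u))\<^sup>2) \<partial>M) \<le> ennreal B" .
  show int: "integrable M (\<lambda>\<omega>. (norm (\<zeta> n \<omega> - u))\<^sup>2)"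
    by (rule integrableI_bounded[OF m2]) (use le in \<open>simp add: le_less_trans[OF _ ennreal_less_top]\<close>)
  have "ennreal (\<integral>\<omega>. (norm (\<zeta> n \<omega> - u))\<^sup>2 \<partial>M) \<le> ennreal B"
    using le nn_integral_eq_integral[OF int] by simp
  then have "(\<integral>\<omega>. (norm (\<zeta> n \<omega> - u))\<^sup>2 \<partial>M) \<le> B" using B0 by (simp add: ennreal_le_iff)
  then show "(\<integral>\<omega>. (norm (\<zeta> n \<omega> - u))\<^sup>2 \<partial>M) \<le> (norm ((T ^^ n) (z0 - u)))\<^sup>2
      + \<gamma>\<^sup>2 / (2 * \<alpha>) * (\<Sum>j<n. 1 / real (Suc j)) * (\<Sum>\<^sub>\<infinity>e\<in>E. S e \<bullet> e)"
    by (simp only: B_def \<kappa>_def)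
qed

end

text \<open>The sum is at most 1 + ln n, and 1 \<le> 2 ln n for n \<ge> 2 because ln 2 \<ge>
  1/2.\<close>

lemma harmonic_sum_le:
  assumes "2 \<le> n"
  shows "(\<Sum>j<n. 1 / real (Suc j)) \<le> 3 * ln (real n)"
proof -
  have "(\<Sum>j<Suc m. 1 / real (Suc j)) \<le> 1 + ln (real (Suc m))" for m
  proof (induction m)
    case (Suc m)
    have "ln (real (Suc m) / real (Suc (Suc m))) \<le> real (Suc m) / real (Suc (Suc m)) - 1"
      by (rule ln_le_minus_one) simp
    also have "\<dots> = - (1 / real (Suc (Suc m)))" by (simp add: field_simps)
    also have "ln (real (Suc m) / real (Suc (Suc m))) = ln (real (Suc m)) - ln (real (Suc (Suc m)))"
      by (simp add: ln_div del: of_nat_Suc)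
    finally show ?case using Suc by simp
  qed simp
  from this[of "n - 1"] have "(\<Sum>j<n. 1 / real (Suc j)) \<le> 1 + ln (real n)" using assms by simp
  moreover have "1 \<le> 2 * ln (real n)"
  proof -
    have "ln (2::real) \<le> ln (real n)" using assms by (subst ln_le_cancel_iff) auto
    moreover have "1 / 2 \<le> ln (2::real)" using ln_le_minus_one[of "1 / 2 :: real"] by (simp add: ln_div)
    ultimately show ?thesis by linarith
  qed
  ultimately show ?thesis by linarith
qed

theorem theorem5:
  fixes A :: "'x::{real_inner,banach} \<Rightarrow> 'y::{real_inner,banach}"
    and S :: "'x \<Rightarrow> 'x" and u z0 :: 'x and a c s :: real
  assumes "compact_operator A"
    and "assumption_A A S u z0 a c s"
  shows
    "(\<exists>C. \<forall>(M :: 'w measure) \<gamma> \<alpha> y \<zeta>.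
        prob_space M \<and> 0 < \<gamma> \<and> 0 < \<alpha> \<and> data_model M A u \<gamma> y \<and> threedvar M A S \<alpha> z0 y \<zeta> \<longrightarrow>
        (\<forall>n\<ge>2.
           integrable M (\<lambda>\<omega>. (norm (\<zeta> n \<omega> - u))\<^sup>2) \<and>
           (\<integral>\<omega>. (norm (\<zeta> n \<omega> - u))\<^sup>2 \<partial>M) \<le>
             C * (\<alpha> / real n) powr (s / (a + 1)) + C * (\<gamma>\<^sup>2 * ln (real n) / \<alpha>) * op_trace S)) \<and>
     (\<exists>C'. \<forall>(M :: 'w measure) \<gamma> N \<alpha> y \<zeta>.
        prob_space M \<and> 0 < \<gamma> \<and> N \<ge> 2 \<and> \<alpha> = real N powr (s / (s + a + 1)) \<and>
        data_model M A u \<gamma> y \<and> threedvar M A S \<alpha> z0 y \<zeta> \<longrightarrow>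
        integrable M (\<lambda>\<omega>. (norm (\<zeta> N \<omega> - u))\<^sup>2) \<and>
        (\<integral>\<omega>. (norm (\<zeta> N \<omega> - u))\<^sup>2 \<partial>M) \<le>
          C' * (1 + \<gamma>\<^sup>2 * op_trace S) * real N powr (- (s / (s + a + 1))) * ln (real N))"
proof -
  have S: "positive_selfadjoint S" "inj S" "trace_class_pos S" and a: "0 < a"
    and s: "0 \<le> s" "s \<le> a + 2" and src: "z0 - u \<in> op_power_dom S (- s / 2)"
    using assms(2) by (auto simp: assumption_A_def)
  \<comment> \<open>The very basis that \<open>op_trace\<close> picks, so the trace is literally the
    sum over \<open>E\<close>.\<close>
  define E :: "'x set" where "E = (SOME E. orthonormal_basis E)"
  have E: "orthonormal_basis E"
    using S(3) unfolding E_def trace_class_pos_def by (metis someI_ex)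
  have sE: "(\<lambda>e. S e \<bullet> e) summable_on E" by (rule trace_class_summable_on_basis[OF S E])
  have cE: "countable E" by (rule trace_class_basis_countable[OF S E])
  have tr: "op_trace S = (\<Sum>\<^sub>\<infinity>e\<in>E. S e \<bullet> e)" by (simp add: op_trace_def E_def)
  have tr0: "0 \<le> op_trace S" unfolding tr by (intro infsum_nonneg psa_pos[OF S(1)])
  obtain B where B: "\<And>F. finite F \<Longrightarrow> F \<subseteq> pos_eigenvalues S \<Longrightarrow>
      (\<Sum>l\<in>F. l powr (- s) * (norm (orth_proj (eigenspace S l) (z0 - u)))\<^sup>2) \<le> B"
    using op_power_dom_bound[OF S src] by auto
  have B0: "0 \<le> B" using B[of "{}"] by simp
  \<comment> \<open>The first entry covers the bias; 2 exceeds the variance constant 3/2, which is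
    half of the harmonic constant. \<open>B\<close> depends only on \<open>S\<close>,
    \<open>s\<close> and \<open>z0 - u\<close>, so \<open>C\<close> is fixed before \<gamma>,
    \<alpha> and \<open>n\<close>.\<close>
  define C where "C = max (8 * c ^ 4 * B) 2"
  have C: "8 * c ^ 4 * B \<le> C" "2 \<le> C" by (auto simp: C_def)
  have bound: "integrable M (\<lambda>\<omega>. (norm (\<zeta> n \<omega> - u))\<^sup>2) \<and>
      (\<integral>\<omega>. (norm (\<zeta> n \<omega> - u))\<^sup>2 \<partial>M) \<le>
        C * (\<alpha> / real n) powr (s / (a + 1)) + C * (\<gamma>\<^sup>2 * ln (real n) / \<alpha>) * op_trace S"
    if M: "prob_space M" "0 < \<gamma>" and \<alpha>: "0 < \<alpha>" and D: "data_model M A u \<gamma> y" "threedvar M A S \<alpha> z0 y \<zeta>"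
      and n: "2 \<le> n" for M :: "'w measure" and \<gamma> \<alpha> y \<zeta> n
  proof -
    interpret linked A S \<alpha> "pos_eigenvalues S" "\<lambda>l. orth_proj (eigenspace S l)" a c
      by (rule assumption_A_linked[OF assms \<alpha>])
    note mse = threedvar_mean_square_error[OF M D E cE sE, of n]
    have "(norm ((T ^^ n) (z0 - u)))\<^sup>2 \<le> 8 * c ^ 4 * B * (\<alpha> / real n) powr (s / (a + 1))"
      by (rule T_pow_source[OF s n B])
    also have "\<dots> \<le> C * (\<alpha> / real n) powr (s / (a + 1))" by (intro mult_right_mono C) auto
    finally have 1: "(norm ((T ^^ n) (z0 - u)))\<^sup>2 \<le> C * (\<alpha> / real n) powr (s / (a + 1))" .
    have "\<gamma>\<^sup>2 / (2 * \<alpha>) * (\<Sum>j<n. 1 / real (Suc j)) * op_trace S \<le> \<gamma>\<^sup>2 / (2 * \<alpha>) * (3 * ln (real n)) * op_trace S"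
      using \<alpha> tr0 by (intro mult_right_mono mult_left_mono harmonic_sum_le n) auto
    also have "\<dots> = 3 / 2 * ((\<gamma>\<^sup>2 * ln (real n) / \<alpha>) * op_trace S)" by simp
    also have "\<dots> \<le> C * ((\<gamma>\<^sup>2 * ln (real n) / \<alpha>) * op_trace S)"
      using \<alpha> tr0 C(2) n by (intro mult_right_mono mult_nonneg_nonneg divide_nonneg_nonneg) auto
    finally have 2: "\<gamma>\<^sup>2 / (2 * \<alpha>) * (\<Sum>j<n. 1 / real (Suc j)) * op_trace S \<le> C * (\<gamma>\<^sup>2 * ln (real n) / \<alpha>) * op_trace S"
      by (simp only: mult.assoc)
    have "(\<integral>\<omega>. (norm (\<zeta> n \<omega> - u))\<^sup>2 \<partial>M) \<le>
        C * (\<alpha> / real n) powr (s / (a + 1)) + C * (\<gamma>\<^sup>2 * ln (real n) / \<alpha>) * op_trace S"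
      using mse(2)[folded tr] 1 2 by linarith
    with mse(1) show ?thesis by (rule conjI)
  qed
  \<comment> \<open>For N \<ge> 2 both 1 and ln N are at most ln N / ln 2, the latter because ln 2
    \<le> 1.\<close>
  define C' where "C' = C / ln 2"
  have final: "integrable M (\<lambda>\<omega>. (norm (\<zeta> N \<omega> - u))\<^sup>2) \<and>
      (\<integral>\<omega>. (norm (\<zeta> N \<omega> - u))\<^sup>2 \<partial>M) \<le>
        C' * (1 + \<gamma>\<^sup>2 * op_trace S) * real N powr (- (s / (s + a + 1))) * ln (real N)"
    if M: "prob_space M" "0 < \<gamma>" and N: "2 \<le> N" and \<alpha>: "\<alpha> = real N powr (s / (s + a + 1))"
      and D: "data_model M A u \<gamma> y" "threedvar M A S \<alpha> z0 y \<zeta>" for M :: "'w measure" and \<gamma> \<alpha> y \<zeta> N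
  proof -
    define q where "q = s / (s + a + 1)"
    have \<alpha>0: "0 < \<alpha>" using N \<alpha> by simp
    \<comment> \<open>This \<alpha> balances the two terms: the bias factor and 1 / \<alpha> both
      become \<open>real N powr (- q)\<close>.\<close>
    have "\<alpha> / real N = real N powr (q - 1)" using N by (simp add: \<alpha> q_def powr_diff)
    also have "q - 1 = - ((a + 1) / (s + a + 1))" using s(1) a by (simp add: q_def field_simps)
    finally have "(\<alpha> / real N) powr (s / (a + 1)) = real N powr (- ((a + 1) / (s + a + 1)) * (s / (a + 1)))"
      by (simp only: powr_powr)
    also have "- ((a + 1) / (s + a + 1)) * (s / (a + 1)) = - q" using a by (simp add: q_def)
    finally have e1: "(\<alpha> / real N) powr (s / (a + 1)) = real N powr (- q)" .
    have e2: "\<gamma>\<^sup>2 * ln (real N) / \<alpha> = \<gamma>\<^sup>2 * (real N powr (- q) * ln (real N))"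
      by (simp add: \<alpha> q_def powr_minus_divide)
    have ln: "0 < ln (2::real)" "ln 2 \<le> ln (real N)" using N by (auto simp: ln_le_cancel_iff)
    have l1: "1 \<le> ln (real N) / ln 2" using ln by simp
    have l2: "ln (real N) \<le> ln (real N) / ln 2"
    proof -
      have "ln (2::real) \<le> 1" using ln_le_minus_one[of "2::real"] by simp
      then have "ln (real N) * ln 2 \<le> ln (real N) * 1" using ln by (intro mult_left_mono) linarith+
      then show ?thesis using ln(1) by (simp add: pos_le_divide_eq)
    qed
    have "C * (\<alpha> / real N) powr (s / (a + 1)) + C * (\<gamma>\<^sup>2 * ln (real N) / \<alpha>) * op_trace S
        = C * real N powr (- q) * (1 + \<gamma>\<^sup>2 * op_trace S * ln (real N))"
      unfolding e1 e2 by (simp add: algebra_simps)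
    also have "\<dots> \<le> C * real N powr (- q) * (ln (real N) / ln 2 + \<gamma>\<^sup>2 * op_trace S * (ln (real N) / ln 2))"
      using l1 l2 tr0 C(2) by (intro mult_left_mono add_mono) auto
    also have "\<dots> = C' * (1 + \<gamma>\<^sup>2 * op_trace S) * real N powr (- q) * ln (real N)"
      by (simp add: C'_def distrib_left distrib_right add_divide_distrib mult_ac)
    finally have le: "C * (\<alpha> / real N) powr (s / (a + 1)) + C * (\<gamma>\<^sup>2 * ln (real N) / \<alpha>) * op_trace S
      \<le> C' * (1 + \<gamma>\<^sup>2 * op_trace S) * real N powr (- (s / (s + a + 1))) * ln (real N)" unfolding q_def .
    note b = bound[OF M \<alpha>0 D N]
    show ?thesis using conjunct1[OF b] order_trans[OF conjunct2[OF b] le] by (rule conjI)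
  qed
  show ?thesis
  proof (rule conjI, goal_cases)
    case 1
    show ?case by (rule exI[of _ C], intro allI impI, elim conjE) (rule bound)
  next
    case 2
    show ?case by (rule exI[of _ C'], intro allI impI, elim conjE) (rule final)
  qed
qed

end
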